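(* Let $\mathfrak g$ be of type $D_{n+1}^{(2)}$, $A_{2n}^{(2)}$, $A_{2n}^{(2)\dagger}$ or $C_n^{(1)}$, let $1\le r\le n$, $s\ge1$, and let $\lambda$ be a prescribed weight for $(r,s)$, i.e.: $\lambda=s\overline\Lambda_n$ if $r=n$ and $\mathfrak g\in\{D_{n+1}^{(2)},C_n^{(1)}\}$; otherwise $\lambda=\sum_{i=1}^rm_i\mu_i\overline\Lambda_i$ with $m_i\in\mathbb Z_{\ge0}$, $\sum_{i=1}^rm_i\le s$, $s-m_r\in\gamma'\mathbb Z$ and $m_i\in\gamma'\mathbb Z$ for $1\le i\le r-1$. Then there is a unique $U_q(\overline{\mathfrak g})$-crystal embedding $\iota_\lambda:V(\lambda)\to V^{r,s}$ defined by $b'\mapsto b$ where $b'=\mathbb P(b)$. Moreover, on $\mathrm{Im}(\iota_\lambda)$ the virtual intrinsic energy $D_{V^{r,s}}$ agrees with the prescribed intrinsic energy: it is constantly $0$ if $r=n$ and $\mathfrak g\in\{D_{n+1}^{(2)},C_n^{(1)}\}$, and constantly $(\overline\Lambda_n\,|\,\lambda-s\mu_r\overline\Lambda_r)$ otherwise.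
   Context: $A_{2n}^{(2)}$ is labeled so that $\delta=2\alpha_0+\cdots+2\alpha_{n-1}+\alpha_n$, and $A_{2n}^{(2)\dagger}$ is the same algebra labeled so that $\delta=\alpha_0+2\alpha_1+\cdots+2\alpha_n$. $n\ge2$ for $D_{n+1}^{(2)},C_n^{(1)}$; $n\ge1$ otherwise. $\overline{\mathfrak g}=B_n,C_n,B_n,C_n$ for $D_{n+1}^{(2)},A_{2n}^{(2)},A_{2n}^{(2)\dagger},C_n^{(1)}$, with fundamental weights $\overline\Lambda_i$. $(\gamma,\gamma')=(1,1),(2,1),(1,2),(2,2)$ for $D_{n+1}^{(2)},A_{2n}^{(2)},A_{2n}^{(2)\dagger},C_n^{(1)}$ respectively. $\mu_i=2$ if $\mathfrak g=A_{2n}^{(2)\dagger}$ and $i=n$, and $\mu_i=1$ otherwise. $(\cdot|\cdot)$ is the standard bilinear form on the weight lattice normalized by $(\delta|\lambda)=\langle c,\lambda\rangle$, $c$ the canonical central element; explicitly, for the weights above with $r<n$ or $\mathfrak g\in\{A_{2n}^{(2)},A_{2n}^{(2)\dagger}\}$, $(\overline\Lambda_n|\lambda-s\mu_r\overline\Lambda_r)=\frac1{\gamma'}\bigl(\sum_{j=1}^rjm_j-rs\bigr)$. TYPE A CRYSTALS. $\varnothing$ means "undefined". Tensor convention: $f_i(b_2\otimes b_1)=f_i(b_2)\otimes b_1$ if $\epsilon_i(b_2)\ge\varphi_i(b_1)$ and $b_2\otimes f_i(b_1)$ otherwise; $e_i(b_2\otimes b_1)=e_i(b_2)\otimes b_1$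 if $\epsilon_i(b_2)>\varphi_i(b_1)$ and $b_2\otimes e_i(b_1)$ otherwise. Letters are $[2n]$ with $f_i^A(i)=i+1$ ($1\le i\le 2n-1$), all other values $\varnothing$; words are tensor products of letters; a semistandard tableau is identified with its column-reading word $c_1c_2\cdots$, $c_j$ being the strictly decreasing word of the $j$-th column. $\mathbb P(w)$ is the Schensted tableau of $w$ (the unique semistandard tableau Knuth equivalent to $w$); for $b=b_2\otimes b_1$, $\mathbb P(b)=\mathbb P(b_2b_1)$. $B_A^{r,s}$ is the set of semistandard tableaux in $[2n]$ of rectangular shape with $r$ rows and $s$ columns. The bijection $\psi$ of $B_A^{r,s}$ is such that $\psi^{-1}(t)$ is obtained by deleting the letters $1$ from $t$, applying $\mathbb P$, subtracting $1$ from all entries, and filling the remaining cells of the rectangle with $2n$; $e_0^A=\psi^{-1}e_1^A\psi$, $f_0^A=\psi^{-1}f_1^A\psi$ on $B_A^{r,s}$, extended to tensor products by the tensor rule. VIRTUAL CRYSTALS. Virtual operators: $e_0=(e_0^A)^{\gamma'}$, $e_i=e_{2n-i}^Ae_i^A$ ($1\le i\le n-1$), $e_n=(e_n^A)^\gamma$, and similarly $f_i$. $\Psi(\overline\Lambda_i)=\overline\Lambda_i^A+\overline\Lambda_{2n-i}^A$ for $i<n$, $\Psi(\overline\Lambda_n)=\gamma\overline\Lambda_n^A$; virtual weight: $\Psi(\mathrm{wt}(b))=\mathrm{wt}_A(b)$. Ambient crystals: $\widehat V^{r,s}=B_A^{2n-r,s}\otimes B_A^{r,s}$ if $r<n$;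 $\widehat V^{n,s}=B_A^{n,s}$ for $D_{n+1}^{(2)}$, $B_A^{n,s}\otimes B_A^{n,s}$ for $A_{2n}^{(2)}$ and $A_{2n}^{(2)\dagger}$, $B_A^{n,2s}$ for $C_n^{(1)}$. $V^{r,s}\subset\widehat V^{r,s}$ is the subset generated by the virtual operators $e_i,f_i$, $0\le i\le n$, from the tensor product of the tableaux whose $i$-th row consists of letters $i$. $V(\lambda)$: the subset of the crystal of semistandard tableaux of shape $\lambda^A$ generated by the virtual operators $e_i,f_i$, $1\le i\le n$, from the tableau whose $i$-th row consists of letters $i$; here $\lambda^A$ is the partition with at most $2n$ parts corresponding to the $A_{2n-1}$-weight $\Psi(\lambda)$, with columns of height $2n$ included so that $|\lambda^A|$ is the number of letters of an element of $\widehat V^{r,s}$. Virtual intrinsic energy: $D_{V^{r,s}}=\frac1{\gamma'}D_{\widehat V^{r,s}}|_{V^{r,s}}$, where $D_{\widehat V^{r,s}}=0$ if $\widehat V^{r,s}$ has a single tensor factor, and if $\widehat V^{r,s}=B_A^{2n-r,s}\otimes B_A^{r,s}$ then $D_{\widehat V^{r,s}}(b_2\otimes b_1)=-rs+d$, $d$ the number of cells of the shape of $\mathbb P(b_2b_1)$ strictly to the right of column $s$. *)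

theory Defs
  imports Complex_Main "HOL-Library.FuncSet"
begin

section \<open>Crystal operators and the tensor product rule\<close>

text \<open>The undefined value of a crystal operator is \<^term>\<open>None\<close>.\<close>

type_synonym 'b operator = "'b \<Rightarrow> 'b option"

definition iterate :: "'b operator \<Rightarrow> nat \<Rightarrow> 'b operator" where
  "iterate g k b = ((\<lambda>x. Option.bind x g) ^^ k) (Some b)"

text \<open>With \<open>g = e\<^sub>i\<close> this is \<open>\<epsilon>\<^sub>i(b)\<close>, with \<open>g = f\<^sub>i\<close> it is \<open>\<phi>\<^sub>i(b)\<close>.\<close>

definition string_length :: "'b operator \<Rightarrow> 'b \<Rightarrow> nat" where
  "string_length g b = (GREATEST k. iterate g k b \<noteq> None)"

text \<open>
  A tensor \<open>b\<^sub>k \<otimes> \<dots> \<otimes> b\<^sub>1\<close> is the list \<open>[b\<^sub>k, \<dots>, b\<^sub>1]\<close>.  The operators \<open>e\<close>, \<open>f\<close> act on a single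
  factor, \<open>E\<close>, \<open>F\<close> on the tensor product of all factors but the leftmost one.
\<close>

fun cons_e :: "'b operator \<Rightarrow> 'b list operator \<Rightarrow> 'b list operator \<Rightarrow> 'b list operator" where
  "cons_e e E F [] = None"
| "cons_e e E F (b # bs) =
     (if string_length e b > string_length F bs
      then map_option (\<lambda>c. c # bs) (e b)
      else map_option (\<lambda>cs. b # cs) (E bs))"

fun cons_f :: "'b operator \<Rightarrow> 'b operator \<Rightarrow> 'b list operator \<Rightarrow> 'b list operator" where
  "cons_f e f F [] = None"
| "cons_f e f F (b # bs) =
     (if string_length e b \<ge> string_length F bs
      then map_option (\<lambda>c. c # bs) (f b)
      else map_option (\<lambda>cs. b # cs) (F bs))"

text \<open>
  The recursion is on the number of factors, since the string lengths of the right hand part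
  require the operator on all elements of the smaller tensor power.
\<close>

primrec power_f :: "'b operator \<Rightarrow> 'b operator \<Rightarrow> nat \<Rightarrow> 'b list operator" where
  "power_f e f 0 = (\<lambda>_. None)"
| "power_f e f (Suc k) = cons_f e f (power_f e f k)"

primrec power_e :: "'b operator \<Rightarrow> 'b operator \<Rightarrow> nat \<Rightarrow> 'b list operator" where
  "power_e e f 0 = (\<lambda>_. None)"
| "power_e e f (Suc k) = cons_e e (power_e e f k) (power_f e f k)"

definition tensor_e :: "'b operator \<Rightarrow> 'b operator \<Rightarrow> 'b list operator" where
  "tensor_e e f bs = power_e e f (length bs) bs"

definition tensor_f :: "'b operator \<Rightarrow> 'b operator \<Rightarrow> 'b list operator" where
  "tensor_f e f bs = power_f e f (length bs) bs"

inductive_set generated :: "'b operator set \<Rightarrow> 'b \<Rightarrow> 'b set" for G u where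
  base: "u \<in> generated G u"
| step: "b \<in> generated G u \<Longrightarrow> g \<in> G \<Longrightarrow> g b = Some c \<Longrightarrow> c \<in> generated G u"


section \<open>Words and semistandard tableaux\<close>

definition letter_e :: "nat \<Rightarrow> nat \<Rightarrow> nat operator" where
  "letter_e n i a = (if 1 \<le> i \<and> i \<le> 2 * n - 1 \<and> a = i + 1 then Some i else None)"

definition letter_f :: "nat \<Rightarrow> nat \<Rightarrow> nat operator" where
  "letter_f n i a = (if 1 \<le> i \<and> i \<le> 2 * n - 1 \<and> a = i then Some (i + 1) else None)"

definition word_e :: "nat \<Rightarrow> nat \<Rightarrow> nat list operator" where
  "word_e n i = tensor_e (letter_e n i) (letter_f n i)"

definition word_f :: "nat \<Rightarrow> nat \<Rightarrow> nat list operator" where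
  "word_f n i = tensor_f (letter_e n i) (letter_f n i)"

text \<open>
  The columns of a semistandard tableau, from left to right; each column is listed from bottom to
  top, so the entry in row \<open>k + 1\<close> of column \<open>c\<close> is \<open>rev c ! k\<close>.
\<close>

definition semistandard :: "nat list list \<Rightarrow> bool" where
  "semistandard cs \<longleftrightarrow>
     (\<forall>c \<in> set cs. c \<noteq> [] \<and> sorted_wrt (>) c) \<and>
     (\<forall>j. Suc j < length cs \<longrightarrow>
        length (cs ! Suc j) \<le> length (cs ! j) \<and>
        (\<forall>k < length (cs ! Suc j). rev (cs ! j) ! k \<le> rev (cs ! Suc j) ! k))"

text \<open>
  A tableau is identified with its column reading word.  The columns are recovered from the word
  as its maximal strictly decreasing factors.
\<close>

definition tableaux :: "nat list set" where
  "tableaux = {concat cs | cs. semistandard cs}"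

definition columns :: "nat list \<Rightarrow> nat list list" where
  "columns t = (THE cs. semistandard cs \<and> concat cs = t)"

inductive knuth_step :: "nat list \<Rightarrow> nat list \<Rightarrow> bool" where
  "x < y \<Longrightarrow> y \<le> z \<Longrightarrow> knuth_step (u @ [y, x, z] @ v) (u @ [y, z, x] @ v)"
| "x \<le> y \<Longrightarrow> y < z \<Longrightarrow> knuth_step (u @ [x, z, y] @ v) (u @ [z, x, y] @ v)"

definition schensted :: "nat list \<Rightarrow> nat list" where
  "schensted w = (THE t. t \<in> tableaux \<and> equivclp knuth_step w t)"

definition highest_column :: "nat \<Rightarrow> nat list" where
  "highest_column h = rev [1..<Suc h]"

text \<open>The tableau with \<open>p i\<close> cells in row \<open>i\<close>, all filled with \<open>i\<close>, for a partition \<open>p\<close> with at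
  most \<open>N\<close> parts, indexed from 1.\<close>

definition highest_tableau :: "nat \<Rightarrow> (nat \<Rightarrow> nat) \<Rightarrow> nat list" where
  "highest_tableau N p =
     concat (map (\<lambda>j. highest_column (card {i \<in> {1..N}. j \<le> p i})) [1..<Suc (p 1)])"


section \<open>Type A affine crystals on rectangular tableaux\<close>

definition rectangular :: "nat \<Rightarrow> nat \<Rightarrow> nat \<Rightarrow> nat list set" where
  "rectangular n r s =
     {concat cs | cs. semistandard cs \<and> length cs = s \<and>
        (\<forall>c \<in> set cs. length c = r \<and> set c \<subseteq> {1..2 * n})}"

text \<open>
  \<open>fill_rectangle\<close> adds the missing cells at the bottom of the \<open>s\<close> columns, that is, at the front
  of the column words.
\<close>

definition fill_rectangle :: "nat \<Rightarrow> nat \<Rightarrow> nat \<Rightarrow> nat list \<Rightarrow> nat list" where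
  "fill_rectangle a r s t =
     (let cs = columns t
      in concat (map (\<lambda>c. replicate (r - length c) a @ c)
           (cs @ replicate (s - length cs) [])))"

definition psi_inv :: "nat \<Rightarrow> nat \<Rightarrow> nat \<Rightarrow> nat list \<Rightarrow> nat list" where
  "psi_inv n r s t =
     fill_rectangle (2 * n) r s (map (\<lambda>a. a - 1) (schensted (filter (\<lambda>a. a \<noteq> 1) t)))"

definition psi :: "nat \<Rightarrow> nat \<Rightarrow> nat \<Rightarrow> nat list \<Rightarrow> nat list" where
  "psi n r s = the_inv_into (rectangular n r s) (psi_inv n r s)"

text \<open>On a rectangular tableau the size of the rectangle is read off from the tableau itself.\<close>

definition num_rows :: "nat list \<Rightarrow> nat" where
  "num_rows t = length (hd (columns t))"

definition num_cols :: "nat list \<Rightarrow> nat" where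
  "num_cols t = length (columns t)"

definition e_A :: "nat \<Rightarrow> nat \<Rightarrow> nat list operator" where
  "e_A n i t =
     (if i = 0
      then map_option (psi_inv n (num_rows t) (num_cols t))
             (word_e n 1 (psi n (num_rows t) (num_cols t) t))
      else word_e n i t)"

definition f_A :: "nat \<Rightarrow> nat \<Rightarrow> nat list operator" where
  "f_A n i t =
     (if i = 0
      then map_option (psi_inv n (num_rows t) (num_cols t))
             (word_f n 1 (psi n (num_rows t) (num_cols t) t))
      else word_f n i t)"

definition wt_A :: "nat \<Rightarrow> nat list \<Rightarrow> nat \<Rightarrow> int" where
  "wt_A n w j =
     (if j \<in> {1..2 * n - 1} then int (count_list w j) - int (count_list w (j + 1)) else 0)"


section \<open>Affine types and classical weights\<close>

text \<open>\<open>D2\<close>, \<open>A2\<close>, \<open>A2_dagger\<close>, \<open>C1\<close> stand for the types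
  \<open>D\<^bsub>n+1\<^esub>\<^bsup>(2)\<^esup>\<close>, \<open>A\<^bsub>2n\<^esub>\<^bsup>(2)\<^esup>\<close>, \<open>A\<^bsub>2n\<^esub>\<^bsup>(2)\<dagger>\<^esup>\<close>, \<open>C\<^sub>n\<^bsup>(1)\<^esup>\<close>.\<close>

datatype affine_type = D2 | A2 | A2_dagger | C1

definition valid_rank :: "affine_type \<Rightarrow> nat \<Rightarrow> bool" where
  "valid_rank g n \<longleftrightarrow> (if g \<in> {D2, C1} then n \<ge> 2 else n \<ge> 1)"

fun gam :: "affine_type \<Rightarrow> nat" where
  "gam D2 = 1" | "gam A2 = 2" | "gam A2_dagger = 1" | "gam C1 = 2"

fun gam' :: "affine_type \<Rightarrow> nat" where
  "gam' D2 = 1" | "gam' A2 = 1" | "gam' A2_dagger = 2" | "gam' C1 = 2"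

definition mu :: "affine_type \<Rightarrow> nat \<Rightarrow> nat \<Rightarrow> nat" where
  "mu g n i = (if g = A2_dagger \<and> i = n then 2 else 1)"

text \<open>Weights are given by their coefficients with respect to the fundamental weights, indexed
  from 1 and vanishing beyond the rank.\<close>

definition fund :: "nat \<Rightarrow> nat \<Rightarrow> int" where
  "fund i j = (if j = i then 1 else 0)"

definition Psi :: "affine_type \<Rightarrow> nat \<Rightarrow> (nat \<Rightarrow> int) \<Rightarrow> nat \<Rightarrow> int" where
  "Psi g n w j =
     (\<Sum>i = 1..n. w i * (if i < n then fund i j + fund (2 * n - i) j
                        else int (gam g) * fund n j))"

text \<open>
  The fundamental weight \<open>\<Lambda>\<^sub>i\<close> of \<open>B\<^sub>n\<close> (types \<open>D2\<close>, \<open>A2_dagger\<close>) or \<open>C\<^sub>n\<close> (types \<open>A2\<close>, \<open>C1\<close>) is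
  \<open>\<epsilon>\<^sub>1 + \<dots> + \<epsilon>\<^sub>i\<close>, except for \<open>\<Lambda>\<^sub>n = (\<epsilon>\<^sub>1 + \<dots> + \<epsilon>\<^sub>n) / 2\<close> in type \<open>B\<^sub>n\<close>.
\<close>

definition fund_eps :: "affine_type \<Rightarrow> nat \<Rightarrow> nat \<Rightarrow> nat \<Rightarrow> rat" where
  "fund_eps g n i k =
     (if 1 \<le> k \<and> k \<le> i then (if g \<in> {D2, A2_dagger} \<and> i = n then 1 / 2 else 1) else 0)"

definition weight_eps :: "affine_type \<Rightarrow> nat \<Rightarrow> (nat \<Rightarrow> int) \<Rightarrow> nat \<Rightarrow> rat" where
  "weight_eps g n w k = (\<Sum>i = 1..n. of_int (w i) * fund_eps g n i k)"

text \<open>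
  The value of \<open>(\<epsilon>\<^sub>k | \<epsilon>\<^sub>k)\<close>.  The normalization \<open>(\<delta>|\<lambda>) = \<langle>c,\<lambda>\<rangle>\<close> amounts to
  \<open>(\<alpha>\<^sub>i|\<alpha>\<^sub>i) = 2 a\<^sub>i\<^sup>\<or> / a\<^sub>i\<close> with the Kac labels \<open>\<delta> = \<Sum> a\<^sub>i \<alpha>\<^sub>i\<close>, \<open>c = \<Sum> a\<^sub>i\<^sup>\<or> \<alpha>\<^sub>i\<^sup>\<or>\<close>, and
  \<open>\<alpha>\<^sub>n\<close> is \<open>\<epsilon>\<^sub>n\<close> for \<open>B\<^sub>n\<close> and \<open>2 \<epsilon>\<^sub>n\<close> for \<open>C\<^sub>n\<close>.  The pairs \<open>(a\<^sub>n, a\<^sub>n\<^sup>\<or>)\<close> are, in this order,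
  \<open>(1, 1)\<close>, \<open>(1, 2)\<close>, \<open>(2, 1)\<close>, \<open>(1, 1)\<close>.
\<close>

fun eps_norm :: "affine_type \<Rightarrow> rat" where
  "eps_norm D2 = 2" | "eps_norm A2 = 1" | "eps_norm A2_dagger = 1" | "eps_norm C1 = 1 / 2"

definition bilinear_form ::
    "affine_type \<Rightarrow> nat \<Rightarrow> (nat \<Rightarrow> int) \<Rightarrow> (nat \<Rightarrow> int) \<Rightarrow> rat" where
  "bilinear_form g n v w = eps_norm g * (\<Sum>k = 1..n. weight_eps g n v k * weight_eps g n w k)"

lemma weight_eps_comb:
  assumes "r \<le> n"
  shows "weight_eps g n (\<lambda>j. \<Sum>i = 1..r. c i * fund i j) k = (\<Sum>i = 1..r. of_int (c i) * fund_eps g n i k)"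
proof -
  have "(\<Sum>i = 1..r. c i * fund i j) = (\<Sum>i = 1..r. if i = j then c j else 0)" for j
    by (intro sum.cong) (auto simp: fund_def)
  then have "(\<Sum>i = 1..r. c i * fund i j) = (if j \<in> {1..r} then c j else 0)" for j
    by simp
  then have "weight_eps g n (\<lambda>j. \<Sum>i = 1..r. c i * fund i j) k =
        (\<Sum>j = 1..n. if j \<in> {1..r} then of_int (c j) * fund_eps g n j k else 0)"
    unfolding weight_eps_def by (intro sum.cong) auto
  also have "\<dots> = (\<Sum>i = 1..r. of_int (c i) * fund_eps g n i k)"
    using assms by (subst sum.inter_restrict [symmetric]) (auto intro!: sum.cong)
  finally show ?thesis .
qed

lemma bilinear_form_fund:
  assumes "1 \<le> i" "i \<le> n" "i < n \<or> g \<in> {A2, A2_dagger}"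
  shows "eps_norm g * (\<Sum>k = 1..n. fund_eps g n n k * (of_nat (mu g n i) * fund_eps g n i k)) =
         of_nat i / of_nat (gam' g)"
proof -
  let ?x = "if g \<in> {D2, A2_dagger} then 1 / 2 else 1 :: rat"
  let ?y = "if g \<in> {D2, A2_dagger} \<and> i = n then 1 / 2 else 1 :: rat"
  have "(\<Sum>k = 1..n. fund_eps g n n k * (of_nat (mu g n i) * fund_eps g n i k)) =
        (\<Sum>k = 1..n. if k \<in> {1..i} then ?x * (of_nat (mu g n i) * ?y) else 0)"
    by (intro sum.cong) (auto simp: fund_eps_def)
  also have "\<dots> = (\<Sum>k = 1..i. ?x * (of_nat (mu g n i) * ?y))"
    using assms by (subst sum.inter_restrict [symmetric]) (auto intro!: sum.cong)
  finally show ?thesis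
    using assms by (cases g) (auto simp: mu_def)
qed

lemma bilinear_form_explicit:
  assumes "1 \<le> r" "r \<le> n" "r < n \<or> g \<in> {A2, A2_dagger}"
  shows "bilinear_form g n (fund n)
           (\<lambda>j. (\<Sum>i = 1..r. int (m i * mu g n i) * fund i j) - int (s * mu g n r) * fund r j) =
         (of_nat (\<Sum>i = 1..r. i * m i) - of_nat (r * s)) / of_nat (gam' g)"
proof -
  define c where "c i = int (m i) - (if i = r then int s else 0)" for i
  have "(\<Sum>i = 1..r. int (m i * mu g n i) * fund i j) - int (s * mu g n r) * fund r j =
        (\<Sum>i = 1..r. (c i * int (mu g n i)) * fund i j)" for j
  proof -
    have "(\<Sum>i = 1..r. (c i * int (mu g n i)) * fund i j) =
          (\<Sum>i = 1..r. int (m i * mu g n i) * fund i j - (if i = r then int (s * mu g n r) * fund r j else 0))"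
      by (intro sum.cong) (auto simp: c_def algebra_simps)
    then show ?thesis using assms by (simp add: sum_subtractf)
  qed
  then have w: "(\<lambda>j. (\<Sum>i = 1..r. int (m i * mu g n i) * fund i j) - int (s * mu g n r) * fund r j) =
        (\<lambda>j. \<Sum>i = 1..r. (c i * int (mu g n i)) * fund i j)" by auto
  have n: "weight_eps g n (fund n) k = fund_eps g n n k" for k
  proof -
    have "weight_eps g n (fund n) k = (\<Sum>i = 1..n. if i = n then fund_eps g n n k else 0)"
      unfolding weight_eps_def by (intro sum.cong) (auto simp: fund_def)
    then show ?thesis using assms by simp
  qed
  have "bilinear_form g n (fund n) (\<lambda>j. \<Sum>i = 1..r. (c i * int (mu g n i)) * fund i j) =
        eps_norm g * (\<Sum>k = 1..n. \<Sum>i = 1..r.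
          of_int (c i) * (fund_eps g n n k * (of_nat (mu g n i) * fund_eps g n i k)))"
    unfolding bilinear_form_def n weight_eps_comb [OF assms(2)] sum_distrib_left
    by (intro sum.cong) (auto simp: algebra_simps)
  also have "\<dots> = (\<Sum>i = 1..r. of_int (c i) *
          (eps_norm g * (\<Sum>k = 1..n. fund_eps g n n k * (of_nat (mu g n i) * fund_eps g n i k))))"
    by (subst sum.swap) (simp add: sum_distrib_left mult.left_commute)
  also have "\<dots> = (\<Sum>i = 1..r. of_int (c i) * (of_nat i / of_nat (gam' g)))"
    using assms by (intro sum.cong refl, subst bilinear_form_fund) auto
  also have "\<dots> = (\<Sum>i = 1..r. of_nat (i * m i) / of_nat (gam' g) -
                     (if i = r then of_nat (r * s) / of_nat (gam' g) else 0))"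
    by (intro sum.cong) (auto simp: c_def algebra_simps diff_divide_distrib)
  also have "\<dots> = (of_nat (\<Sum>i = 1..r. i * m i) - of_nat (r * s)) / of_nat (gam' g)"
    using assms by (simp add: sum_subtractf sum_divide_distrib diff_divide_distrib)
  finally show ?thesis unfolding w .
qed

definition spin_case :: "affine_type \<Rightarrow> nat \<Rightarrow> nat \<Rightarrow> bool" where
  "spin_case g n r \<longleftrightarrow> r = n \<and> g \<in> {D2, C1}"

definition prescribed_weight :: "affine_type \<Rightarrow> nat \<Rightarrow> nat \<Rightarrow> nat \<Rightarrow> (nat \<Rightarrow> int) \<Rightarrow> bool" where
  "prescribed_weight g n r s w \<longleftrightarrow>
     (if spin_case g n r then w = (\<lambda>j. int s * fund n j)
      else \<exists>m :: nat \<Rightarrow> nat.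
             w = (\<lambda>j. \<Sum>i = 1..r. int (m i * mu g n i) * fund i j) \<and>
             (\<Sum>i = 1..r. m i) \<le> s \<and>
             int (gam' g) dvd int s - int (m r) \<and>
             (\<forall>i \<in> {1..r - 1}. gam' g dvd m i))"

definition prescribed_energy :: "affine_type \<Rightarrow> nat \<Rightarrow> nat \<Rightarrow> nat \<Rightarrow> (nat \<Rightarrow> int) \<Rightarrow> rat" where
  "prescribed_energy g n r s w =
     (if spin_case g n r then 0
      else bilinear_form g n (fund n) (\<lambda>j. w j - int (s * mu g n r) * fund r j))"


section \<open>Virtual crystals\<close>

text \<open>\<open>opA i\<close> is the family of type A operators, the result the family of virtual ones.\<close>

definition virtual :: "affine_type \<Rightarrow> nat \<Rightarrow> (nat \<Rightarrow> 'b operator) \<Rightarrow> nat \<Rightarrow> 'b operator" where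
  "virtual g n opA i =
     (if i = 0 then iterate (opA 0) (gam' g)
      else if i < n then (\<lambda>b. Option.bind (opA i b) (opA (2 * n - i)))
      else iterate (opA n) (gam g))"

definition virtual_wt :: "affine_type \<Rightarrow> nat \<Rightarrow> nat list \<Rightarrow> nat \<Rightarrow> int" where
  "virtual_wt g n w = (THE v. (\<forall>i. i \<notin> {1..n} \<longrightarrow> v i = 0) \<and> Psi g n v = wt_A n w)"

record 'b crystal =
  carrier :: "'b set"
  e_op :: "nat \<Rightarrow> 'b operator"
  f_op :: "nat \<Rightarrow> 'b operator"
  wt :: "'b \<Rightarrow> nat \<Rightarrow> int"

definition crystal_embedding ::
    "nat set \<Rightarrow> 'b crystal \<Rightarrow> 'c crystal \<Rightarrow> ('b \<Rightarrow> 'c) \<Rightarrow> bool" where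
  "crystal_embedding I B C \<iota> \<longleftrightarrow>
     \<iota> \<in> carrier B \<rightarrow> carrier C \<and> inj_on \<iota> (carrier B) \<and>
     (\<forall>b \<in> carrier B.
        wt C (\<iota> b) = wt B b \<and>
        (\<forall>i \<in> I.
           string_length (e_op C i) (\<iota> b) = string_length (e_op B i) b \<and>
           string_length (f_op C i) (\<iota> b) = string_length (f_op B i) b \<and>
           e_op C i (\<iota> b) = map_option \<iota> (e_op B i b) \<and>
           f_op C i (\<iota> b) = map_option \<iota> (f_op B i b)))"

text \<open>The rectangles (rows, columns) of the tensor factors of the ambient crystal, from left to
  right.\<close>

definition ambient :: "affine_type \<Rightarrow> nat \<Rightarrow> nat \<Rightarrow> nat \<Rightarrow> (nat \<times> nat) list" where
  "ambient g n r s =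
     (if r < n then [(2 * n - r, s), (r, s)]
      else (case g of
              D2 \<Rightarrow> [(n, s)]
            | A2 \<Rightarrow> [(n, s), (n, s)]
            | A2_dagger \<Rightarrow> [(n, s), (n, s)]
            | C1 \<Rightarrow> [(n, 2 * s)]))"

definition ambient_e :: "affine_type \<Rightarrow> nat \<Rightarrow> nat \<Rightarrow> nat list list operator" where
  "ambient_e g n = virtual g n (\<lambda>i. tensor_e (e_A n i) (f_A n i))"

definition ambient_f :: "affine_type \<Rightarrow> nat \<Rightarrow> nat \<Rightarrow> nat list list operator" where
  "ambient_f g n = virtual g n (\<lambda>i. tensor_f (e_A n i) (f_A n i))"

definition ambient_highest :: "affine_type \<Rightarrow> nat \<Rightarrow> nat \<Rightarrow> nat \<Rightarrow> nat list list" where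
  "ambient_highest g n r s =
     map (\<lambda>(a, b). highest_tableau (2 * n) (\<lambda>i. if 1 \<le> i \<and> i \<le> a then b else 0)) (ambient g n r s)"

text \<open>The virtual crystal \<open>V\<^bsup>r,s\<^esup>\<close>.\<close>

definition V_rect :: "affine_type \<Rightarrow> nat \<Rightarrow> nat \<Rightarrow> nat \<Rightarrow> nat list list crystal" where
  "V_rect g n r s =
     \<lparr>carrier = generated (ambient_e g n ` {0..n} \<union> ambient_f g n ` {0..n}) (ambient_highest g n r s),
      e_op = ambient_e g n,
      f_op = ambient_f g n,
      wt = (\<lambda>b. virtual_wt g n (concat b))\<rparr>"

definition num_letters :: "affine_type \<Rightarrow> nat \<Rightarrow> nat \<Rightarrow> nat \<Rightarrow> nat" where
  "num_letters g n r s = (\<Sum>(a, b) \<leftarrow> ambient g n r s. a * b)"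

text \<open>The partition with at most \<open>2n\<close> parts and \<open>N\<close> cells belonging to \<open>\<Psi>(w)\<close>.\<close>

definition partition_A :: "affine_type \<Rightarrow> nat \<Rightarrow> nat \<Rightarrow> (nat \<Rightarrow> int) \<Rightarrow> nat \<Rightarrow> nat" where
  "partition_A g n N w =
     (THE p. (\<forall>j. j \<notin> {1..2 * n} \<longrightarrow> p j = 0) \<and>
             (\<forall>j \<in> {1..2 * n - 1}. int (p j) - int (p (j + 1)) = Psi g n w j) \<and>
             (\<Sum>j = 1..2 * n. p j) = N)"

text \<open>The crystal \<open>V(w)\<close>, realized by tableaux with \<open>N\<close> cells.\<close>

definition V_weight :: "affine_type \<Rightarrow> nat \<Rightarrow> nat \<Rightarrow> (nat \<Rightarrow> int) \<Rightarrow> nat list crystal" where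
  "V_weight g n N w =
     \<lparr>carrier = generated (virtual g n (word_e n) ` {1..n} \<union> virtual g n (word_f n) ` {1..n})
                  (highest_tableau (2 * n) (partition_A g n N w)),
      e_op = virtual g n (word_e n),
      f_op = virtual g n (word_f n),
      wt = virtual_wt g n\<rparr>"

definition ambient_energy :: "nat \<Rightarrow> nat \<Rightarrow> nat list list \<Rightarrow> int" where
  "ambient_energy r s b =
     (if length b = 1 then 0
      else int (\<Sum>c \<leftarrow> drop s (columns (schensted (concat b))). length c) - int (r * s))"

definition virtual_energy :: "affine_type \<Rightarrow> nat \<Rightarrow> nat \<Rightarrow> nat list list \<Rightarrow> rat" where
  "virtual_energy g r s b = of_int (ambient_energy r s b) / of_nat (gam' g)"

text \<open>
  The crystal embedding \<open>\<iota> : V(w) \<rightarrow> V\<^bsup>r,s\<^esup>\<close> defined by \<open>b' \<mapsto> b\<close> where \<open>b'\<close> is the Schensted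
  tableau of \<open>b\<close>: \<open>\<iota> b'\<close> is the one and only element of \<open>V\<^bsup>r,s\<^esup>\<close> with this property.
  Extensionality makes \<open>\<iota>\<close> determined by its values on \<open>V(w)\<close>.
\<close>

definition is_iota ::
    "affine_type \<Rightarrow> nat \<Rightarrow> nat \<Rightarrow> nat \<Rightarrow> (nat \<Rightarrow> int) \<Rightarrow> (nat list \<Rightarrow> nat list list) \<Rightarrow> bool" where
  "is_iota g n r s w \<iota> \<longleftrightarrow>
     (let L = V_weight g n (num_letters g n r s) w; V = V_rect g n r s
      in \<iota> \<in> extensional (carrier L) \<and>
         crystal_embedding {1..n} L V \<iota> \<and>
         (\<forall>b' \<in> carrier L. \<forall>b \<in> carrier V. \<iota> b' = b \<longleftrightarrow> schensted (concat b) = b'))"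

end

theory Submission
  imports Defs "HOL-Library.Multiset"
begin

text \<open>
  The idea is to work with the type A operators on words only.  They commute with Knuth
  equivalence (\<open>crystal_eq_keq\<close>), hence so do the virtual operators of positive index.  If \<open>b\<close> lies in the ambient
  crystal and \<open>b'\<close> is its Schensted tableau, the same virtual operator applied to both
  gives such a pair again or is undefined on both.  So \<open>\<iota>\<close>, read as a section of the Schensted
  map, commutes with all operators as soon as it exists, and two things remain to be
  shown (\<open>iota_exists_unique\<close>): the Schensted map is injective on the ambient crystal, and
  some element of \<open>V\<^bsup>r,s\<^esup>\<close> lies above the highest tableau of \<open>V(\<lambda>)\<close>.

  The combinatorics of tableaux comes from the crystal as well.  Raising operators bring every word to a
  highest one, a highest word is Knuth equivalent to a tableau that is determined by the
  content of the word (\<open>highest_word_keq_canonical\<close>), and lowering operators bring this tableau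
  back.  So every Knuth class contains exactly one tableau (\<open>schensted_eq_iff\<close>).

  For the injectivity, raise \<open>t\<^sub>2 \<otimes> t\<^sub>1\<close> to a highest element.  Then \<open>t\<^sub>1\<close> is the highest rectangle
  with \<open>r\<close> rows, and \<open>t\<^sub>2\<close> is killed by \<open>e\<^sub>i\<close> for all \<open>i \<noteq> r\<close>.  In a rectangular tableau with this
  property every column consists of an initial segment of \<open>{1..r}\<close> and an initial segment of
  \<open>{r+1..}\<close> (\<open>levi_classification\<close>), so the tableau is determined by its content and
  \<open>t\<^sub>2 \<otimes> t\<^sub>1\<close> by its Schensted tableau (\<open>rect_pair_inj\<close>).
  The same classification with \<open>r = 1\<close> shows that a rectangular tableau can be recovered from
  what remains after deletion of its ones; therefore \<open>\<psi>\<close> is a bijection, and \<open>e\<^sub>0\<close>, \<open>f\<^sub>0\<close> preserve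
  rectangles.

  In the spin case the generator of \<open>V\<^bsup>r,s\<^esup>\<close> itself lies above the highest tableau.  Otherwise let
  \<open>t\<^sub>2\<close> have \<open>m\<^sub>k\<close> columns \<open>{1..k} \<union> {r+1..2n-k}\<close> for \<open>1 \<le> k \<le> r\<close> and \<open>s - \<Sum> m\<^sub>k\<close> columns with
  \<open>k = 0\<close>.  With \<open>t\<^sub>1\<close> as above, \<open>t\<^sub>2 \<otimes> t\<^sub>1\<close> is a highest element of weight \<open>\<Psi>(\<lambda>)\<close>.  It is reached from the
  generator, where all columns have \<open>k = r\<close>: for \<open>k = r-1, \<dots>, 0\<close> in turn, the last \<open>q\<close> columns
  pass from \<open>k + 1\<close> to \<open>k\<close>.  Here the zero operator removes the ones of these columns and
  adds letters \<open>2n\<close> at the bottom, and the virtual operators \<open>e\<^sub>1, \<dots>, e\<^sub>k\<close> move the resulting gaps into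
  place (\<open>vertex_step\<close>).  Since the virtual \<open>e\<^sub>0\<close> is the \<open>\<gamma>'\<close>-th power of the one of type A, the number
  \<open>q\<close> has to be divisible by \<open>\<gamma>'\<close>, and that is what the conditions on the \<open>m\<^sub>i\<close> provide.

  All tableaux in \<open>V(\<lambda>)\<close> have the shape of the highest one.  Its columns beyond column \<open>s\<close> are
  \<open>m\<^sub>k\<close> of height \<open>k\<close>, which gives the energy.
\<close>

section \<open>The bracketing rule on words\<close>

text \<open>
  The pair of both string lengths is the image of a word in the bicyclic monoid.  Natural number
  subtraction is truncated; it counts the brackets left over when two words are joined.
\<close>

fun eps :: "nat \<Rightarrow> nat list \<Rightarrow> nat" and phi :: "nat \<Rightarrow> nat list \<Rightarrow> nat" where
  "eps i [] = 0"
| "eps i (x # w) = eps i w + (of_bool (x = Suc i) - phi i w)"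
| "phi i [] = 0"
| "phi i (x # w) = of_bool (x = i) + (phi i w - of_bool (x = Suc i))"

text \<open>
  The operators \<open>e\<^sub>i\<close> and \<open>f\<^sub>i\<close> on words, by the tensor rule for a letter and the rest of the word.
  They are defined for every index, so that the rank disappears from all statements about words.
\<close>

fun raise :: "nat \<Rightarrow> nat list operator" where
  "raise i [] = None"
| "raise i (x # w) =
     (if of_bool (x = Suc i) > phi i w then Some (i # w) else map_option ((#) x) (raise i w))"

fun lower :: "nat \<Rightarrow> nat list operator" where
  "lower i [] = None"
| "lower i (x # w) =
     (if of_bool (x = Suc i) \<ge> phi i w then (if x = i then Some (Suc i # w) else None)
      else map_option ((#) x) (lower i w))"

lemma eps_phi_append:
  "eps i (u @ v) = eps i v + (eps i u - phi i v) \<and> phi i (u @ v) = phi i u + (phi i v - eps i u)"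
  by (induction u) auto

lemma eps_append: "eps i (u @ v) = eps i v + (eps i u - phi i v)"
  and phi_append: "phi i (u @ v) = phi i u + (phi i v - eps i u)"
  using eps_phi_append by auto

lemma raise_None_iff: "raise i w = None \<longleftrightarrow> eps i w = 0"
  by (induction w) auto

lemma lower_None_iff: "lower i w = None \<longleftrightarrow> phi i w = 0"
  by (induction w) auto

lemma append_Nil_fun: "(@) [] = (\<lambda>x. x)"
  by auto

lemma raise_append:
  "raise i (u @ v) =
     (if eps i u > phi i v then map_option (\<lambda>u'. u' @ v) (raise i u)
      else map_option (\<lambda>v'. u @ v') (raise i v))"
  by (induction u) (auto simp: phi_append option.map_comp comp_def option.map_ident append_Nil_fun)

lemma lower_append:
  "lower i (u @ v) =
     (if eps i u \<ge> phi i v then map_option (\<lambda>u'. u' @ v) (lower i u)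
      else map_option (\<lambda>v'. u @ v') (lower i v))"
  by (induction u)
    (auto simp: phi_append option.map_comp comp_def option.map_ident append_Nil_fun lower_None_iff)

lemma raise_Some:
  "raise i w = Some w' \<Longrightarrow>
     eps i w = Suc (eps i w') \<and> phi i w' = Suc (phi i w) \<and> lower i w' = Some w"
  by (induction w arbitrary: w') (auto split: if_splits)

lemma lower_Some:
  "lower i w = Some w' \<Longrightarrow>
     phi i w = Suc (phi i w') \<and> eps i w' = Suc (eps i w) \<and> raise i w' = Some w"
  by (induction w arbitrary: w') (auto split: if_splits)

lemma raise_length: "raise i w = Some w' \<Longrightarrow> length w' = length w"
  by (induction w arbitrary: w') (auto split: if_splits)

lemma lower_length: "lower i w = Some w' \<Longrightarrow> length w' = length w"
  by (induction w arbitrary: w') (auto split: if_splits)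

lemma raise_sum_list: "raise i w = Some w' \<Longrightarrow> sum_list w = Suc (sum_list w')"
  by (induction w arbitrary: w') (auto split: if_splits simp: of_bool_def)

lemma raise_set: "raise i w = Some w' \<Longrightarrow> set w' \<subseteq> insert i (set w) \<and> Suc i \<in> set w"
  by (induction w arbitrary: w') (auto split: if_splits simp: of_bool_def)

lemma lower_set: "lower i w = Some w' \<Longrightarrow> set w' \<subseteq> insert (Suc i) (set w) \<and> i \<in> set w"
  by (induction w arbitrary: w') (auto split: if_splits)


lemma iterate_0 [simp]: "iterate g 0 b = Some b"
  by (simp add: iterate_def)

lemma iterate_Suc: "iterate g (Suc k) b = Option.bind (g b) (iterate g k)"
proof -
  have *: "((\<lambda>x. Option.bind x g) ^^ k) None = None" for k
    by (induction k) auto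
  show ?thesis
    unfolding iterate_def by (cases "g b") (auto simp: funpow_swap1 * simp del: funpow.simps simp: funpow_Suc_right)
qed

text \<open>
  A counter that drops by one with every application, and vanishes exactly where the
  operator stops, is the string length.  The invariant \<open>Q\<close> restricts this to the elements of
  interest.
\<close>

lemma string_length_eqI:
  assumes "Q b"
    and stop: "\<And>b. Q b \<Longrightarrow> g b = None \<longleftrightarrow> h b = 0"
    and step: "\<And>b c. Q b \<Longrightarrow> g b = Some c \<Longrightarrow> Q c \<and> h b = Suc (h c)"
  shows "string_length g b = h b"
proof -
  have it: "iterate g k b \<noteq> None \<longleftrightarrow> k \<le> h b" if "Q b" for k b
    using that
  proof (induction k arbitrary: b)
    case (Suc k)
    then show ?case
      using stop [of b] step [of b]
      by (cases "g b") (auto simp: iterate_Suc)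
  qed auto
  show ?thesis
    unfolding string_length_def it [OF assms(1)] by (rule Greatest_equality) auto
qed

lemma string_length_raise: "string_length (raise i) w = eps i w"
  by (rule string_length_eqI [where Q = "\<lambda>_. True"]) (auto simp: raise_None_iff dest: raise_Some)

lemma string_length_lower: "string_length (lower i) w = phi i w"
  by (rule string_length_eqI [where Q = "\<lambda>_. True"]) (auto simp: lower_None_iff dest: lower_Some)

lemma power_letters:
  assumes "1 \<le> i" "i \<le> 2 * n - 1" "length w = k"
  shows "power_e (letter_e n i) (letter_f n i) k w = raise i w"
    and "power_f (letter_e n i) (letter_f n i) k w = lower i w"
proof -
  have letter: "string_length (letter_e n i) x = of_bool (x = Suc i)" for x
    by (rule string_length_eqI [where Q = "\<lambda>_. True"]) (use assms in \<open>auto simp: letter_e_def split: if_splits\<close>)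
  have "power_e (letter_e n i) (letter_f n i) k w = raise i w \<and>
        power_f (letter_e n i) (letter_f n i) k w = lower i w"
    using assms(3)
  proof (induction k arbitrary: w)
    case (Suc k)
    obtain x v where w: "w = x # v" "length v = k"
      using Suc.prems by (cases w) auto
    have "string_length (power_f (letter_e n i) (letter_f n i) k) v = phi i v"
      by (rule string_length_eqI [where Q = "\<lambda>u. length u = k"])
         (use w Suc.IH in \<open>auto simp: lower_None_iff dest: lower_Some lower_length\<close>)
    then show ?case
      using Suc.IH [OF w(2)] assms by (auto simp: w letter letter_e_def [of n i x] letter_f_def [of n i x])
  qed auto
  then show "power_e (letter_e n i) (letter_f n i) k w = raise i w"
    and "power_f (letter_e n i) (letter_f n i) k w = lower i w" by auto
qed

lemma word_e_eq: "1 \<le> i \<Longrightarrow> i \<le> 2 * n - 1 \<Longrightarrow> word_e n i = raise i"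
  and word_f_eq: "1 \<le> i \<Longrightarrow> i \<le> 2 * n - 1 \<Longrightarrow> word_f n i = lower i"
  by (auto simp: word_e_def word_f_def tensor_e_def tensor_f_def power_letters fun_eq_iff)

section \<open>Knuth equivalence\<close>

abbreviation keq :: "nat list \<Rightarrow> nat list \<Rightarrow> bool" where
  "keq \<equiv> equivclp knuth_step"

lemma keq_refl [simp, intro!]: "keq w w"
  by (simp add: equivclp_refl)

lemma keq_sym: "keq v w \<Longrightarrow> keq w v"
  by (rule equivclp_sym)

lemma keq_trans [trans]: "keq u v \<Longrightarrow> keq v w \<Longrightarrow> keq u w"
  by (rule equivclp_trans)

lemma keq_knuth1: "x < y \<Longrightarrow> y \<le> z \<Longrightarrow> keq [y, x, z] [y, z, x]"
  using knuth_step.intros(1) [of x y z "[]" "[]"] by auto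

lemma keq_knuth2: "x \<le> y \<Longrightarrow> y < z \<Longrightarrow> keq [x, z, y] [z, x, y]"
  using knuth_step.intros(2) [of x y z "[]" "[]"] by auto

lemma keq_context: "keq a b \<Longrightarrow> keq (u @ a @ v) (u @ b @ v)"
proof (induction rule: equivclp_induct)
  case (step b c)
  have "knuth_step (u @ a @ v) (u @ b @ v)" if "knuth_step a b" for a b
    using that
  proof cases
    case (1 x y z u' v')
    then show ?thesis using knuth_step.intros(1) [of x y z "u @ u'" "v' @ v"] by simp
  next
    case (2 x y z u' v')
    then show ?thesis using knuth_step.intros(2) [of x y z "u @ u'" "v' @ v"] by simp
  qed
  then have "keq (u @ b @ v) (u @ c @ v)"
    using step.hyps(2) by (meson equivclp_sym r_into_equivclp)
  with step.IH show ?case by (rule keq_trans)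
qed auto

lemma keq_append: "keq a b \<Longrightarrow> keq c d \<Longrightarrow> keq (a @ c) (b @ d)"
  using keq_context [of a b "[]" c] keq_context [of c d b "[]"] by (auto intro: keq_trans)

lemma keq_Cons: "keq a b \<Longrightarrow> keq (x # a) (x # b)"
  using keq_context [of a b "[x]" "[]"] by simp

text \<open>
  Two words that the crystal operators cannot tell apart, up to Knuth equivalence.
\<close>

definition crystal_eq :: "nat list \<Rightarrow> nat list \<Rightarrow> bool" where
  "crystal_eq v w \<longleftrightarrow> (\<forall>i. eps i v = eps i w \<and> phi i v = phi i w \<and>
     rel_option keq (raise i v) (raise i w) \<and> rel_option keq (lower i v) (lower i w))"

text \<open>
  For three letters this is a finite check: only the position of each letter relative to \<open>i\<close>
  and \<open>Suc i\<close> matters.  One elementary relation may turn into the other one.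
\<close>

lemma crystal_eq_knuth1: 
  assumes "x < y" "y \<le> z" shows "crystal_eq [y, x, z] [y, z, x]"
proof -
  have *: "x = i \<or> x = Suc i \<or> x \<noteq> i \<and> x \<noteq> Suc i" for x i :: nat by auto
  show ?thesis
    unfolding crystal_eq_def
    apply (intro allI)
    subgoal for i
      using *[of x i] *[of y i] *[of z i] assms
      by (elim disjE) (auto intro: keq_knuth1 keq_knuth2 keq_sym)
    done
qed

lemma crystal_eq_knuth2: 
  assumes "x \<le> y" "y < z" shows "crystal_eq [x, z, y] [z, x, y]"
proof -
  have *: "x = i \<or> x = Suc i \<or> x \<noteq> i \<and> x \<noteq> Suc i" for x i :: nat by auto
  show ?thesis
    unfolding crystal_eq_def
    apply (intro allI)
    subgoal for i
      using *[of x i] *[of y i] *[of z i] assms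
      by (elim disjE) (auto intro: keq_knuth1 keq_knuth2 keq_sym)
    done
qed

text \<open>
  In a longer word the operator acts in the left part, in the middle or in the right part, and
  the string lengths decide which.  They agree for both words.
\<close>

lemma crystal_eq_context:
  assumes "crystal_eq a b" "keq a b" shows "crystal_eq (u @ a @ v) (u @ b @ v)"
proof -
  have ab: "eps i a = eps i b" "phi i a = phi i b" "rel_option keq (raise i a) (raise i b)"
    "rel_option keq (lower i a) (lower i b)" for i
    using assms(1) by (auto simp: crystal_eq_def)
  show ?thesis
    unfolding crystal_eq_def
  proof (intro allI)
    fix i
    show "eps i (u @ a @ v) = eps i (u @ b @ v) \<and> phi i (u @ a @ v) = phi i (u @ b @ v) \<and>
     rel_option keq (raise i (u @ a @ v)) (raise i (u @ b @ v)) \<and>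
     rel_option keq (lower i (u @ a @ v)) (lower i (u @ b @ v))"
      using ab [of i] keq_context [OF assms(2), of u] keq_context [of _ _ u v] keq_context [OF assms(2), of _ v]
      by (auto simp: eps_append phi_append raise_append lower_append option.rel_map
           intro!: option.rel_refl_strong elim!: option.rel_mono_strong)
  qed
qed

lemma crystal_eq_keq: "keq v w \<Longrightarrow> crystal_eq v w"
proof (induction rule: equivclp_induct)
  case base
  then show ?case by (auto simp: crystal_eq_def intro!: option.rel_refl)
next
  case (step b c)
  have sym: "crystal_eq c b" if "crystal_eq b c" for b c
    using that unfolding crystal_eq_def by (metis (mono_tags, lifting) keq_sym option.rel_flip option.rel_mono_strong conversep_iff)
  have "crystal_eq b c" if "knuth_step b c" for b c
    using that
  proof cases
    case (1 x y z u v)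
    then show ?thesis
      using crystal_eq_context [OF crystal_eq_knuth1 keq_knuth1, of x y z u v] by simp
  next
    case (2 x y z u v)
    then show ?thesis
      using crystal_eq_context [OF crystal_eq_knuth2 keq_knuth2, of x y z u v] by simp
  qed
  then have "crystal_eq b c" using step.hyps(2) sym by blast
  with step.IH show ?case
    unfolding crystal_eq_def by (metis (mono_tags, opaque_lifting) keq_trans option.rel_transp transp_def)
qed

lemma keq_eps: "keq v w \<Longrightarrow> eps i v = eps i w"
  and keq_phi: "keq v w \<Longrightarrow> phi i v = phi i w"
  and keq_raise: "keq v w \<Longrightarrow> rel_option keq (raise i v) (raise i w)"
  and keq_lower: "keq v w \<Longrightarrow> rel_option keq (lower i v) (lower i w)"
  using crystal_eq_keq by (auto simp: crystal_eq_def)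

lemma keq_mset: "keq v w \<Longrightarrow> mset v = mset w"
proof (induction rule: equivclp_induct)
  case (step b c)
  have "knuth_step b c \<Longrightarrow> mset b = mset c" for b c
    by (induction rule: knuth_step.induct) auto
  then show ?case using step by metis
qed auto

lemma keq_set: "keq v w \<Longrightarrow> set v = set w"
  by (metis keq_mset set_mset_mset)

lemma keq_count: "keq v w \<Longrightarrow> count_list v x = count_list w x"
  by (metis count_mset keq_mset)

section \<open>Columns and tableaux\<close>

abbreviation column :: "nat list \<Rightarrow> bool" where
  "column \<equiv> sorted_wrt (>)"

lemma column_eps_phi:
  assumes "column c"
  shows "eps i c = of_bool (Suc i \<in> set c \<and> i \<notin> set c) \<and>
         phi i c = of_bool (i \<in> set c \<and> Suc i \<notin> set c)"
  using assms
proof (induction c)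
  case (Cons x c)
  then show ?case by (cases "x = i"; cases "x = Suc i") (auto simp: of_bool_def)
qed auto

lemma column_eps: "column c \<Longrightarrow> eps i c = of_bool (Suc i \<in> set c \<and> i \<notin> set c)"
  and column_phi: "column c \<Longrightarrow> phi i c = of_bool (i \<in> set c \<and> Suc i \<notin> set c)"
  using column_eps_phi by auto

lemma column_raise:
  assumes "column c" "Suc i \<in> set c" "i \<notin> set c"
  shows "raise i c = Some (map (\<lambda>x. if x = Suc i then i else x) c)"
  using assms
proof (induction c)
  case (Cons x c)
  show ?case
  proof (cases "x = Suc i")
    case True
    then have "map (\<lambda>x. if x = Suc i then i else x) c = c"
      using Cons.prems by (auto intro!: map_idI)
    then show ?thesis using True Cons.prems by (auto simp: column_phi)
  next
    case False
    then show ?thesis using Cons by auto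
  qed
qed auto

lemma column_lower:
  assumes "column c" "i \<in> set c" "Suc i \<notin> set c"
  shows "lower i c = Some (map (\<lambda>x. if x = i then Suc i else x) c)"
  using assms
proof (induction c)
  case (Cons x c)
  show ?case
  proof (cases "x = i")
    case True
    then have "map (\<lambda>x. if x = i then Suc i else x) c = c"
      using Cons.prems by (auto intro!: map_idI)
    then show ?thesis using True Cons.prems by (auto simp: column_phi)
  next
    case False
    then show ?thesis using Cons by (auto simp: column_phi)
  qed
qed auto

lemma column_map:
  assumes "column c" "\<And>x y. x \<in> set c \<Longrightarrow> y \<in> set c \<Longrightarrow> x < y \<Longrightarrow> h x < (h y :: nat)"
  shows "column (map h c)"
  using assms by (induction c) auto

lemma column_raise_column:
  assumes "column c" "Suc i \<in> set c" "i \<notin> set c"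
  shows "column (map (\<lambda>x. if x = Suc i then i else x) c)"
proof (rule column_map [OF assms(1)])
  fix x y assume "x \<in> set c" "y \<in> set c" "x < y"
  then show "(if x = Suc i then i else x) < (if y = Suc i then i else y)"
    using assms(3) by (cases "x = i") auto
qed

lemma column_lower_column:
  assumes "column c" "i \<in> set c" "Suc i \<notin> set c"
  shows "column (map (\<lambda>x. if x = i then Suc i else x) c)"
proof (rule column_map [OF assms(1)])
  fix x y assume "x \<in> set c" "y \<in> set c" "x < y"
  then show "(if x = i then Suc i else x) < (if y = i then Suc i else y)"
    using assms(3) by (cases "y = Suc i") auto
qed

lemma column_rev_less: "column c \<Longrightarrow> k < l \<Longrightarrow> l < length c \<Longrightarrow> rev c ! k < rev c ! l"
proof -
  assume "column c" "k < l" "l < length c"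
  then have "sorted_wrt (<) (rev c)" by (simp add: sorted_wrt_rev)
  then show ?thesis using \<open>k < l\<close> \<open>l < length c\<close> by (simp add: sorted_wrt_iff_nth_less)
qed

lemma column_rev_less_iff:
  assumes "column c" "k < length c" "l < length c"
  shows "rev c ! k < rev c ! l \<longleftrightarrow> k < l"
  using column_rev_less [OF assms(1), of k l] column_rev_less [OF assms(1), of l k] assms(2,3)
  by (cases k l rule: linorder_cases) auto

lemma in_set_rev_nth: "x \<in> set c \<longleftrightarrow> (\<exists>k<length c. rev c ! k = x)"
  using in_set_conv_nth [of x "rev c"] by simp

definition col_le :: "nat list \<Rightarrow> nat list \<Rightarrow> bool" where
  "col_le c d \<longleftrightarrow> length d \<le> length c \<and> (\<forall>k < length d. rev c ! k \<le> rev d ! k)"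

text \<open>
  Semistandard except that empty columns are admitted at the end.  Deleting letters from a
  rectangle may empty some of its columns, and the number of columns is still to be remembered then.
\<close>

definition weak_ss :: "nat list list \<Rightarrow> bool" where
  "weak_ss cs \<longleftrightarrow> (\<forall>c \<in> set cs. column c) \<and> successively col_le cs"

lemma successively_iff_nth: "successively P xs \<longleftrightarrow> (\<forall>j. Suc j < length xs \<longrightarrow> P (xs ! j) (xs ! Suc j))"
proof (induction xs)
  case (Cons x xs)
  show ?case
    unfolding successively_Cons Cons.IH by (cases xs) (auto simp: nth_Cons split: nat.splits)
qed auto

lemma semistandard_iff: "semistandard cs \<longleftrightarrow> weak_ss cs \<and> [] \<notin> set cs"
  unfolding semistandard_def weak_ss_def successively_iff_nth col_le_def by blast

lemma weak_ss_Nil [simp]: "weak_ss []"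
  by (simp add: weak_ss_def)

lemma weak_ss_appendD: "weak_ss (as @ bs) \<Longrightarrow> weak_ss as \<and> weak_ss bs"
  by (auto simp: weak_ss_def successively_append_iff)

lemma weak_ss_Cons:
  "weak_ss (c # cs) \<longleftrightarrow> column c \<and> weak_ss cs \<and> (cs \<noteq> [] \<longrightarrow> col_le c (hd cs))"
  by (auto simp: weak_ss_def successively_Cons)

lemma weak_ss_middle:
  "weak_ss (as @ c # bs) \<longleftrightarrow> weak_ss as \<and> column c \<and> weak_ss bs \<and>
     (as \<noteq> [] \<longrightarrow> col_le (last as) c) \<and> (bs \<noteq> [] \<longrightarrow> col_le c (hd bs))"
  by (auto simp: weak_ss_def successively_append_iff successively_Cons)

text \<open>
  Locates the column in which the operator acts, with the inequalities that the tensor rule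
  leaves behind on both sides of it.
\<close>

lemma raise_concat:
  assumes "raise i (concat cs) = Some w" 
  obtains as c c' bs where "cs = as @ c # bs" "raise i c = Some c'" "w = concat (as @ c' # bs)"
    "eps i c > phi i (concat bs)" "eps i (concat as) \<le> phi i (concat (c # bs))"
proof -
  have "\<exists>as c c' bs. cs = as @ c # bs \<and> raise i c = Some c' \<and> w = concat (as @ c' # bs) \<and>
    eps i c > phi i (concat bs) \<and> eps i (concat as) \<le> phi i (concat (c # bs))"
    using assms
  proof (induction cs arbitrary: w)
    case (Cons d cs)
    show ?case
    proof (cases "eps i d > phi i (concat cs)")
      case True
      then obtain d' where "raise i d = Some d'" "w = d' @ concat cs"
        using Cons.prems by (auto simp: raise_append)
      then show ?thesis using True by (intro exI [of _ "[]"] exI [of _ d] exI [of _ d'] exI [of _ cs]) auto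
    next
      case False
      then obtain v where v: "raise i (concat cs) = Some v" "w = d @ v"
        using Cons.prems by (auto simp: raise_append)
      then obtain as c c' bs where *: "cs = as @ c # bs" "raise i c = Some c'" "v = concat (as @ c' # bs)"
        "eps i c > phi i (concat bs)" "eps i (concat as) \<le> phi i (concat (c # bs))"
        using Cons.IH by blast
      then have "eps i (d @ concat as) \<le> phi i (concat (c # bs))"
        using False by (auto simp: eps_append phi_append)
      then show ?thesis using * v
        by (intro exI [of _ "d # as"] exI [of _ c] exI [of _ c'] exI [of _ bs]) auto
    qed
  qed auto
  then show thesis using that by blast
qed

lemma lower_concat:
  assumes "lower i (concat cs) = Some w" 
  obtains as c c' bs where "cs = as @ c # bs" "lower i c = Some c'" "w = concat (as @ c' # bs)"
    "eps i c \<ge> phi i (concat bs)" 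
proof -
  have "\<exists>as c c' bs. cs = as @ c # bs \<and> lower i c = Some c' \<and> w = concat (as @ c' # bs) \<and>
    eps i c \<ge> phi i (concat bs)"
    using assms
  proof (induction cs arbitrary: w)
    case (Cons d cs)
    show ?case
    proof (cases "eps i d \<ge> phi i (concat cs)")
      case True
      then obtain d' where "lower i d = Some d'" "w = d' @ concat cs"
        using Cons.prems by (auto simp: lower_append)
      then show ?thesis using True by (intro exI [of _ "[]"] exI [of _ d] exI [of _ d'] exI [of _ cs]) auto
    next
      case False
      then obtain v where v: "lower i (concat cs) = Some v" "w = d @ v"
        using Cons.prems by (auto simp: lower_append)
      then obtain as c c' bs where *: "cs = as @ c # bs" "lower i c = Some c'" "v = concat (as @ c' # bs)"
        "eps i c \<ge> phi i (concat bs)"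
        using Cons.IH by blast
      then show ?thesis using v
        by (intro exI [of _ "d # as"] exI [of _ c] exI [of _ c'] exI [of _ bs]) auto
    qed
  qed auto
  then show thesis using that by blast
qed

lemma column_raiseD:
  assumes "column c" "raise i c = Some c'"
  shows "Suc i \<in> set c" "i \<notin> set c" "c' = map (\<lambda>x. if x = Suc i then i else x) c"
    "column c'" "eps i c = 1" "phi i c = 0"
proof -
  have "eps i c \<noteq> 0" using assms(2) raise_None_iff [of i c] by auto
  then show 1: "Suc i \<in> set c" "i \<notin> set c" using assms(1) by (auto simp: column_eps)
  then show "c' = map (\<lambda>x. if x = Suc i then i else x) c" "column c'" "eps i c = 1" "phi i c = 0"
    using assms column_raise [OF assms(1) 1] column_raise_column [OF assms(1) 1]
    by (auto simp: column_eps column_phi)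
qed

lemma column_lowerD:
  assumes "column c" "lower i c = Some c'"
  shows "i \<in> set c" "Suc i \<notin> set c" "c' = map (\<lambda>x. if x = i then Suc i else x) c"
    "column c'" "eps i c = 0" "phi i c = 1"
proof -
  have "phi i c \<noteq> 0" using assms(2) lower_None_iff [of i c] by auto
  then show 1: "i \<in> set c" "Suc i \<notin> set c" using assms(1) by (auto simp: column_phi)
  then show "c' = map (\<lambda>x. if x = i then Suc i else x) c" "column c'" "eps i c = 0" "phi i c = 1"
    using assms column_lower [OF assms(1) 1] column_lower_column [OF assms(1) 1]
    by (auto simp: column_eps column_phi)
qed

text \<open>
  Replacing \<open>Suc i\<close> by \<open>i\<close> could spoil the order only in a row where the left column also has
  \<open>Suc i\<close>.  Since \<open>e\<^sub>i\<close> does not act in the left column, this column has an \<open>i\<close> above, which forces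
  an \<open>i\<close> into the right column too; but there \<open>e\<^sub>i\<close> is defined.
\<close>

lemma col_le_raise_right:
  assumes "col_le d c" "column d" "column c" "raise i c = Some c'" "eps i d = 0"
  shows "col_le d c'"
  unfolding col_le_def
proof (intro conjI allI impI)
  note c' = column_raiseD [OF assms(3,4)]
  show "length c' \<le> length d" using assms(1) c'(3) by (simp add: col_le_def)
  fix k assume "k < length c'"
  then have k: "k < length c" "k < length d" using assms(1) c'(3) by (auto simp: col_le_def)
  have le: "rev d ! l \<le> rev c ! l" if "l < length c" for l
    using assms(1) that by (simp add: col_le_def)
  have "rev d ! k \<noteq> Suc i" if "rev c ! k = Suc i"
  proof
    assume dk: "rev d ! k = Suc i"
    then have "Suc i \<in> set d" using k unfolding in_set_rev_nth by blast
    then have "i \<in> set d" using assms(5,2) by (auto simp: column_eps)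
    then obtain l where l: "l < length d" "rev d ! l = i" unfolding in_set_rev_nth by blast
    then have "l < k" using dk k column_rev_less_iff [OF assms(2) l(1) k(2)] by simp
    then have "rev c ! l < Suc i" "i \<le> rev c ! l"
      using that k l column_rev_less [OF assms(3), of l k] le [of l] by auto
    then have "rev c ! l = i" by simp
    then have "i \<in> set c" using \<open>l < k\<close> k unfolding in_set_rev_nth using less_trans by blast
    with c'(2) show False by simp
  qed
  then show "rev d ! k \<le> rev c' ! k"
    using le [OF k(1)] k c'(3) by (auto simp: rev_map)
qed

lemma col_le_lower_left:
  assumes "col_le c d" "column c" "column d" "lower i c = Some c'" "phi i d = 0"
  shows "col_le c' d"
  unfolding col_le_def
proof (intro conjI allI impI)
  note c' = column_lowerD [OF assms(2,4)]
  show "length d \<le> length c'" using assms(1) c'(3) by (simp add: col_le_def)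
  fix k assume kd: "k < length d"
  then have k: "k < length c" using assms(1) by (auto simp: col_le_def)
  have le: "rev c ! l \<le> rev d ! l" if "l < length d" for l
    using assms(1) that by (simp add: col_le_def)
  have "rev d ! k \<noteq> i" if "rev c ! k = i"
  proof
    assume dk: "rev d ! k = i"
    then have "i \<in> set d" using kd unfolding in_set_rev_nth by blast
    then have "Suc i \<in> set d" using assms(5,3) by (auto simp: column_phi)
    then obtain l where l: "l < length d" "rev d ! l = Suc i" unfolding in_set_rev_nth by blast
    then have "k < l" using dk kd column_rev_less_iff [OF assms(3) kd l(1)] by simp
    have lc: "l < length c" using l assms(1) by (auto simp: col_le_def)
    then have "rev c ! l > i" "rev c ! l \<le> Suc i"
      using that \<open>k < l\<close> l column_rev_less [OF assms(2), of k l] le [of l] by auto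
    then have "rev c ! l = Suc i" by simp
    then have "Suc i \<in> set c" using lc unfolding in_set_rev_nth by blast
    with c'(2) show False by simp
  qed
  then show "rev c' ! k \<le> rev d ! k"
    using le [OF kd] k c'(3) by (auto simp: rev_map)
qed

lemma col_le_raise_left:
  assumes "col_le c d" "column c" "raise i c = Some c'" shows "col_le c' d"
  using assms column_raiseD [OF assms(2,3)] by (auto simp: col_le_def rev_map)

lemma col_le_lower_right:
  assumes "col_le d c" "column c" "lower i c = Some c'" shows "col_le d c'"
  using assms column_lowerD [OF assms(2,3)] by (auto simp: col_le_def rev_map)

text \<open>
  Operators preserve the shape.  For \<open>e\<^sub>i\<close> acting in a column, the tensor rule forces
  \<open>\<epsilon>\<^sub>i = 0\<close> for the column to the left, and only this column could come into conflict.
\<close>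

lemma weak_ss_raise:
  assumes "weak_ss cs" "raise i (concat cs) = Some w"
  obtains cs' where "weak_ss cs'" "concat cs' = w" "map length cs' = map length cs"
proof -
  from assms(2) obtain as c c' bs where *: "cs = as @ c # bs" "raise i c = Some c'"
    "w = concat (as @ c' # bs)" "eps i c > phi i (concat bs)"
    "eps i (concat as) \<le> phi i (concat (c # bs))" by (rule raise_concat)
  have cols: "weak_ss as" "column c" "weak_ss bs" "as \<noteq> [] \<Longrightarrow> col_le (last as) c"
    "bs \<noteq> [] \<Longrightarrow> col_le c (hd bs)"
    using assms(1) unfolding *(1) weak_ss_middle by auto
  note c' = column_raiseD [OF cols(2) *(2)]
  have "phi i (concat (c # bs)) = 0" using *(4) c' by (simp add: phi_append)
  then have "eps i (concat as) = 0" using *(5) by simp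
  have "col_le (last as) c'" if ne: "as \<noteq> []"
  proof -
    obtain as' d where d: "as = as' @ [d]" using ne by (cases as rule: rev_cases) simp_all
    then have "eps i d = 0" using \<open>eps i (concat as) = 0\<close> by (simp add: eps_append)
    then show ?thesis
      using col_le_raise_right [OF _ _ cols(2) *(2), of d] cols(1,4) d by (simp add: weak_ss_def)
  qed
  then have "weak_ss (as @ c' # bs)"
    using cols c'(4) col_le_raise_left [OF _ cols(2) *(2), of "hd bs"] by (simp add: weak_ss_middle)
  moreover have "map length (as @ c' # bs) = map length cs"
    using *(1) raise_length [OF *(2)] by simp
  ultimately show thesis using that *(3) by simp
qed

lemma weak_ss_lower:
  assumes "weak_ss cs" "lower i (concat cs) = Some w"
  obtains cs' where "weak_ss cs'" "concat cs' = w" "map length cs' = map length cs"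
proof -
  from assms(2) obtain as c c' bs where *: "cs = as @ c # bs" "lower i c = Some c'"
    "w = concat (as @ c' # bs)" "eps i c \<ge> phi i (concat bs)" by (rule lower_concat)
  have cols: "weak_ss as" "column c" "weak_ss bs" "as \<noteq> [] \<Longrightarrow> col_le (last as) c"
    "bs \<noteq> [] \<Longrightarrow> col_le c (hd bs)"
    using assms(1) unfolding *(1) weak_ss_middle by auto
  note c' = column_lowerD [OF cols(2) *(2)]
  have "phi i (concat bs) = 0" using *(4) c' by simp
  have "col_le c' (hd bs)" if ne: "bs \<noteq> []"
  proof -
    obtain bs' d where d: "bs = d # bs'" using ne by (cases bs) simp_all
    then have "phi i d = 0" using \<open>phi i (concat bs) = 0\<close> by (simp add: phi_append)
    then show ?thesis
      using col_le_lower_left [OF _ cols(2) _ *(2), of d] cols(3,5) d by (simp add: weak_ss_def)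
  qed
  then have "weak_ss (as @ c' # bs)"
    using cols c'(4) col_le_lower_right [OF _ cols(2) *(2), of "last as"] by (simp add: weak_ss_middle)
  moreover have "map length (as @ c' # bs) = map length cs"
    using *(1) lower_length [OF *(2)] by simp
  ultimately show thesis using that *(3) by simp
qed

lemma weak_ss_split:
  assumes "weak_ss cs"
  obtains bs k where "semistandard bs" "cs = bs @ replicate k []"
proof -
  have "\<exists>bs k. semistandard bs \<and> cs = bs @ replicate k []"
    using assms
  proof (induction cs)
    case Nil
    have "semistandard [] \<and> [] = [] @ replicate 0 []" by (simp add: semistandard_iff)
    then show ?case by blast
  next
    case (Cons c cs)
    then have "weak_ss cs" by (simp add: weak_ss_Cons)
    then obtain bs k where bk: "semistandard bs" "cs = bs @ replicate k []"
      using Cons.IH by blast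
    show ?case
    proof (cases "c = []")
      case True
      have "bs = []"
      proof (cases bs)
        case (Cons b bs')
        then have "col_le c b" using \<open>weak_ss (c # cs)\<close> bk by (simp add: weak_ss_Cons)
        then show ?thesis using True bk Cons by (simp add: col_le_def semistandard_iff)
      qed
      then have "semistandard [] \<and> c # cs = [] @ replicate (Suc k) []"
        using True bk by (simp add: semistandard_iff)
      then show ?thesis by blast
    next
      case False
      have "weak_ss ((c # bs) @ replicate k [])" using Cons.prems bk by simp
      from weak_ss_appendD [OF this] have "semistandard (c # bs)"
        using False bk by (simp add: semistandard_iff)
      then have "semistandard (c # bs) \<and> c # cs = (c # bs) @ replicate k []" using bk by simp
      then show ?thesis by blast
    qed
  qed
  then show thesis using that by blast
qed

lemma concat_replicate_Nil [simp]: "concat (replicate k []) = []"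
  by (induction k) auto

lemma weak_ss_tableaux:
  assumes "weak_ss cs"
  shows "concat cs \<in> tableaux"
proof -
  obtain bs k where "semistandard bs" "cs = bs @ replicate k []"
    using assms by (rule weak_ss_split)
  then have "concat cs = concat bs \<and> semistandard bs" by simp
  then show ?thesis unfolding tableaux_def by blast
qed

text \<open>
  Within a column the letters decrease, while the last letter of a column never exceeds the
  first letter of the next one.  So the columns are the maximal decreasing factors of the word.
\<close>

lemma semistandard_concat_inj:
  assumes "semistandard cs" "semistandard ds" "concat cs = concat ds"
  shows "cs = ds"
  using assms
proof (induction cs arbitrary: ds)
  case Nil
  then show ?case by (cases ds) (auto simp: semistandard_iff)
next
  case (Cons c cs)
  then obtain d ds' where ds: "ds = d # ds'" by (cases ds) (auto simp: semistandard_iff)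
  have prefix: "us = []"
    if ss: "semistandard (a # as)" "semistandard (b # bs)" and eq: "a @ us = b" "concat as = us @ concat bs"
    for a b us :: "nat list" and as bs
  proof (rule ccontr)
    assume "us \<noteq> []"
    then obtain x us' where us: "us = x # us'" by (cases us) auto
    have "as \<noteq> []" using eq us by auto
    then obtain a' as' where as: "as = a' # as'" by (cases as) auto
    have a: "a \<noteq> []" "a' \<noteq> []" "column b" "column a'" "col_le a a'"
      using ss as by (auto simp: semistandard_iff weak_ss_Cons)
    have "hd a' = x" using eq(2) as us a by (cases a') auto
    obtain a0 y where y: "a = a0 @ [y]" using a(1) by (cases a rule: rev_cases) simp_all
    have "x < y" using a(3) eq(1) y us by (auto simp: sorted_wrt_append)
    have "y \<le> rev a' ! 0" using a(2,5) y by (auto simp: col_le_def dest!: spec [of _ 0])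
    also have "rev a' ! 0 \<le> x"
    proof -
      have "rev a' ! 0 \<in> set a'" using a(2) by (metis length_greater_0_conv length_rev nth_mem set_rev)
      then show ?thesis using \<open>hd a' = x\<close> a(2,4) by (cases a') auto
    qed
    finally show False using \<open>x < y\<close> by simp
  qed
  have "c @ concat cs = d @ concat ds'" using Cons.prems ds by simp
  then obtain us where us: "c @ us = d \<and> concat cs = us @ concat ds' \<or> c = d @ us \<and> us @ concat cs = concat ds'"
    unfolding append_eq_append_conv2 by metis
  have "us = []"
    using us
  proof
    assume "c @ us = d \<and> concat cs = us @ concat ds'"
    then show ?thesis using prefix [of c cs d ds' us] Cons.prems ds by blast
  next
    assume "c = d @ us \<and> us @ concat cs = concat ds'"
    then show ?thesis using prefix [of d ds' c cs us] Cons.prems ds by metis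
  qed
  then have *: "c = d" "concat cs = concat ds'" using us by auto
  have "semistandard cs" "semistandard ds'"
    using Cons.prems ds by (auto simp: semistandard_iff weak_ss_Cons)
  then show ?case using Cons.IH [of ds'] * ds by simp
qed

lemma columns_concat: "semistandard cs \<Longrightarrow> columns (concat cs) = cs"
  unfolding columns_def by (rule the_equality) (auto intro: semistandard_concat_inj)

lemma tableaux_iff: "t \<in> tableaux \<longleftrightarrow> (\<exists>cs. weak_ss cs \<and> t = concat cs)"
  using weak_ss_tableaux by (auto simp: tableaux_def semistandard_iff)

lemma tableaux_raise: "t \<in> tableaux \<Longrightarrow> raise i t = Some t' \<Longrightarrow> t' \<in> tableaux"
  unfolding tableaux_iff by (metis weak_ss_raise)

lemma tableaux_lower: "t \<in> tableaux \<Longrightarrow> lower i t = Some t' \<Longrightarrow> t' \<in> tableaux"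
  unfolding tableaux_iff by (metis weak_ss_lower)

lemma eps_concat_0: "(\<And>c. c \<in> set cs \<Longrightarrow> eps i c = 0) \<Longrightarrow> eps i (concat cs) = 0"
  by (induction cs) (auto simp: eps_append)

lemma phi_concat_0: "(\<And>c. c \<in> set cs \<Longrightarrow> phi i c = 0) \<Longrightarrow> phi i (concat cs) = 0"
  by (induction cs) (auto simp: phi_append)

lemma set_eq_column: "column c \<Longrightarrow> column d \<Longrightarrow> set c = set d \<Longrightarrow> c = d"
proof -
  assume *: "column c" "column d" "set c = set d"
  have "sorted (rev c) \<and> distinct (rev c)" if "column c" for c
    using that by (metis sorted_wrt_rev strict_sorted_iff)
  then show ?thesis using * sorted_distinct_set_unique [of "rev c" "rev d"] by auto
qed

section \<open>Highest words and highest tableaux\<close>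

text \<open>
  Every raising operator lowers the sum of the letters, so a word reaches a highest one.  The
  index set \<open>I\<close> allows highest words for a Levi subalgebra only.
\<close>

lemma raise_induct [case_names highest raise]:
  assumes "\<And>w. (\<And>i. i \<in> I \<Longrightarrow> eps i w = 0) \<Longrightarrow> P w"
    and "\<And>w i w'. i \<in> I \<Longrightarrow> raise i w = Some w' \<Longrightarrow> P w' \<Longrightarrow> P w"
  shows "P w"
proof (induction "sum_list w" arbitrary: w rule: less_induct)
  case less
  show ?case
  proof (cases "\<exists>i\<in>I. eps i w \<noteq> 0")
    case True
    then obtain i where i: "i \<in> I" "eps i w \<noteq> 0" by blast
    then obtain w' where w': "raise i w = Some w'" using raise_None_iff [of i w] by auto
    then have "P w'" using less raise_sum_list [OF w'] by auto
    then show ?thesis using assms(2) i(1) w' by blast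
  qed (use assms(1) in blast)
qed

lemma highest_column_0 [simp]: "highest_column 0 = []"
  and highest_column_Suc [simp]: "highest_column (Suc h) = Suc h # highest_column h"
  by (auto simp: highest_column_def)

lemma set_highest_column [simp]: "set (highest_column h) = {1..h}"
  by (auto simp: highest_column_def)

lemma length_highest_column [simp]: "length (highest_column h) = h"
  by (simp add: highest_column_def)

lemma column_highest_column [simp]: "column (highest_column h)"
  by (induction h) auto

lemma rev_highest_column_nth: "k < h \<Longrightarrow> rev (highest_column h) ! k = Suc k"
  by (simp add: highest_column_def del: upt_Suc)

lemma col_le_highest_column: "h' \<le> h \<Longrightarrow> col_le (highest_column h) (highest_column h')"
  by (simp add: col_le_def rev_highest_column_nth)

text \<open>
  A letter that is not smaller than the bottom of a column moves past the rest of this column.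
\<close>

lemma keq_column_letter:
  assumes "column (d # E)" "d \<le> z"
  shows "keq (d # E @ [z]) (d # z # E)"
  using assms
proof (induction E rule: rev_induct)
  case (snoc e E)
  \<comment> \<open>\<open>y\<close> is the letter before \<open>e\<close>; it makes the swap of \<open>e\<close> and \<open>z\<close> an elementary relation.\<close>
  obtain F y where F: "d # E = F @ [y]" by (cases "d # E" rule: rev_cases) simp_all
  have "y \<in> set (d # E)" unfolding F by simp
  then have "e < y" "y \<le> z" using snoc.prems by (auto simp: sorted_wrt_append)
  then have "keq (F @ [y, e, z] @ []) (F @ [y, z, e] @ [])"
    by (intro keq_context keq_knuth1)
  then have "keq ((d # E) @ [e, z]) ((d # E) @ [z, e])" unfolding F by simp
  also have "keq ((d # E @ [z]) @ [e]) ((d # z # E) @ [e])"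
    using snoc by (intro keq_append) (auto simp: sorted_wrt_append)
  then have "keq ((d # E) @ [z, e]) (d # z # E @ [e])" by simp
  finally show ?case by simp
qed simp

text \<open>
  The column \<open>h \<dots> 2 1\<close> commutes with all letters up to \<open>h\<close>: the letter moves down to its own
  value in the column, and there it is absorbed by \<open>keq_column_letter\<close>.
\<close>

lemma keq_letter_highest_column:
  assumes "1 \<le> x" "x \<le> h"
  shows "keq (x # highest_column h) (highest_column h @ [x])"
  using assms
proof (induction h)
  case (Suc h)
  show ?case
  proof (cases "x = Suc h")
    case True
    then show ?thesis
      using keq_column_letter [of "Suc h" "highest_column h" x] column_highest_column [of "Suc h"]
      by (auto intro: keq_sym)
  next
    case False
    then obtain g where g: "h = Suc g" using Suc.prems by (cases h) auto
    have "keq ([x, Suc h, h] @ highest_column g) ([Suc h, x, h] @ highest_column g)"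
      using Suc.prems False by (intro keq_append keq_knuth2) auto
    then have "keq (x # highest_column (Suc h)) (Suc h # x # highest_column h)" by (simp add: g)
    also have "keq (Suc h # x # highest_column h) (Suc h # highest_column h @ [x])"
      using Suc False by (intro keq_Cons) auto
    finally show ?thesis by simp
  qed
qed simp

lemma keq_word_highest_column:
  assumes "set w \<subseteq> {1..h}"
  shows "keq (w @ highest_column h) (highest_column h @ w)"
  using assms
proof (induction w)
  case (Cons x w)
  then have "keq (x # w @ highest_column h) (x # highest_column h @ w)"
    by (intro keq_Cons) auto
  also have "keq ((x # highest_column h) @ w) ((highest_column h @ [x]) @ w)"
    using Cons.prems by (intro keq_append keq_letter_highest_column) auto
  then have "keq (x # highest_column h @ w) (highest_column h @ x # w)" by simp
  finally show ?case by simp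
qed simp

text \<open>
  The highest weight (Yamanouchi) tableau with given column heights.
\<close>

definition canonical :: "nat list \<Rightarrow> nat list" where
  "canonical hs = concat (map highest_column hs)"

lemma canonical_simps [simp]: "canonical [] = []" "canonical (h # hs) = highest_column h @ canonical hs"
  "canonical (hs @ hs') = canonical hs @ canonical hs'"
  by (auto simp: canonical_def)

lemma phi_highest_column: "i \<ge> 1 \<Longrightarrow> phi i (highest_column h) = of_bool (i = h)"
  by (auto simp: column_phi)

lemma eps_canonical: "i \<ge> 1 \<Longrightarrow> eps i (canonical hs) = 0"
  unfolding canonical_def by (rule eps_concat_0) (auto simp: column_eps)

lemma phi_canonical_mem:
  assumes "i \<ge> 1" "phi i (canonical hs) \<noteq> 0"
  shows "i \<in> set hs"
proof (rule ccontr)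
  assume "i \<notin> set hs"
  then have "phi i c = 0" if "c \<in> set (map highest_column hs)" for c
    using that phi_highest_column [OF assms(1)] by auto
  then have "phi i (canonical hs) = 0" unfolding canonical_def by (rule phi_concat_0)
  then show False using assms(2) by simp
qed

lemma keq_letter_canonical:
  assumes "1 \<le> x" "\<forall>h \<in> set hs. x \<le> h"
  shows "keq (x # canonical hs) (canonical hs @ [x])"
  using assms(2)
proof (induction hs)
  case (Cons h hs)
  have "keq ((x # highest_column h) @ canonical hs) ((highest_column h @ [x]) @ canonical hs)"
    using Cons.prems assms(1) by (intro keq_append keq_letter_highest_column) auto
  also have "keq (highest_column h @ x # canonical hs) (highest_column h @ canonical hs @ [x])"
    using Cons by (intro keq_append) auto
  then have "keq ((highest_column h @ [x]) @ canonical hs) (highest_column h @ canonical hs @ [x])" by simp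
  finally show ?case by simp
qed simp

text \<open>
  Induction over the letters from the right.  If \<open>x w\<close> is highest, so is \<open>w\<close>, and the weight of \<open>w\<close>
  allows to add a cell in row \<open>x\<close>.  The letter \<open>x\<close> commutes with all columns of height at
  least \<open>x\<close> and then completes the first column of height \<open>x - 1\<close>.
\<close>

lemma highest_word_keq_canonical:
  assumes "\<And>i. i \<ge> 1 \<Longrightarrow> eps i w = 0" "0 \<notin> set w"
  obtains hs where "sorted_wrt (\<ge>) hs" "0 \<notin> set hs" "keq w (canonical hs)"
proof -
  have "\<exists>hs. sorted_wrt (\<ge>) hs \<and> 0 \<notin> set hs \<and> keq w (canonical hs)"
    using assms
  proof (induction w)
    case Nil
    have "sorted_wrt (\<ge>) [] \<and> 0 \<notin> set ([] :: nat list) \<and> keq [] (canonical [])" by simp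
    then show ?case by blast
  next
    case (Cons x w)
    have e: "eps i w = 0" "of_bool (x = Suc i) \<le> phi i w" if "i \<ge> 1" for i
      using Cons.prems(1) [OF that] by auto
    then obtain hs where hs: "sorted_wrt (\<ge>) hs" "0 \<notin> set hs" "keq w (canonical hs)"
      using Cons by auto
    \<comment> \<open>\<open>x\<close> commutes with the columns in \<open>as\<close> and is stacked on the first column of \<open>bs\<close>.\<close>
    define as where "as = takeWhile (\<lambda>h. x \<le> h) hs"
    define bs where "bs = dropWhile (\<lambda>h. x \<le> h) hs"
    have hs_eq: "hs = as @ bs" by (simp add: as_def bs_def)
    have x: "1 \<le> x" using Cons.prems by (cases x) auto
    have as_ge: "\<forall>h \<in> set as. x \<le> h" unfolding as_def by (meson set_takeWhileD)
    have bs_hd: "\<not> x \<le> hd bs" if "bs \<noteq> []" using that unfolding bs_def by (rule hd_dropWhile)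
    have bs_less: "\<forall>h \<in> set bs. h < x"
      using bs_hd hs(1) unfolding hs_eq by (cases bs) (auto simp: sorted_wrt_append)
    have "keq (x # w) (x # canonical as @ canonical bs)"
      using hs(3) unfolding hs_eq by (intro keq_Cons) simp
    also have "keq ((x # canonical as) @ canonical bs) ((canonical as @ [x]) @ canonical bs)"
      using x as_ge by (intro keq_append keq_letter_canonical) auto
    then have "keq (x # canonical as @ canonical bs) (canonical as @ x # canonical bs)" by simp
    finally have eq: "keq (x # w) (canonical as @ x # canonical bs)" .
    have "\<exists>cs. x # canonical bs = canonical (x # cs) \<and> set cs \<subseteq> set bs \<and> sorted_wrt (\<ge>) cs"
    proof (cases "x = 1")
      case True
      then have "bs = []" using bs_less hs(2) unfolding hs_eq by (cases bs) auto
      then have "x # canonical bs = canonical (x # []) \<and> set [] \<subseteq> set bs \<and> sorted_wrt (\<ge>) ([] :: nat list)"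
        using True by (simp add: numeral_nat highest_column_def)
      then show ?thesis by blast
    next
      case False
      then obtain y where y: "x = Suc y" "y \<ge> 1" using x by (cases x) auto
      have "phi y w \<noteq> 0" using e(2) [of y] y by simp
      then have "phi y (canonical hs) \<noteq> 0" using keq_phi [OF hs(3)] by simp
      then have "y \<in> set hs" using y phi_canonical_mem by blast
      then have "y \<in> set bs" using as_ge y unfolding hs_eq by auto
      then obtain b cs where b: "bs = b # cs" by (cases bs) auto
      have "y \<le> b" "b < x" using \<open>y \<in> set bs\<close> bs_less hs(1) unfolding hs_eq b
        by (auto simp: sorted_wrt_append)
      then have "b = y" using y by simp
      moreover have "sorted_wrt (\<ge>) cs" using hs(1) unfolding hs_eq b by (simp add: sorted_wrt_append)
      ultimately have "x # canonical bs = canonical (x # cs) \<and> set cs \<subseteq> set bs \<and> sorted_wrt (\<ge>) cs"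
        using b y by auto
      then show ?thesis by blast
    qed
    then obtain cs where cs: "x # canonical bs = canonical (x # cs)" "set cs \<subseteq> set bs" "sorted_wrt (\<ge>) cs"
      by blast
    have "sorted_wrt (\<ge>) (as @ x # cs)"
      using hs(1) as_ge bs_less cs unfolding hs_eq by (fastforce simp: sorted_wrt_append)
    moreover have "0 \<notin> set (as @ x # cs)" using hs(2) x cs(2) unfolding hs_eq by auto
    moreover have "keq (x # w) (canonical (as @ x # cs))" using eq cs(1) by simp
    ultimately show ?case by blast
  qed
  then show thesis using that by blast
qed

lemma count_highest_column: "i \<ge> 1 \<Longrightarrow> count_list (highest_column h) i = of_bool (i \<le> h)"
  by (induction h) auto

lemma count_canonical: "i \<ge> 1 \<Longrightarrow> count_list (canonical hs) i = length (filter (\<lambda>h. i \<le> h) hs)"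
  by (induction hs) (auto simp: count_highest_column)

text \<open>
  A partition is determined by its conjugate.
\<close>

lemma sorted_by_counts:
  assumes "sorted_wrt (\<ge>) hs" "sorted_wrt (\<ge>) hs'"
    and "\<And>i. length (filter (\<lambda>h. i \<le> h) hs) = length (filter (\<lambda>h. i \<le> h) hs')"
  shows "hs = (hs' :: nat list)"
proof -
  have count: "count (mset hs) i + length (filter (\<lambda>h. Suc i \<le> h) hs) = length (filter (\<lambda>h. i \<le> h) hs)"
    for hs i by (induction hs) auto
  have "mset hs = mset hs'"
  proof (rule multiset_eqI)
    fix i show "count (mset hs) i = count (mset hs') i"
      using count [of hs i] count [of hs' i] assms(3) [of i] assms(3) [of "Suc i"] by linarith
  qed
  then have "mset (rev hs) = mset (rev hs')" by simp
  moreover have "sorted (rev hs)" "sorted (rev hs')" using assms(1,2) by (simp_all add: sorted_wrt_rev)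
  ultimately have "rev hs = rev hs'" by (metis properties_for_sort)
  then show ?thesis by simp
qed

lemma canonical_inj:
  assumes "sorted_wrt (\<ge>) hs" "sorted_wrt (\<ge>) hs'" "0 \<notin> set hs" "0 \<notin> set hs'"
    and "\<And>i. i \<ge> 1 \<Longrightarrow> count_list (canonical hs) i = count_list (canonical hs') i"
  shows "hs = hs'"
proof (rule sorted_by_counts [OF assms(1,2)])
  have pos: "filter (\<lambda>h. 0 \<le> h) hs = filter (\<lambda>h. 1 \<le> h) hs" if "0 \<notin> set hs" for hs :: "nat list"
    using that by (intro filter_cong) (auto simp: Suc_le_eq intro: gr0I)
  fix i show "length (filter (\<lambda>h. i \<le> h) hs) = length (filter (\<lambda>h. i \<le> h) hs')"
  proof (cases "i = 0")
    case True
    then show ?thesis using assms(5) [of 1] by (simp only: pos [OF assms(3)] pos [OF assms(4)] count_canonical)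
  next
    case False
    then show ?thesis using assms(5) [of i] by (simp add: count_canonical)
  qed
qed

lemma weak_ss_canonical: "sorted_wrt (\<ge>) hs \<Longrightarrow> weak_ss (map highest_column hs)"
  by (induction hs) (auto simp: weak_ss_Cons hd_map intro!: col_le_highest_column)

lemma canonical_tableau: "sorted_wrt (\<ge>) hs \<Longrightarrow> canonical hs \<in> tableaux"
  unfolding canonical_def by (intro weak_ss_tableaux weak_ss_canonical)

lemma weak_ss_lengths: "weak_ss cs \<Longrightarrow> sorted_wrt (\<ge>) (map length cs)"
proof -
  assume "weak_ss cs"
  then have "successively (\<lambda>c d. length c \<ge> length d) cs"
    unfolding weak_ss_def by (auto intro: successively_mono simp: col_le_def)
  then have "successively (\<ge>) (map length cs)" by (simp add: successively_map)
  then show ?thesis by (subst (asm) successively_conv_sorted_wrt) (auto simp: transp_def)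
qed

lemma column_nth_ge:
  assumes "column c" "0 \<notin> set c" "k < length c"
  shows "Suc k \<le> rev c ! k"
  using assms(3)
proof (induction k)
  case 0
  then have "rev c ! 0 \<in> set c" by (metis length_rev nth_mem set_rev)
  then show ?case using assms(2) by (metis Suc_leI bot_nat_0.not_eq_extremum)
next
  case (Suc k)
  then show ?case using column_rev_less [OF assms(1), of k "Suc k"] by simp
qed

lemma interval_of_downward_closed:
  assumes "finite S" "\<And>x. x \<in> S \<Longrightarrow> r < x" "\<And>i. r < i \<Longrightarrow> Suc i \<in> S \<Longrightarrow> i \<in> S"
  shows "S = {r + 1..r + card S}"
proof -
  have "\<exists>l. S = {r + 1..r + l}"
  proof (cases "S = {}")
    case True
    then have "S = {r + 1..r + 0}" by simp
    then show ?thesis by blast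
  next
    case False
    have down: "Max S - d \<in> S" if "r < Max S - d" for d
      using that
    proof (induction d)
      case 0
      then show ?case using False assms(1) by simp
    next
      case (Suc d)
      then have "Suc (Max S - Suc d) = Max S - d" by simp
      then show ?case using Suc assms(3) [of "Max S - Suc d"] by simp
    qed
    have "S = {r + 1..r + (Max S - r)}"
    proof (intro equalityI subsetI)
      fix x assume "x \<in> S"
      then show "x \<in> {r + 1..r + (Max S - r)}" using assms(2) [of x] Max_ge [OF assms(1), of x] by simp
    next
      fix x assume "x \<in> {r + 1..r + (Max S - r)}"
      then show "x \<in> S" using down [of "Max S - x"] by auto
    qed
    then show ?thesis by blast
  qed
  then show ?thesis by auto
qed

lemma card_column: "column c \<Longrightarrow> card (set c) = length c"
  by (rule distinct_card) (metis distinct_rev sorted_wrt_rev strict_sorted_iff)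

text \<open>
  From right to left.  If a column contains \<open>Suc i\<close> but not \<open>i\<close>, the columns to the right must
  compensate, so one of them has height \<open>i\<close>.  Then the first \<open>i\<close> rows of the next column are
  \<open>1, \<dots>, i\<close>, which forces the same in the column itself.
\<close>

lemma highest_tableau_columns:
  assumes "weak_ss cs" "0 \<notin> set (concat cs)" "\<And>i. i \<ge> 1 \<Longrightarrow> eps i (concat cs) = 0"
  shows "cs = map highest_column (map length cs)"
  using assms
proof (induction cs)
  case (Cons c cs)
  have e: "eps i (concat cs) = 0" "eps i c \<le> phi i (concat cs)" if "i \<ge> 1" for i
    using Cons.prems(3) [OF that] by (auto simp: eps_append)
  have col: "column c" "weak_ss cs" "cs \<noteq> [] \<Longrightarrow> col_le c (hd cs)" "0 \<notin> set c"
    using Cons.prems by (auto simp: weak_ss_Cons)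
  have cs: "cs = map highest_column (map length cs)"
    using Cons.IH [OF col(2)] Cons.prems(2) e(1) by auto
  have closed: "i \<in> set c" if i: "0 < i" "Suc i \<in> set c" for i
  proof (rule ccontr)
    assume "i \<notin> set c"
    then have "eps i c = 1" using col(1) i by (simp add: column_eps)
    then have "phi i (concat cs) \<noteq> 0" using e(2) [of i] i by simp
    then have "i \<in> set (map length cs)"
      using phi_canonical_mem [of i "map length cs"] i cs by (simp add: canonical_def)
    moreover obtain d ds where d: "cs = d # ds" using calculation by (cases cs) auto
    ultimately have "i \<le> length d" using weak_ss_lengths [OF col(2)] i by auto
    have "d = highest_column (length d)" using cs d by simp
    then have "rev d ! (i - 1) = i"
      using rev_highest_column_nth [of "i - 1" "length d"] \<open>i \<le> length d\<close> i by simp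
    moreover have "i \<le> length c" "rev c ! (i - 1) \<le> rev d ! (i - 1)"
      using col(3) d i \<open>i \<le> length d\<close> by (auto simp: col_le_def)
    moreover have "i \<le> rev c ! (i - 1)"
      using column_nth_ge [OF col(1,4), of "i - 1"] i \<open>i \<le> length c\<close> by simp
    ultimately have "rev c ! (i - 1) = i" "i - 1 < length c" using i by auto
    then show False using \<open>i \<notin> set c\<close> unfolding in_set_rev_nth by blast
  qed
  have "set c = {0 + 1..0 + card (set c)}"
    by (rule interval_of_downward_closed) (use closed col(4) in \<open>auto intro: gr0I\<close>)
  then have "c = highest_column (length c)"
    using col(1) by (intro set_eq_column) (auto simp: card_column)
  then show ?case using cs by simp
qed simp

section \<open>The Schensted tableau\<close>

text \<open>
  Raise the word to a highest one, replace that by its tableau, and undo the raising.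
\<close>

lemma keq_tableau_exists:
  assumes "0 \<notin> set w"
  shows "\<exists>t \<in> tableaux. keq w t"
  using assms
proof (induction w rule: raise_induct [where I = "{1..}"])
  case (highest w)
  then obtain hs where "sorted_wrt (\<ge>) hs" "keq w (canonical hs)"
    using highest_word_keq_canonical [of w] by auto
  then show ?case using canonical_tableau by blast
next
  case (raise w i w')
  then have "0 \<notin> set w'" using raise_set [OF raise.hyps(2)] by auto
  then obtain t' where t': "t' \<in> tableaux" "keq w' t'" using raise.IH by blast
  have "rel_option keq (Some w) (lower i t')"
    using keq_lower [OF t'(2), of i] raise_Some [OF raise.hyps(2)] by simp
  then obtain t where "lower i t' = Some t" "keq w t" by (cases "lower i t'") auto
  then show ?case using tableaux_lower t'(1) by blast
qed

text \<open>
  Equivalent tableaux can be raised simultaneously.  At the top both are determined by their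
  content, and the lowering operators lead back to the same tableau.
\<close>

lemma keq_tableau_unique:
  assumes "0 \<notin> set t" "t \<in> tableaux" "t' \<in> tableaux" "keq t t'"
  shows "t = t'"
  using assms
proof (induction t arbitrary: t' rule: raise_induct [where I = "{1..}"])
  case (highest t)
  have canonical: "\<exists>hs. sorted_wrt (\<ge>) hs \<and> 0 \<notin> set hs \<and> u = canonical hs"
    if u: "u \<in> tableaux" and "0 \<notin> set u" "\<And>i. i \<ge> 1 \<Longrightarrow> eps i u = 0" for u
  proof -
    obtain cs where cs: "semistandard cs" "u = concat cs" using u unfolding tableaux_def by blast
    then have "cs = map highest_column (map length cs)"
      using that by (intro highest_tableau_columns) (auto simp: semistandard_iff)
    then have "u = canonical (map length cs)" using cs by (simp add: canonical_def)
    moreover have "0 \<notin> set (map length cs)" using cs(1) by (auto simp: semistandard_iff)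
    moreover have "sorted_wrt (\<ge>) (map length cs)"
      using cs(1) weak_ss_lengths by (simp add: semistandard_iff)
    ultimately show ?thesis by blast
  qed
  obtain hs where hs: "sorted_wrt (\<ge>) hs" "0 \<notin> set hs" "t = canonical hs"
    using canonical [of t] highest by auto
  obtain hs' where hs': "sorted_wrt (\<ge>) hs'" "0 \<notin> set hs'" "t' = canonical hs'"
    using canonical [of t'] highest keq_eps [OF highest.prems(4)] keq_set [OF highest.prems(4)] by auto
  have "hs = hs'"
    using hs hs' keq_count [OF highest.prems(4)] by (intro canonical_inj) auto
  then show ?case using hs hs' by simp
next
  case (raise t i s)
  have "rel_option keq (Some s) (raise i t')"
    using keq_raise [OF raise.prems(4), of i] raise.hyps by simp
  then obtain s' where s': "raise i t' = Some s'" "keq s s'" by (cases "raise i t'") auto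
  have "0 \<notin> set s" using raise_set [OF raise.hyps(2)] raise by auto
  then have "s = s'"
    using raise.IH s' tableaux_raise raise.hyps(2) raise.prems(2,3) by blast
  then show ?case using raise_Some [OF s'(1)] raise_Some [OF raise.hyps(2)] by simp
qed

lemma schensted_eq_iff:
  assumes "0 \<notin> set w"
  shows "schensted w = t \<longleftrightarrow> t \<in> tableaux \<and> keq w t"
proof -
  have "\<exists>!t. t \<in> tableaux \<and> keq w t"
  proof -
    obtain t where t: "t \<in> tableaux" "keq w t" using keq_tableau_exists [OF assms] by blast
    have "0 \<notin> set t" using assms keq_set [OF t(2)] by simp
    then show ?thesis
      using t keq_tableau_unique by (metis keq_sym keq_trans)
  qed
  then show ?thesis unfolding schensted_def
    by (metis (no_types, lifting) theI')
qed

section \<open>Rectangular tableaux and Levi highest elements\<close>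

definition rect :: "nat \<Rightarrow> nat \<Rightarrow> nat list set" where
  "rect r s = {concat cs | cs. weak_ss cs \<and> length cs = s \<and> (\<forall>c \<in> set cs. length c = r)}"

lemma rectI: "weak_ss cs \<Longrightarrow> length cs = s \<Longrightarrow> (\<And>c. c \<in> set cs \<Longrightarrow> length c = r) \<Longrightarrow> concat cs \<in> rect r s"
  unfolding rect_def by blast

lemma rectE:
  assumes "t \<in> rect r s"
  obtains cs where "t = concat cs" "weak_ss cs" "length cs = s" "\<forall>c \<in> set cs. length c = r"
  using assms unfolding rect_def by blast

lemma length_rect: "t \<in> rect r s \<Longrightarrow> length t = s * r"
proof -
  assume "t \<in> rect r s"
  then obtain cs where "t = concat cs" "length cs = s" "\<forall>c \<in> set cs. length c = r" by (rule rectE)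
  moreover have "map length cs = replicate s r"
    using calculation by (intro replicate_eqI) auto
  ultimately show ?thesis by (simp add: length_concat sum_list_replicate)
qed

lemma map_length_eq_cong:
  "map length cs = map length ds \<Longrightarrow> length cs = s \<Longrightarrow> \<forall>c \<in> set cs. length c = r \<Longrightarrow>
   length ds = s \<and> (\<forall>d \<in> set ds. length d = r)"
  by (metis (no_types, lifting) imageE imageI length_map list.set_map)

lemma rect_raise: "t \<in> rect r s \<Longrightarrow> raise i t = Some t' \<Longrightarrow> t' \<in> rect r s"
proof -
  assume "t \<in> rect r s" and t': "raise i t = Some t'"
  then obtain cs where cs: "t = concat cs" "weak_ss cs" "length cs = s" "\<forall>c \<in> set cs. length c = r"
    by (auto elim: rectE)
  obtain ds where ds: "weak_ss ds" "concat ds = t'" "map length ds = map length cs"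
    using weak_ss_raise [OF cs(2)] t' cs(1) by metis
  show ?thesis
    using map_length_eq_cong [OF ds(3) [symmetric] cs(3,4)] ds rectI [of ds s r] by simp
qed

lemma rect_lower: "t \<in> rect r s \<Longrightarrow> lower i t = Some t' \<Longrightarrow> t' \<in> rect r s"
proof -
  assume "t \<in> rect r s" and t': "lower i t = Some t'"
  then obtain cs where cs: "t = concat cs" "weak_ss cs" "length cs = s" "\<forall>c \<in> set cs. length c = r"
    by (auto elim: rectE)
  obtain ds where ds: "weak_ss ds" "concat ds = t'" "map length ds = map length cs"
    using weak_ss_lower [OF cs(2)] t' cs(1) by metis
  show ?thesis
    using map_length_eq_cong [OF ds(3) [symmetric] cs(3,4)] ds rectI [of ds s r] by simp
qed

lemma rectangular_eq:
  assumes "1 \<le> r"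
  shows "rectangular n r s = {t \<in> rect r s. set t \<subseteq> {1..2 * n}}"
proof -
  have "(semistandard cs \<and> length cs = s \<and> (\<forall>c \<in> set cs. length c = r \<and> set c \<subseteq> {1..2 * n})) \<longleftrightarrow>
        ((weak_ss cs \<and> length cs = s \<and> (\<forall>c \<in> set cs. length c = r)) \<and> set (concat cs) \<subseteq> {1..2 * n})" for cs
    using assms by (auto simp: semistandard_iff)
  then show ?thesis unfolding rectangular_def rect_def by blast
qed

text \<open>
  The columns of rectangular tableaux that are highest except possibly in direction \<open>r\<close>: \<open>k\<close>
  letters from \<open>{1..r}\<close> and \<open>a - k\<close> letters above \<open>r\<close>, each time the smallest ones.
\<close>

definition levi_column :: "nat \<Rightarrow> nat \<Rightarrow> nat \<Rightarrow> nat list" where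
  "levi_column r a k = rev ([1..<Suc k] @ [Suc r..<Suc (r + a - k)])"

lemma set_levi_column: "set (levi_column r a k) = {1..k} \<union> {r + 1..r + a - k}"
  by (auto simp: levi_column_def)

lemma column_levi_column: "k \<le> r \<Longrightarrow> column (levi_column r a k)"
  unfolding levi_column_def sorted_wrt_rev by (auto simp: sorted_wrt_append simp del: upt_Suc)

lemma length_levi_column: "k \<le> r \<Longrightarrow> k \<le> a \<Longrightarrow> length (levi_column r a k) = a"
  by (auto simp: levi_column_def)

lemma levi_column_nth: "j < k \<Longrightarrow> rev (levi_column r a k) ! j = Suc j"
  by (simp add: levi_column_def nth_append del: upt_Suc)

lemma phi_levi_column:
  assumes "k \<le> r" "i \<ge> 1" "phi i (levi_column r a k) \<noteq> 0"
  shows "i = k \<or> r < i \<and> i = r + a - k"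
  using assms by (auto simp: column_phi [OF column_levi_column] set_levi_column split: if_splits)

text \<open>
  From right to left.  A gap in a column, that is \<open>Suc i\<close> without \<open>i\<close> for some \<open>i \<noteq> r\<close>, has to be compensated
  by a column further right that ends one of its two segments with \<open>i\<close>.  For \<open>i < r\<close> that is excluded because the first
  rows are forced by the next column, and for \<open>i > r\<close> because \<open>Suc i\<close> would exceed all
  letters of the next column; the latter uses that all columns have the same height.
\<close>

lemma levi_classification:
  assumes "weak_ss cs" "\<And>c. c \<in> set cs \<Longrightarrow> length c = a" "0 \<notin> set (concat cs)"
    and "\<And>i. i \<ge> 1 \<Longrightarrow> i \<noteq> r \<Longrightarrow> eps i (concat cs) = 0"
  obtains ks where "cs = map (levi_column r a) ks" "sorted_wrt (\<ge>) ks" "\<And>k. k \<in> set ks \<Longrightarrow> k \<le> r \<and> k \<le> a"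
proof -
  have "\<exists>ks. cs = map (levi_column r a) ks \<and> sorted_wrt (\<ge>) ks \<and> (\<forall>k \<in> set ks. k \<le> r \<and> k \<le> a)"
    using assms
  proof (induction cs)
    case (Cons c cs)
    have e: "eps i (concat cs) = 0" "eps i c \<le> phi i (concat cs)" if "i \<ge> 1" "i \<noteq> r" for i
      using Cons.prems(4) [OF that] by (auto simp: eps_append)
    have col: "column c" "weak_ss cs" "cs \<noteq> [] \<Longrightarrow> col_le c (hd cs)" "0 \<notin> set c" "length c = a"
      using Cons.prems by (auto simp: weak_ss_Cons)
    have "\<exists>ks. cs = map (levi_column r a) ks \<and> sorted_wrt (\<ge>) ks \<and> (\<forall>k \<in> set ks. k \<le> r \<and> k \<le> a)"
      using Cons.IH [OF col(2)] Cons.prems(2,3) e(1) by auto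
    then obtain ks where ks: "cs = map (levi_column r a) ks" "sorted_wrt (\<ge>) ks"
      "\<And>k. k \<in> set ks \<Longrightarrow> k \<le> r" "\<And>k. k \<in> set ks \<Longrightarrow> k \<le> a" by blast
    have initial: "j \<in> set c" if j: "1 \<le> j" "ks \<noteq> []" "j \<le> hd ks" for j
    proof -
      have hd: "hd cs = levi_column r a (hd ks)" "cs \<noteq> []" using ks j by (auto simp: hd_map)
      have "hd ks \<le> r" "hd ks \<le> a" using ks(3,4) j(2) by auto
      then have "rev c ! (j - 1) \<le> rev (hd cs) ! (j - 1)"
        using col(3) hd j by (simp add: col_le_def length_levi_column)
      also have "\<dots> = j" using levi_column_nth [of "j - 1" "hd ks" r a] j hd by simp
      finally have "rev c ! (j - 1) \<le> j" .
      moreover have "j \<le> rev c ! (j - 1)"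
        using column_nth_ge [OF col(1,4), of "j - 1"] j \<open>hd ks \<le> a\<close> col(5) by simp
      ultimately have "rev c ! (j - 1) = j" "j - 1 < length c"
        using j \<open>hd ks \<le> a\<close> col(5) by auto
      then show ?thesis unfolding in_set_rev_nth by blast
    qed
    have gap: "\<exists>k \<in> set ks. i = k \<or> r < i \<and> i = r + a - k"
      if i: "i \<ge> 1" "i \<noteq> r" "Suc i \<in> set c" "i \<notin> set c" for i
    proof (rule ccontr)
      assume *: "\<not> ?thesis"
      have "phi i (levi_column r a k) = 0" if "k \<in> set ks" for k
        using phi_levi_column [of k r i a] ks(3) [OF that] i(1) * that by blast
      then have "phi i (concat cs) = 0" unfolding ks(1) by (intro phi_concat_0) auto
      moreover have "eps i c = 1" using col(1) i by (simp add: column_eps)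
      ultimately show False using e(2) [of i] i by simp
    qed
    have hd_max: "ks \<noteq> [] \<and> k \<le> hd ks" if "k \<in> set ks" for k
      using that ks(2) by (cases ks) auto
    have low: "i \<in> {x \<in> set c. x \<le> r}" if i: "0 < i" "Suc i \<in> {x \<in> set c. x \<le> r}" for i
    proof (rule ccontr)
      assume "i \<notin> {x \<in> set c. x \<le> r}"
      then have "i \<notin> set c" using i by simp
      then obtain k where "k \<in> set ks" "i = k" using gap [of i] i by auto
      then show False using initial [of i] hd_max i \<open>i \<notin> set c\<close> by auto
    qed
    have high: "i \<in> {x \<in> set c. r < x}" if i: "r < i" "Suc i \<in> {x \<in> set c. r < x}" for i
    proof (rule ccontr)
      assume "i \<notin> {x \<in> set c. r < x}"
      then have "i \<notin> set c" using i by simp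
      then obtain k where k: "k \<in> set ks" "i = k \<or> i = r + a - k" using gap [of i] i by auto
      have "k \<le> r" "k \<le> a" using ks k by auto
      have i_eq: "i = r + a - k" using k(2) i \<open>k \<le> r\<close> by auto
      have hd: "hd cs = levi_column r a (hd ks)" "cs \<noteq> []" "hd ks \<in> set ks" using ks hd_max [OF k(1)] by (auto simp: hd_map)
      then have len: "length (hd cs) = a" using ks length_levi_column by simp
      obtain p where p: "p < length c" "rev c ! p = Suc i" using i in_set_rev_nth [of "Suc i" c] by auto
      have "Suc i \<le> rev (hd cs) ! p" using col(3) hd p col(5) len by (auto simp: col_le_def)
      moreover have "rev (hd cs) ! p \<in> set (hd cs)" using p col(5) len by (metis length_rev nth_mem set_rev)
      ultimately have "Suc i \<le> hd ks \<or> Suc i \<le> r + a - hd ks" using hd by (auto simp: set_levi_column)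
      then show False using i_eq hd_max [OF k(1)] ks(3,4) [OF hd(3)] i by auto
    qed
    \<comment> \<open>Both parts of the column are without gaps now, so their sizes determine it.\<close>
    define k where "k = card {x \<in> set c. x \<le> r}"
    have S1: "{x \<in> set c. x \<le> r} = {0 + 1..0 + k}" unfolding k_def
      by (rule interval_of_downward_closed) (use low col(4) in \<open>auto intro: gr0I\<close>)
    have S2: "{x \<in> set c. r < x} = {r + 1..r + card {x \<in> set c. r < x}}"
      by (rule interval_of_downward_closed) (use high in auto)
    have "set c = {x \<in> set c. x \<le> r} \<union> {x \<in> set c. r < x}" by auto
    then have "card (set c) = k + card {x \<in> set c. r < x}" unfolding k_def
      by (metis (mono_tags, lifting) card_Un_disjoint disjoint_iff finite_Un finite_set leD mem_Collect_eq)
    then have ka: "k + card {x \<in> set c. r < x} = a" using col(1,5) card_column by simp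
    have kr: "k \<le> r"
    proof (cases "k = 0")
      case False
      then have "k \<in> {x \<in> set c. x \<le> r}" unfolding S1 by simp
      then show ?thesis by simp
    qed simp
    have "set c = {1..k} \<union> {r + 1..r + a - k}"
    proof -
      have "r + card {x \<in> set c. r < x} = r + a - k" using ka by simp
      then show ?thesis using S1 S2 \<open>set c = {x \<in> set c. x \<le> r} \<union> {x \<in> set c. r < x}\<close> by simp
    qed
    then have "c = levi_column r a k"
      by (intro set_eq_column col(1) column_levi_column kr) (simp add: set_levi_column)
    moreover have "k' \<le> k" if "k' \<in> set ks" for k'
    proof (cases "k' = 0")
      case False
      then have "k' \<in> {x \<in> set c. x \<le> r}" using initial [of k'] hd_max [OF that] ks(3) [OF that] by simp
      then show ?thesis unfolding S1 by simp
    qed simp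
    ultimately have "c # cs = map (levi_column r a) (k # ks) \<and> sorted_wrt (\<ge>) (k # ks) \<and>
      (\<forall>k \<in> set (k # ks). k \<le> r \<and> k \<le> a)"
      using ks kr ka by auto
    then show ?case by (rule exI [of _ "k # ks"])
  qed auto
  then show thesis using that by blast
qed

lemma count_column: "column c \<Longrightarrow> count_list c x = of_bool (x \<in> set c)"
proof -
  assume "column c"
  then have "distinct c" by (metis distinct_rev sorted_wrt_rev strict_sorted_iff)
  then show ?thesis by (induction c) auto
qed

lemma count_levi:
  assumes "\<And>k. k \<in> set ks \<Longrightarrow> k \<le> r" "1 \<le> j" "j \<le> r"
  shows "count_list (concat (map (levi_column r a) ks)) j = length (filter (\<lambda>k. j \<le> k) ks)"
  using assms(1)
proof (induction ks)
  case (Cons k ks)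
  then have "count_list (levi_column r a k) j = of_bool (j \<le> k)"
    using assms(2,3) by (subst count_column [OF column_levi_column]) (auto simp: set_levi_column)
  then show ?case using Cons by simp
qed simp

lemma levi_unique:
  assumes "t \<in> rect a s" "t' \<in> rect a s" "0 \<notin> set t" "0 \<notin> set t'"
    and "\<And>i. i \<ge> 1 \<Longrightarrow> i \<noteq> r \<Longrightarrow> eps i t = 0" "\<And>i. i \<ge> 1 \<Longrightarrow> i \<noteq> r \<Longrightarrow> eps i t' = 0"
    and "\<And>j. 1 \<le> j \<Longrightarrow> j \<le> r \<Longrightarrow> count_list t j = count_list t' j"
  shows "t = t'"
proof -
  have form: "\<exists>ks. u = concat (map (levi_column r a) ks) \<and> length ks = s \<and> sorted_wrt (\<ge>) ks \<and> (\<forall>k \<in> set ks. k \<le> r)"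
    if u: "u \<in> rect a s" "0 \<notin> set u" "\<And>i. i \<ge> 1 \<Longrightarrow> i \<noteq> r \<Longrightarrow> eps i u = 0" for u
  proof -
    obtain cs where cs: "u = concat cs" "weak_ss cs" "length cs = s" "\<forall>c \<in> set cs. length c = a"
      using u(1) by (rule rectE)
    obtain ks where ks: "cs = map (levi_column r a) ks" "sorted_wrt (\<ge>) ks" "\<And>k. k \<in> set ks \<Longrightarrow> k \<le> r \<and> k \<le> a"
      by (rule levi_classification [of cs a r]) (use cs u in auto)
    then have "u = concat (map (levi_column r a) ks) \<and> length ks = s \<and> sorted_wrt (\<ge>) ks \<and> (\<forall>k \<in> set ks. k \<le> r)"
      using cs by auto
    then show ?thesis by blast
  qed
  obtain ks where ks: "t = concat (map (levi_column r a) ks)" "length ks = s" "sorted_wrt (\<ge>) ks"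
    "\<And>k. k \<in> set ks \<Longrightarrow> k \<le> r" using form [of t] assms by blast
  obtain ks' where ks': "t' = concat (map (levi_column r a) ks')" "length ks' = s" "sorted_wrt (\<ge>) ks'"
    "\<And>k. k \<in> set ks' \<Longrightarrow> k \<le> r" using form [of t'] assms by blast
  have "ks = ks'"
  proof (rule sorted_by_counts [OF ks(3) ks'(3)])
    fix j
    consider "j = 0" | "1 \<le> j" "j \<le> r" | "j > r" by linarith
    then show "length (filter (\<lambda>k. j \<le> k) ks) = length (filter (\<lambda>k. j \<le> k) ks')"
    proof cases
      case 2
      then show ?thesis using assms(7) [of j] count_levi [of ks r j a] count_levi [of ks' r j a] ks ks' by simp
    next
      case 3
      then have "filter (\<lambda>k. j \<le> k) ks = []" "filter (\<lambda>k. j \<le> k) ks' = []"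
        using ks(4) ks'(4) by (fastforce simp: filter_empty_conv)+
      then show ?thesis by simp
    qed (use ks ks' in simp)
  qed
  then show ?thesis using ks ks' by simp
qed

section \<open>Injectivity of the Schensted map on pairs of rectangles\<close>

lemma highest_rect:
  assumes "t \<in> rect r s" "0 \<notin> set t" "\<And>i. i \<ge> 1 \<Longrightarrow> eps i t = 0"
  shows "t = canonical (replicate s r)"
proof -
  obtain cs where cs: "t = concat cs" "weak_ss cs" "length cs = s" "\<forall>c \<in> set cs. length c = r"
    using assms(1) by (rule rectE)
  have "map length cs = replicate s r" using cs by (intro replicate_eqI) auto
  moreover have "cs = map highest_column (map length cs)"
    using cs assms by (intro highest_tableau_columns) auto
  ultimately show ?thesis using cs(1) by (metis canonical_def)
qed

lemma phi_canonical_replicate: "i \<ge> 1 \<Longrightarrow> i \<noteq> r \<Longrightarrow> phi i (canonical (replicate s r)) = 0"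
  using phi_canonical_mem [of i "replicate s r"] by auto

lemma raise_appendE:
  assumes "raise i (u @ v) = Some w"
  obtains u' v' where "w = u' @ v'" "raise i u = Some u' \<and> v' = v \<or> u' = u \<and> raise i v = Some v'"
  using assms that by (auto simp: raise_append split: if_splits)

lemma rect_pair_raise:
  assumes "t2 \<in> rect a s'" "t1 \<in> rect r s" "raise i (t2 @ t1) = Some w"
  obtains u2 u1 where "u2 \<in> rect a s'" "u1 \<in> rect r s" "w = u2 @ u1"
  using assms(3)
proof (rule raise_appendE)
  fix u' v' assume "w = u' @ v'" "raise i t2 = Some u' \<and> v' = t1 \<or> u' = t2 \<and> raise i t1 = Some v'"
  then show thesis using that [of u' v'] assms rect_raise by blast
qed

text \<open>
  The tensor product of two rectangles is multiplicity free.  Raise both words simultaneously;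
  at the top the right factors are the highest rectangle, and the left factors are compared by
  \<open>levi_unique\<close>.
\<close>

lemma rect_pair_inj:
  assumes "t2 \<in> rect a s'" "t1 \<in> rect r s" "u2 \<in> rect a s'" "u1 \<in> rect r s"
    and "0 \<notin> set (t2 @ t1)" "keq (t2 @ t1) (u2 @ u1)"
  shows "t2 = u2 \<and> t1 = u1"
proof -
  have "t2 @ t1 = u2 @ u1"
    using assms
  proof (induction "t2 @ t1" arbitrary: t2 t1 u2 u1 rule: raise_induct [where I = "{1..}"])
    case highest
    have e: "eps i (t2 @ t1) = 0" "eps i (u2 @ u1) = 0" if "i \<ge> 1" for i
      using highest.hyps that keq_eps [OF highest.prems(6), of i] by auto
    have z: "0 \<notin> set (u2 @ u1)" using highest.prems(5) keq_set [OF highest.prems(6)] by metis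
    have 1: "t1 = canonical (replicate s r)" "u1 = canonical (replicate s r)"
      using e highest.prems z by (auto intro!: highest_rect simp: eps_append)
    have "t2 = u2"
    proof (rule levi_unique [OF highest.prems(1,3), of r])
      show "eps i t2 = 0" "eps i u2 = 0" if "i \<ge> 1" "i \<noteq> r" for i
        using e [OF that(1)] phi_canonical_replicate [OF that, of s] 1 by (auto simp: eps_append)
      show "count_list t2 j = count_list u2 j" for j
        using keq_count [OF highest.prems(6), of j] 1 by simp
    qed (use highest.prems z in auto)
    then show ?case using 1 by simp
  next
    case (raise i w')
    obtain v2 v1 where v: "v2 \<in> rect a s'" "v1 \<in> rect r s" "w' = v2 @ v1"
      using raise.prems(1,2) raise.hyps(2) by (rule rect_pair_raise)
    have "rel_option keq (Some w') (raise i (u2 @ u1))"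
      using keq_raise [OF raise.prems(6), of i] raise.hyps(2) by simp
    then obtain w'' where w'': "raise i (u2 @ u1) = Some w''" "keq w' w''"
      by (cases "raise i (u2 @ u1)") auto
    obtain x2 x1 where x: "x2 \<in> rect a s'" "x1 \<in> rect r s" "w'' = x2 @ x1"
      using raise.prems(3,4) w''(1) by (rule rect_pair_raise)
    have "0 \<notin> set w'" using raise_set [OF raise.hyps(2)] raise.prems(5) raise.hyps(1) by auto
    then have "w' = w''" using raise.hyps(3) [OF v(3) v(1,2) x(1,2)] w''(2) v(3) x(3) by simp
    then show ?case using raise_Some [OF raise.hyps(2)] raise_Some [OF w''(1)] by simp
  qed
  moreover have "length t2 = length u2" using assms length_rect by metis
  ultimately show ?thesis by simp
qed

section \<open>Bijectivity of the promotion map\<close>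

text \<open>
  The deletion of the ones and the shift of the other letters in one step, whereas \<open>psi_inv\<close> rectifies in
  between.  The shift commutes with the Schensted map, and in this order the letters of the word to be
  rectified are \<open>1, 2, \<dots>\<close>, to which the results on highest words apply.
\<close>

definition drop_ones :: "nat list \<Rightarrow> nat list" where
  "drop_ones t = map (\<lambda>a. a - 1) (filter (\<lambda>a. a \<noteq> 1) t)"

lemma drop_ones_simps [simp]: "drop_ones [] = []"
  "drop_ones (x # w) = (if x = 1 then drop_ones w else (x - 1) # drop_ones w)"
  "drop_ones (u @ v) = drop_ones u @ drop_ones v"
  by (auto simp: drop_ones_def)

lemma drop_ones_map_Suc: "0 \<notin> set w \<Longrightarrow> drop_ones (map Suc w) = w"
  by (induction w) auto

lemma map_Suc_drop_ones: "0 \<notin> set t \<Longrightarrow> map Suc (drop_ones t) = filter (\<lambda>a. a \<noteq> 1) t"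
  by (induction t) auto

lemma length_drop_ones: "length (drop_ones t) + count_list t 1 = length t"
  by (induction t) auto

lemma set_drop_ones: "0 \<notin> set t \<Longrightarrow> set (drop_ones t) = (\<lambda>a. a - 1) ` (set t - {1})"
  by (induction t) auto

lemma zero_notin_drop_ones: "0 \<notin> set t \<Longrightarrow> 0 \<notin> set (drop_ones t)"
  by (induction t) auto

lemma drop_ones_eps_phi:
  assumes "0 \<notin> set t" "i \<ge> 1"
  shows "eps i (drop_ones t) = eps (Suc i) t \<and> phi i (drop_ones t) = phi (Suc i) t"
  using assms(1)
proof (induction t)
  case (Cons x t)
  then obtain y where "x = Suc y" by (cases x) auto
  then show ?case using Cons assms(2) by (cases "y = 0") auto
qed simp

lemma drop_ones_eps: "0 \<notin> set t \<Longrightarrow> i \<ge> 1 \<Longrightarrow> eps i (drop_ones t) = eps (Suc i) t"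
  and drop_ones_phi: "0 \<notin> set t \<Longrightarrow> i \<ge> 1 \<Longrightarrow> phi i (drop_ones t) = phi (Suc i) t"
  using drop_ones_eps_phi by auto

text \<open>
  The ones do not take part in the brackets for indices above 1.
\<close>

lemma drop_ones_raise:
  assumes "0 \<notin> set t" "i \<ge> 1"
  shows "raise i (drop_ones t) = map_option drop_ones (raise (Suc i) t)"
  using assms(1)
proof (induction t)
  case (Cons x t)
  then obtain y where "x = Suc y" by (cases x) auto
  then show ?case using Cons assms(2)
    by (cases "y = 0") (auto simp: drop_ones_phi option.map_comp comp_def)
qed simp

lemma keq_map_Suc: "keq v w \<Longrightarrow> keq (map Suc v) (map Suc w)"
proof (induction rule: equivclp_induct)
  case (step b c)
  have "knuth_step (map Suc b) (map Suc c)" if "knuth_step b c" for b c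
    using that
  proof cases
    case (1 x y z u v)
    then show ?thesis using knuth_step.intros(1) [of "Suc x" "Suc y" "Suc z" "map Suc u" "map Suc v"] by simp
  next
    case (2 x y z u v)
    then show ?thesis using knuth_step.intros(2) [of "Suc x" "Suc y" "Suc z" "map Suc u" "map Suc v"] by simp
  qed
  then have "keq (map Suc b) (map Suc c)"
    using step.hyps(2) by (meson equivclp_sym r_into_equivclp)
  with step.IH show ?case by (rule keq_trans)
qed auto

lemma weak_ss_map_Suc: "weak_ss cs \<Longrightarrow> weak_ss (map (map Suc) cs)"
  by (auto simp: weak_ss_def successively_map sorted_wrt_map col_le_def rev_map elim!: successively_mono)

lemma psi_inv_eq:
  assumes "0 \<notin> set t"
  shows "psi_inv n r s t = fill_rectangle (2 * n) r s (schensted (drop_ones t))"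
proof -
  have z: "0 \<notin> set (drop_ones t)" using assms by (rule zero_notin_drop_ones)
  have *: "schensted (drop_ones t) \<in> tableaux" "keq (drop_ones t) (schensted (drop_ones t))"
    using schensted_eq_iff [OF z] by auto
  then obtain cs where "weak_ss cs" "schensted (drop_ones t) = concat cs" by (auto simp: tableaux_iff)
  then have "weak_ss (map (map Suc) cs)" "map Suc (schensted (drop_ones t)) = concat (map (map Suc) cs)"
    by (auto simp: weak_ss_map_Suc map_concat)
  then have "map Suc (schensted (drop_ones t)) \<in> tableaux" by (metis weak_ss_tableaux)
  moreover have "keq (filter (\<lambda>a. a \<noteq> 1) t) (map Suc (schensted (drop_ones t)))"
    using keq_map_Suc [OF *(2)] map_Suc_drop_ones [OF assms] by simp
  moreover have "0 \<notin> set (filter (\<lambda>a. a \<noteq> 1) t)" using assms by auto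
  ultimately have "schensted (filter (\<lambda>a. a \<noteq> 1) t) = map Suc (schensted (drop_ones t))"
    using schensted_eq_iff by blast
  then show ?thesis by (simp add: psi_inv_def comp_def)
qed

lemma fill_rectangle_concat:
  assumes "weak_ss cs" "length cs = s"
  shows "fill_rectangle a r s (concat cs) = concat (map (\<lambda>c. replicate (r - length c) a @ c) cs)"
proof -
  obtain bs k where bs: "semistandard bs" "cs = bs @ replicate k []"
    using assms(1) by (rule weak_ss_split)
  then have "columns (concat cs) = bs" by (simp add: columns_concat)
  moreover have "s - length bs = k" using bs assms(2) by auto
  ultimately show ?thesis using bs by (simp add: fill_rectangle_def Let_def)
qed

lemma weak_ss_fill:
  assumes "weak_ss cs" "\<And>c. c \<in> set cs \<Longrightarrow> length c \<le> r \<and> r \<le> Suc (length c)" "\<And>c x. c \<in> set cs \<Longrightarrow> x \<in> set c \<Longrightarrow> x < a"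
  shows "weak_ss (map (\<lambda>c. replicate (r - length c) a @ c) cs)"
proof -
  let ?f = "\<lambda>c. replicate (r - length c) a @ c"
  have f: "?f c = c \<or> ?f c = a # c" if "c \<in> set cs" for c
    using assms(2) [OF that] by (cases "r = length c") (auto simp: le_Suc_eq)
  have col: "column (?f c)" if "c \<in> set cs" for c
    using f [OF that] assms(1) assms(3) [OF that] that by (auto simp: weak_ss_def)
  have le: "col_le (?f c) (?f d)" if cd: "c \<in> set cs" "d \<in> set cs" "col_le c d" for c d
    unfolding col_le_def
  proof (intro conjI allI impI)
    show "length (?f d) \<le> length (?f c)" using assms(2) [OF cd(1)] assms(2) [OF cd(2)] by simp
    fix k assume k: "k < length (?f d)"
    then have kr: "k < r" using assms(2) [OF cd(2)] by simp
    show "rev (?f c) ! k \<le> rev (?f d) ! k"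
    proof (cases "k < length d")
      case True
      then show ?thesis using cd(3) by (auto simp: col_le_def nth_append)
    next
      case False
      then have "rev (?f d) ! k = a" using kr by (simp add: nth_append)
      moreover have "rev (?f c) ! k \<in> set (?f c)"
        using kr assms(2) [OF cd(1)] by (metis (no_types, lifting) le_add_diff_inverse2 length_append length_replicate length_rev nth_mem set_rev)
      moreover have "x \<le> a" if "x \<in> set (?f c)" for x
        using that assms(3) [OF cd(1), of x] by (auto simp: less_imp_le)
      ultimately show ?thesis by simp
    qed
  qed
  have "successively (\<lambda>c d. col_le (?f c) (?f d)) cs"
    by (rule successively_mono [of col_le]) (use assms(1) le in \<open>auto simp: weak_ss_def\<close>)
  then show ?thesis using col by (auto simp: weak_ss_def successively_map)
qed

lemma raise_count:
  "raise i w = Some w' \<Longrightarrow> j \<noteq> i \<Longrightarrow> j \<noteq> Suc i \<Longrightarrow> count_list w' j = count_list w j"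
  by (induction w arbitrary: w') (auto split: if_splits simp: of_bool_def)

lemma map_Suc_highest_column: "map Suc (highest_column h) = rev [2..<Suc (Suc h)]"
  by (simp add: highest_column_def rev_map [symmetric] map_Suc_upt numeral_2_eq_2 del: upt_Suc)

lemma drop_ones_levi:
  assumes "k \<le> 1" "1 \<le> r"
  shows "drop_ones (levi_column 1 r k) = highest_column (r - k)"
proof (cases "k = 0")
  case True
  then have "levi_column 1 r k = map Suc (highest_column r)"
    by (simp add: levi_column_def map_Suc_highest_column numeral_2_eq_2 del: upt_Suc)
  then show ?thesis using True by (simp add: drop_ones_map_Suc)
next
  case False
  then have "k = 1" using assms by simp
  then have "levi_column 1 r k = map Suc (highest_column (r - 1)) @ [1]"
    using assms(2) by (simp add: levi_column_def map_Suc_highest_column numeral_2_eq_2 del: upt_Suc) simp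
  then show ?thesis using \<open>k = 1\<close> by (simp add: drop_ones_map_Suc)
qed

lemma keq_shift_columns:
  "set w \<subseteq> {1..r} \<Longrightarrow> keq (w @ canonical (replicate q r)) (canonical (replicate q r) @ w)"
proof (induction q)
  case (Suc q)
  have "keq ((w @ highest_column r) @ canonical (replicate q r)) ((highest_column r @ w) @ canonical (replicate q r))"
    using Suc.prems by (intro keq_append keq_word_highest_column) auto
  also have "keq (highest_column r @ w @ canonical (replicate q r)) (highest_column r @ canonical (replicate q r) @ w)"
    using Suc.IH [OF Suc.prems] by (rule keq_append [OF keq_refl])
  then have "keq ((highest_column r @ w) @ canonical (replicate q r)) (highest_column r @ canonical (replicate q r) @ w)" by simp
  finally show ?case by simp
qed simp

lemma sorted_wrt_replicate: "sorted_wrt (\<ge>) (replicate p (x :: nat))"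
  by (induction p) auto

text \<open>
  The shape is invariant under the operators with index above 1, so it suffices to look at the Levi
  highest tableaux.  There the remaining columns are \<open>{1..r-1}\<close> and \<open>{1..r}\<close> in the wrong order, and they
  commute up to Knuth equivalence.
\<close>

lemma drop_ones_shape:
  assumes "t \<in> rect r s" "0 \<notin> set t" "1 \<le> r"
  shows "\<exists>cs. weak_ss cs \<and> keq (drop_ones t) (concat cs) \<and>
    map length cs = replicate (s - count_list t 1) r @ replicate (count_list t 1) (r - 1) \<and>
    count_list t 1 \<le> s"
  using assms
proof (induction t rule: raise_induct [where I = "{2..}"])
  case (highest t)
  obtain cs where cs: "t = concat cs" "weak_ss cs" "length cs = s" "\<forall>c \<in> set cs. length c = r"
    using highest.prems(1) by (rule rectE)
  obtain ks where ks: "cs = map (levi_column 1 r) ks" "sorted_wrt (\<ge>) ks" "\<And>k. k \<in> set ks \<Longrightarrow> k \<le> 1 \<and> k \<le> r"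
    by (rule levi_classification [of cs r 1]) (use cs highest in auto)
  have "\<exists>p q. ks = replicate p 1 @ replicate q 0"
    using ks(2,3)
  proof (induction ks)
    case Nil
    have "[] = replicate 0 1 @ replicate 0 (0::nat)" by simp
    then show ?case by blast
  next
    case (Cons k ks)
    then obtain p q where pq: "ks = replicate p 1 @ replicate q 0" by auto
    show ?case
    proof (cases "k = 0")
      case True
      then have "p = 0" using Cons.prems(1) pq by (cases p) auto
      then have "k # ks = replicate 0 1 @ replicate (Suc q) 0" using pq True by simp
      then show ?thesis by blast
    next
      case False
      then have "k = 1" using Cons.prems(2) [of k] by simp
      then have "k # ks = replicate (Suc p) 1 @ replicate q 0" using pq by simp
      then show ?thesis by blast
    qed
  qed
  then obtain p q where pq: "ks = replicate p 1 @ replicate q 0" by blast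
  have s: "s = p + q" using cs(3) ks(1) pq by simp
  have "count_list t 1 = length (filter (\<lambda>k. 1 \<le> k) ks)"
    unfolding cs(1) ks(1) by (rule count_levi) (use ks(3) in auto)
  then have p: "count_list t 1 = p" using pq by simp
  have "drop_ones t = canonical (replicate p (r - 1)) @ canonical (replicate q r)"
  proof -
    have "drop_ones (concat (map (levi_column 1 r) js)) = canonical (map (\<lambda>k. r - k) js)"
      if "\<And>k. k \<in> set js \<Longrightarrow> k \<le> 1" for js
      using that by (induction js) (simp_all add: drop_ones_levi [OF _ highest.prems(3), unfolded One_nat_def])
    from this [of ks] show ?thesis using ks(3) unfolding cs(1) ks(1) by (simp add: pq)
  qed
  also have "keq \<dots> (canonical (replicate q r) @ canonical (replicate p (r - 1)))"
    by (rule keq_shift_columns) (auto simp: canonical_def)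
  finally have "keq (drop_ones t) (concat (map highest_column (replicate q r @ replicate p (r - 1))))"
    by (simp add: canonical_def)
  moreover have "weak_ss (map highest_column (replicate q r @ replicate p (r - 1)))"
    by (rule weak_ss_canonical) (auto simp: sorted_wrt_append sorted_wrt_replicate)
  ultimately show ?case
    by (intro exI [of _ "map highest_column (replicate q r @ replicate p (r - 1))"]) (simp add: p [unfolded One_nat_def] s comp_def)
next
  case (raise t i t')
  then obtain j where j: "i = Suc j" "j \<ge> 1" by (cases i) auto
  have t': "t' \<in> rect r s" "0 \<notin> set t'"
    using rect_raise raise_set [OF raise.hyps(2)] raise by auto
  have p: "count_list t' 1 = count_list t 1" using raise_count [OF raise.hyps(2), of 1] raise.hyps(1) by simp
  obtain cs where cs: "weak_ss cs" "keq (drop_ones t') (concat cs)"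
    "map length cs = replicate (s - count_list t 1) r @ replicate (count_list t 1) (r - 1)" "count_list t 1 \<le> s"
    using raise.IH [OF t' raise.prems(3)] unfolding p by blast
  have "raise j (drop_ones t) = Some (drop_ones t')"
    using drop_ones_raise [OF raise.prems(2) j(2)] raise.hyps(2) j by simp
  then have "lower j (drop_ones t') = Some (drop_ones t)" using raise_Some by blast
  then have "rel_option keq (Some (drop_ones t)) (lower j (concat cs))" using keq_lower [OF cs(2), of j] by simp
  then obtain w where w: "lower j (concat cs) = Some w" "keq (drop_ones t) w" by (cases "lower j (concat cs)") auto
  obtain ds where "weak_ss ds" "concat ds = w" "map length ds = map length cs"
    using weak_ss_lower [OF cs(1) w(1)] by metis
  then show ?case using w(2) cs(3,4) by (intro exI [of _ ds]) simp
qed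

text \<open>
  The operators with index above 1 act on both sides of the map, and at the top the classification for
  \<open>r = 1\<close> applies.  The number of ones is known from the number of letters that are left.
\<close>

lemma drop_ones_inj:
  assumes "t \<in> rect r s" "t' \<in> rect r s" "0 \<notin> set t" "0 \<notin> set t'" "keq (drop_ones t) (drop_ones t')"
  shows "t = t'"
  using assms
proof (induction t arbitrary: t' rule: raise_induct [where I = "{2..}"])
  case (highest t)
  show ?case
  proof (rule levi_unique [OF highest.prems(1-4), of 1])
    fix i :: nat assume i: "i \<ge> 1" "i \<noteq> 1"
    then obtain j where j: "i = Suc j" "j \<ge> 1" by (cases i) auto
    show "eps i t = 0" using highest.hyps i by simp
    then show "eps i t' = 0"
      using keq_eps [OF highest.prems(5), of j] drop_ones_eps [OF _ j(2)] highest.prems j(1) by simp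
  next
    fix j :: nat assume "1 \<le> j" "j \<le> 1"
    then have "j = 1" by simp
    moreover have "length (drop_ones t) = length (drop_ones t')"
      by (metis keq_mset [OF highest.prems(5)] size_mset)
    ultimately show "count_list t j = count_list t' j"
      using length_drop_ones [of t] length_drop_ones [of t'] highest.prems(1,2) by (simp add: length_rect)
  qed
next
  case (raise t i u)
  then obtain j where j: "i = Suc j" "j \<ge> 1" by (cases i) auto
  have "rel_option keq (raise j (drop_ones t)) (raise j (drop_ones t'))"
    by (rule keq_raise [OF raise.prems(5)])
  then have "rel_option keq (Some (drop_ones u)) (map_option drop_ones (raise i t'))"
    using raise.hyps(2) raise.prems j by (simp add: drop_ones_raise)
  then obtain u' where u': "raise i t' = Some u'" "keq (drop_ones u) (drop_ones u')"
    by (cases "raise i t'") auto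
  have "u = u'"
    by (rule raise.IH [OF _ _ _ _ u'(2)])
       (use rect_raise raise raise_set [OF raise.hyps(2)] raise_set [OF u'(1)] u'(1) in auto)
  then show ?case using raise_Some [OF raise.hyps(2)] raise_Some [OF u'(1)] by simp
qed

lemma psi_inv_shape:
  assumes "t \<in> rectangular n r s" "1 \<le> r"
  obtains cs where "weak_ss cs" "length cs = s" "\<And>c. c \<in> set cs \<Longrightarrow> length c \<le> r \<and> r \<le> Suc (length c)"
    "keq (drop_ones t) (concat cs)" "schensted (drop_ones t) = concat cs" "\<And>c x. c \<in> set cs \<Longrightarrow> x \<in> set c \<Longrightarrow> 1 \<le> x \<and> x < 2 * n"
    "psi_inv n r s t = concat (map (\<lambda>c. replicate (r - length c) (2 * n) @ c) cs)"
proof -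
  have t: "t \<in> rect r s" "set t \<subseteq> {1..2 * n}" "0 \<notin> set t" using assms by (auto simp: rectangular_eq)
  obtain cs where cs: "weak_ss cs" "keq (drop_ones t) (concat cs)"
    "map length cs = replicate (s - count_list t 1) r @ replicate (count_list t 1) (r - 1)" "count_list t 1 \<le> s"
    using drop_ones_shape [OF t(1,3) assms(2)] by blast
  have len: "length cs = s" using arg_cong [OF cs(3), of length] cs(4) by simp
  have "set (map length cs) \<subseteq> {r, r - 1}" unfolding cs(3) by auto
  then have lens: "length c \<le> r \<and> r \<le> Suc (length c)" if "c \<in> set cs" for c
    using that assms(2) by auto
  have sch: "schensted (drop_ones t) = concat cs"
    using schensted_eq_iff [OF zero_notin_drop_ones [OF t(3)]] cs weak_ss_tableaux by blast
  have letters: "1 \<le> x \<and> x < 2 * n" if "c \<in> set cs" "x \<in> set c" for c x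
  proof -
    have "x \<in> set (drop_ones t)" using that keq_set [OF cs(2)] by auto
    then obtain y where y: "y \<in> set t" "y \<noteq> 1" "x = y - 1" using set_drop_ones [OF t(3)] by auto
    have "y \<in> {1..2 * n}" using y(1) t(2) by (rule subsetD [rotated])
    then show ?thesis using y by auto
  qed
  show thesis
    by (rule that [OF cs(1) len lens cs(2) sch letters])
       (simp_all add: psi_inv_eq [OF t(3)] sch fill_rectangle_concat [OF cs(1) len])
qed

lemma psi_inv_rectangular:
  assumes "t \<in> rectangular n r s" "1 \<le> r" "1 \<le> n"
  shows "psi_inv n r s t \<in> rectangular n r s"
proof -
  obtain cs where cs: "weak_ss cs" "length cs = s" "\<And>c. c \<in> set cs \<Longrightarrow> length c \<le> r \<and> r \<le> Suc (length c)"
    "keq (drop_ones t) (concat cs)" "schensted (drop_ones t) = concat cs" "\<And>c x. c \<in> set cs \<Longrightarrow> x \<in> set c \<Longrightarrow> 1 \<le> x \<and> x < 2 * n"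
    "psi_inv n r s t = concat (map (\<lambda>c. replicate (r - length c) (2 * n) @ c) cs)"
    using assms(1,2) by (rule psi_inv_shape) blast
  have "psi_inv n r s t \<in> rect r s"
    unfolding cs(7) by (rule rectI) (use weak_ss_fill [OF cs(1,3)] cs in auto)
  moreover have "set (psi_inv n r s t) \<subseteq> {1..2 * n}"
  proof
    fix x assume "x \<in> set (psi_inv n r s t)"
    then obtain c where "c \<in> set cs" "x = 2 * n \<or> x \<in> set c" unfolding cs(7) by auto
    then show "x \<in> {1..2 * n}" using cs(6) [of c x] assms(3) by auto
  qed
  ultimately show ?thesis using assms(2) by (simp add: rectangular_eq)
qed

text \<open>
  The letters \<open>2 * n\<close> in the image are exactly those that were filled in.
\<close>

lemma psi_inv_inj:
  assumes "1 \<le> r"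
  shows "inj_on (psi_inv n r s) (rectangular n r s)"
proof (rule inj_onI)
  have recover: "filter (\<lambda>x. x \<noteq> 2 * n) (psi_inv n r s t) = schensted (drop_ones t)"
    if t: "t \<in> rectangular n r s" for t
  proof -
    obtain cs where cs: "weak_ss cs" "length cs = s" "\<And>c. c \<in> set cs \<Longrightarrow> length c \<le> r \<and> r \<le> Suc (length c)"
    "keq (drop_ones t) (concat cs)" "schensted (drop_ones t) = concat cs" "\<And>c x. c \<in> set cs \<Longrightarrow> x \<in> set c \<Longrightarrow> 1 \<le> x \<and> x < 2 * n"
    "psi_inv n r s t = concat (map (\<lambda>c. replicate (r - length c) (2 * n) @ c) cs)"
      using t assms by (rule psi_inv_shape) blast
    have "filter (\<lambda>x. x \<noteq> 2 * n) (concat (map (\<lambda>c. replicate (r - length c) (2 * n) @ c) cs)) = concat cs"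
      using cs(6)
    proof (induction cs)
      case (Cons c cs)
      have "filter (\<lambda>x. x \<noteq> 2 * n) c = c" unfolding filter_id_conv using Cons.prems [of c] by fastforce
      moreover have "filter (\<lambda>x. x \<noteq> 2 * n) (concat (map (\<lambda>c. replicate (r - length c) (2 * n) @ c) cs)) = concat cs"
        by (rule Cons.IH, rule Cons.prems) simp_all
      ultimately show ?case by simp
    qed simp
    then show ?thesis by (simp only: cs(5,7))
  qed
  fix t t' assume *: "t \<in> rectangular n r s" "t' \<in> rectangular n r s" "psi_inv n r s t = psi_inv n r s t'"
  then have "schensted (drop_ones t) = schensted (drop_ones t')" using recover by metis
  moreover have t: "t \<in> rect r s" "0 \<notin> set t" "t' \<in> rect r s" "0 \<notin> set t'"
    using * assms by (auto simp: rectangular_eq)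
  ultimately have "keq (drop_ones t) (drop_ones t')"
    using schensted_eq_iff [OF zero_notin_drop_ones [OF t(2)]] schensted_eq_iff [OF zero_notin_drop_ones [OF t(4)]]
    by (metis keq_sym keq_trans)
  then show "t = t'" using drop_ones_inj t by blast
qed

lemma finite_rectangular: "1 \<le> r \<Longrightarrow> finite (rectangular n r s)"
proof -
  assume "1 \<le> r"
  then have "rectangular n r s \<subseteq> {t. set t \<subseteq> {1..2 * n} \<and> length t = s * r}"
    using length_rect by (auto simp: rectangular_eq)
  then show ?thesis using finite_lists_length_eq [of "{1..2 * n}"] finite_subset by blast
qed

text \<open>
  An injective self-map of a finite set is onto.
\<close>

lemma psi_inv_bij:
  assumes "1 \<le> r" "1 \<le> n"
  shows "bij_betw (psi_inv n r s) (rectangular n r s) (rectangular n r s)"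
  using psi_inv_rectangular [OF _ assms] psi_inv_inj [OF assms(1)] finite_rectangular [OF assms(1)]
  by (metis bij_betw_def endo_inj_surj image_subsetI)

lemma psi_psi_inv: "1 \<le> r \<Longrightarrow> t \<in> rectangular n r s \<Longrightarrow> psi n r s (psi_inv n r s t) = t"
  unfolding psi_def by (intro the_inv_into_f_f psi_inv_inj)

lemma psi_rectangular: "1 \<le> r \<Longrightarrow> 1 \<le> n \<Longrightarrow> t \<in> rectangular n r s \<Longrightarrow> psi n r s t \<in> rectangular n r s"
  unfolding psi_def
  by (metis bij_betw_def psi_inv_bij the_inv_into_into subset_refl)

lemma rectangular_raise: "1 \<le> r \<Longrightarrow> t \<in> rectangular n r s \<Longrightarrow> raise i t = Some t' \<Longrightarrow> 1 \<le> i \<Longrightarrow> t' \<in> rectangular n r s"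
  using rect_raise [of t r s i t'] raise_set [of i t t'] by (fastforce simp: rectangular_eq)

lemma rectangular_lower: "1 \<le> r \<Longrightarrow> t \<in> rectangular n r s \<Longrightarrow> lower i t = Some t' \<Longrightarrow> i < 2 * n \<Longrightarrow> t' \<in> rectangular n r s"
  using rect_lower [of t r s i t'] lower_set [of i t t'] by (fastforce simp: rectangular_eq)

lemma rectangular_size:
  assumes "t \<in> rectangular n r s" "1 \<le> r" "1 \<le> s"
  shows "num_rows t = r" "num_cols t = s"
proof -
  obtain cs where cs: "t = concat cs" "semistandard cs" "length cs = s" "\<forall>c \<in> set cs. length c = r"
    using assms(1) unfolding rectangular_def by blast
  then have "hd cs \<in> set cs" using assms(3) by (intro hd_in_set) auto
  then show "num_rows t = r" "num_cols t = s"
    using cs by (simp_all add: num_rows_def num_cols_def columns_concat)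
qed

lemma e_A_0:
  assumes "t \<in> rectangular n r s" "1 \<le> r" "1 \<le> s" "1 \<le> n"
  shows "e_A n 0 t = map_option (psi_inv n r s) (raise 1 (psi n r s t))"
    and "f_A n 0 t = map_option (psi_inv n r s) (lower 1 (psi n r s t))"
  using rectangular_size [OF assms(1-3)] assms(4) word_e_eq [of 1 n] word_f_eq [of 1 n]
  by (simp_all add: e_A_def f_A_def)

lemma e_A_pos: "1 \<le> i \<Longrightarrow> i \<le> 2 * n - 1 \<Longrightarrow> e_A n i = raise i"
  and f_A_pos: "1 \<le> i \<Longrightarrow> i \<le> 2 * n - 1 \<Longrightarrow> f_A n i = lower i"
  using word_e_eq [of i n] word_f_eq [of i n] by (auto simp: e_A_def f_A_def fun_eq_iff)

lemma e_A_rectangular: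
  assumes "t \<in> rectangular n r s" "1 \<le> r" "1 \<le> s" "1 \<le> n" "i < 2 * n"
  shows "e_A n i t = Some t' \<Longrightarrow> t' \<in> rectangular n r s"
    and "f_A n i t = Some t' \<Longrightarrow> t' \<in> rectangular n r s"
proof -
  have p: "psi n r s t \<in> rectangular n r s" using psi_rectangular assms by blast
  show "e_A n i t = Some t' \<Longrightarrow> t' \<in> rectangular n r s"
  proof (cases "i = 0")
    case True
    assume "e_A n i t = Some t'"
    then obtain u where "raise 1 (psi n r s t) = Some u" "t' = psi_inv n r s u"
      using e_A_0 [OF assms(1-4)] True by auto
    then show ?thesis using rectangular_raise [OF assms(2) p, of 1 u] psi_inv_rectangular assms(2,4) by auto
  next
    case False
    then show "e_A n i t = Some t' \<Longrightarrow> ?thesis"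
      using rectangular_raise [OF assms(2,1)] e_A_pos [of i n] assms(5) by auto
  qed
  show "f_A n i t = Some t' \<Longrightarrow> t' \<in> rectangular n r s"
  proof (cases "i = 0")
    case True
    assume "f_A n i t = Some t'"
    then obtain u where "lower 1 (psi n r s t) = Some u" "t' = psi_inv n r s u"
      using e_A_0 [OF assms(1-4)] True by auto
    then show ?thesis using rectangular_lower [OF assms(2) p, of 1 u] psi_inv_rectangular assms(2,4) by auto
  next
    case False
    then show "f_A n i t = Some t' \<Longrightarrow> ?thesis"
      using rectangular_lower [OF assms(2,1)] f_A_pos [of i n] assms(5) by auto
  qed
qed

lemma string_length_e_A_0:
  assumes "t \<in> rectangular n r s" "1 \<le> r" "1 \<le> s" "1 \<le> n"
  shows "string_length (e_A n 0) t = eps 1 (psi n r s t)"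
    and "string_length (f_A n 0) t = phi 1 (psi n r s t)"
proof -
  have e: "e_A n 0 t = None \<longleftrightarrow> eps 1 (psi n r s t) = 0"
    "e_A n 0 t = Some t' \<Longrightarrow> t' \<in> rectangular n r s \<and> eps 1 (psi n r s t) = Suc (eps 1 (psi n r s t'))"
    "f_A n 0 t = None \<longleftrightarrow> phi 1 (psi n r s t) = 0"
    "f_A n 0 t = Some t' \<Longrightarrow> t' \<in> rectangular n r s \<and> phi 1 (psi n r s t) = Suc (phi 1 (psi n r s t'))"
    if t: "t \<in> rectangular n r s" for t t'
  proof -
    have p: "psi n r s t \<in> rectangular n r s" using psi_rectangular assms t by blast
    note 0 = e_A_0 [OF t assms(2-4)]
    show "e_A n 0 t = None \<longleftrightarrow> eps 1 (psi n r s t) = 0" "f_A n 0 t = None \<longleftrightarrow> phi 1 (psi n r s t) = 0"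
      using 0 by (auto simp: raise_None_iff lower_None_iff)
    show "t' \<in> rectangular n r s \<and> eps 1 (psi n r s t) = Suc (eps 1 (psi n r s t'))" if et: "e_A n 0 t = Some t'"
    proof -
      obtain u where u: "raise 1 (psi n r s t) = Some u" "t' = psi_inv n r s u" using 0 et by (cases "raise 1 (psi n r s t)") auto
      then have "u \<in> rectangular n r s" using rectangular_raise [OF assms(2) p] by auto
      then show ?thesis using u raise_Some [OF u(1)] psi_psi_inv [OF assms(2)] psi_inv_rectangular assms by simp
    qed
    show "t' \<in> rectangular n r s \<and> phi 1 (psi n r s t) = Suc (phi 1 (psi n r s t'))" if ft: "f_A n 0 t = Some t'"
    proof -
      obtain u where u: "lower 1 (psi n r s t) = Some u" "t' = psi_inv n r s u" using 0 ft by (cases "lower 1 (psi n r s t)") auto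
      then have "u \<in> rectangular n r s" using rectangular_lower [OF assms(2) p] assms by auto
      then show ?thesis using u lower_Some [OF u(1)] psi_psi_inv [OF assms(2)] psi_inv_rectangular assms by simp
    qed
  qed
  show "string_length (e_A n 0) t = eps 1 (psi n r s t)"
    by (rule string_length_eqI [where Q = "\<lambda>t. t \<in> rectangular n r s", OF assms(1) e(1,2)])
  show "string_length (f_A n 0) t = phi 1 (psi n r s t)"
    by (rule string_length_eqI [where Q = "\<lambda>t. t \<in> rectangular n r s", OF assms(1) e(3,4)])
qed

section \<open>The zero operator on tableaux with a one in every column\<close>

lemma raise_middle:
  assumes "eps i u = 0" "phi i v = 0" "raise i c = Some c'"
  shows "raise i (u @ c @ v) = Some (u @ c' @ v)"
proof -
  have "eps i c \<noteq> 0" using assms(3) raise_None_iff [of i c] by auto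
  then show ?thesis using assms by (simp add: raise_append)
qed

text \<open>
  Two columns of equal height rewritten as a row reading.  A tail \<open>x\<close> of the first column stays
  behind at the end.  This makes both sides of \<open>keq_slide_letter\<close> equivalent to the same word.
\<close>

lemma keq_two_columns:
  assumes "list_all2 (\<le>) d d'" "column (d @ x)"
  shows "keq (d @ x @ d') (concat (map (\<lambda>(a, b). [a, b]) (zip d d')) @ x)"
  using assms
proof (induction rule: list_all2_induct)
  case (Cons a d b d')
  have "keq ((a # (d @ x) @ [b]) @ d') ((a # b # (d @ x)) @ d')"
    by (rule keq_append [OF keq_column_letter keq_refl]) (use Cons.hyps(1) Cons.prems in auto)
  also have "keq ((a # b # (d @ x)) @ d') (a # b # concat (map (\<lambda>(a, b). [a, b]) (zip d d')) @ x)"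
    using Cons by (simp add: keq_Cons)
  finally show ?case by simp
qed simp

lemma keq_slide_letter:
  assumes "list_all2 (\<le>) d d'" "column (d @ [x])"
  shows "keq (d @ d' @ [x]) (d @ [x] @ d')"
proof -
  have "keq ((d @ [] @ d') @ [x]) ((concat (map (\<lambda>(a, b). [a, b]) (zip d d')) @ []) @ [x])"
    by (rule keq_append [OF keq_two_columns keq_refl]) (use assms in \<open>auto simp: sorted_wrt_append\<close>)
  then have 1: "keq (d @ d' @ [x]) (concat (map (\<lambda>(a, b). [a, b]) (zip d d')) @ [x])" by simp
  have 2: "keq (d @ [x] @ d') (concat (map (\<lambda>(a, b). [a, b]) (zip d d')) @ [x])"
    by (rule keq_two_columns [OF assms])
  show ?thesis by (rule keq_trans [OF 1 keq_sym [OF 2]])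
qed

lemma keq_slide_letter_chain:
  assumes "successively (list_all2 (\<le>)) (d # ds)" "\<And>d'. d' \<in> set (d # ds) \<Longrightarrow> column (d' @ [x])"
  shows "keq (concat (d # ds) @ [x]) (d @ [x] @ concat ds)"
  using assms
proof (induction ds arbitrary: d)
  case (Cons d' ds)
  have "keq (concat (d' # ds) @ [x]) (d' @ [x] @ concat ds)"
    using Cons.prems by (intro Cons.IH) auto
  then have "keq (d @ concat (d' # ds) @ [x]) (d @ d' @ [x] @ concat ds)"
    by (rule keq_append [OF keq_refl])
  also have "keq ((d @ d' @ [x]) @ concat ds) ((d @ [x] @ d') @ concat ds)"
    by (rule keq_append [OF keq_slide_letter keq_refl]) (use Cons.prems in auto)
  then have "keq (d @ d' @ [x] @ concat ds) (d @ [x] @ d' @ concat ds)" by simp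
  finally show ?case by simp
qed simp

lemma keq_slide_letters:
  assumes "successively (list_all2 (\<le>)) (as @ bs)" "\<And>d. d \<in> set (as @ bs) \<Longrightarrow> column (d @ [x])"
  shows "keq (concat as @ concat (map (\<lambda>d. d @ [x]) bs))
     (concat (map (\<lambda>d. d @ [x]) (take (length bs) (as @ bs))) @ concat (drop (length bs) (as @ bs)))"
  using assms
proof (induction bs arbitrary: as)
  case (Cons b bs)
  show ?case
  proof (cases as)
    case as: (Cons a as')
    have ch: "successively (list_all2 (\<le>)) (a # as' @ [b])" "successively (list_all2 (\<le>)) ((as' @ [b]) @ bs)"
    proof -
      have *: "successively (list_all2 (\<le>)) ((a # as' @ [b]) @ bs)" using Cons.prems(1) as by simp
      show "successively (list_all2 (\<le>)) (a # as' @ [b])"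
        using * successively_append_iff [of _ "a # as' @ [b]" bs] by blast
      have "successively (list_all2 (\<le>)) (a # ((as' @ [b]) @ bs))" using * by simp
      then show "successively (list_all2 (\<le>)) ((as' @ [b]) @ bs)"
        using successively_Cons [of "list_all2 (\<le>)" a "(as' @ [b]) @ bs"] by simp
    qed
    have "keq ((concat (a # as' @ [b]) @ [x]) @ concat (map (\<lambda>d. d @ [x]) bs))
              ((a @ [x] @ concat (as' @ [b])) @ concat (map (\<lambda>d. d @ [x]) bs))"
      by (rule keq_append [OF keq_slide_letter_chain [OF ch(1)] keq_refl]) (use Cons.prems(2) as in auto)
    also have "(a @ [x] @ concat (as' @ [b])) @ concat (map (\<lambda>d. d @ [x]) bs) =
      (a @ [x]) @ concat (as' @ [b]) @ concat (map (\<lambda>d. d @ [x]) bs)" by simp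
    also have "keq \<dots> ((a @ [x]) @
        concat (map (\<lambda>d. d @ [x]) (take (length bs) ((as' @ [b]) @ bs))) @ concat (drop (length bs) ((as' @ [b]) @ bs)))"
      by (rule keq_append [OF keq_refl Cons.IH [OF ch(2)]]) (use Cons.prems(2) as in auto)
    finally show ?thesis using as by simp
  qed simp
qed simp

lemma map_nth_split:
  "length ds = s \<Longrightarrow> q \<le> s \<Longrightarrow>
   map (\<lambda>j. if j < q then f (ds ! j) else h (ds ! j)) [0..<s] = map f (take q ds) @ map h (drop q ds)"
  by (rule nth_equalityI) (auto simp: nth_append)

lemma col_le_snoc:
  "col_le (d @ [x]) (d' @ [x']) \<longleftrightarrow> x \<le> x' \<and> col_le d d'"
proof
  assume *: "col_le (d @ [x]) (d' @ [x'])"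
  have "(x # rev d) ! k \<le> (x' # rev d') ! k" if "k < Suc (length d')" for k
    using * that by (simp add: col_le_def)
  from this [of 0] this [of "Suc k" for k] show "x \<le> x' \<and> col_le d d'"
    using * by (simp add: col_le_def)
next
  assume *: "x \<le> x' \<and> col_le d d'"
  have "(x # rev d) ! k \<le> (x' # rev d') ! k" if "k < Suc (length d')" for k
    using * that by (cases k) (auto simp: col_le_def)
  then show "col_le (d @ [x]) (d' @ [x'])"
    using * by (simp add: col_le_def)
qed

lemma col_le_list_all2: "col_le d d' \<Longrightarrow> length d = length d' \<Longrightarrow> list_all2 (\<le>) d d'"
proof -
  assume "col_le d d'" "length d = length d'"
  then have "list_all2 (\<le>) (rev d) (rev d')" by (simp add: list_all2_conv_all_nth col_le_def)
  then show ?thesis by simp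
qed

lemma col_le_map_Suc: "col_le (map Suc d) (map Suc d') \<longleftrightarrow> col_le d d'"
  by (auto simp: col_le_def rev_map)

lemma column_snoc: "column (d @ [x]) \<longleftrightarrow> column d \<and> (\<forall>y \<in> set d. x < y)"
  by (auto simp: sorted_wrt_append)

lemma weak_ss_map_upt:
  "(\<And>j. j < s \<Longrightarrow> column (g j)) \<Longrightarrow> (\<And>j. Suc j < s \<Longrightarrow> col_le (g j) (g (Suc j))) \<Longrightarrow>
   weak_ss (map g [0..<s])"
  by (simp add: weak_ss_def successively_iff_nth del: upt_Suc)

text \<open>
  A rectangular tableau whose columns are \<open>d @ [1]\<close> for \<open>d\<close> in \<open>ds\<close>, without the letter \<open>2 * n\<close>.  On such a tableau \<open>\<psi>\<close>
  and the powers of \<open>e\<^sub>0\<close> are explicit: \<open>promoted q\<close> is the result of \<open>q\<close> steps, and \<open>shifted q\<close> is its image under \<open>\<psi>\<close>,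
  all letters raised by one and the first \<open>q\<close> letters of the first row turned into ones.  The intermediate
  \<open>rectified q\<close> is what remains of \<open>shifted q\<close> before filling up the rectangle.
\<close>

locale columns_with_one =
  fixes n r s :: nat and ds :: "nat list list"
  assumes n: "1 \<le> n" and r: "1 \<le> r"
    and len: "length ds = s" "\<And>d. d \<in> set ds \<Longrightarrow> Suc (length d) = r"
    and letters: "\<And>d x. d \<in> set ds \<Longrightarrow> x \<in> set d \<Longrightarrow> 1 < x \<and> x < 2 * n"
    and ss: "weak_ss (map (\<lambda>d. d @ [1]) ds)"
begin

definition shifted :: "nat \<Rightarrow> nat list" where
  "shifted q = concat (map (\<lambda>j. map Suc (ds ! j) @ [if j < q then 1 else 2]) [0..<s])"

definition rectified :: "nat \<Rightarrow> nat list list" where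
  "rectified q = map (\<lambda>j. if j < s - q then ds ! j @ [1] else ds ! j) [0..<s]"

definition promoted :: "nat \<Rightarrow> nat list" where
  "promoted q = concat (map (\<lambda>j. if j < s - q then ds ! j @ [1] else 2 * n # ds ! j) [0..<s])"

lemma length_rectified: "length (rectified q) = s"
  by (simp add: rectified_def)

lemma ds_column: "d \<in> set ds \<Longrightarrow> column d"
  using ss by (auto simp: weak_ss_def column_snoc)

lemma ds_le: "Suc j < s \<Longrightarrow> col_le (ds ! j) (ds ! Suc j)"
  using ss len(1) by (auto simp: weak_ss_def successively_iff_nth col_le_snoc)

lemma letters_nth: "j < s \<Longrightarrow> x \<in> set (ds ! j) \<Longrightarrow> Suc 0 < x \<and> 0 < x \<and> x < 2 * n"
  using letters [of "ds ! j" x] len(1) by simp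

lemma shifted_rectangular: "shifted q \<in> rectangular n r s"
proof -
  have "shifted q \<in> rect r s"
    unfolding shifted_def
  proof (rule rectI)
    show "weak_ss (map (\<lambda>j. map Suc (ds ! j) @ [if j < q then 1 else 2]) [0..<s])"
      unfolding weak_ss_def successively_iff_nth
      using ds_column len(1) ds_le
      by (auto simp: column_snoc sorted_wrt_map col_le_snoc col_le_map_Suc letters_nth)
  qed (use len in auto)
  moreover have "set (shifted q) \<subseteq> {1..2 * n}"
  proof -
    have "x \<in> {1..2 * n}" if "j < s" "x \<in> set (map Suc (ds ! j) @ [if j < q then 1 else 2])" for j x
      using that letters_nth n by (auto split: if_splits simp: Suc_le_eq)
    then show ?thesis unfolding shifted_def by auto
  qed
  ultimately show ?thesis using r by (simp add: rectangular_eq)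
qed

lemma raise_shifted:
  assumes "q < s"
  shows "raise 1 (shifted q) = Some (shifted (Suc q))"
proof -
  define f where "f q j = map Suc (ds ! j) @ [if j < q then 1 else 2]" for q j :: nat
  have upt: "[0..<s] = [0..<q] @ q # [Suc q..<s]"
    using assms by (metis le_add1 le_add_same_cancel1 less_imp_le_nat upt_add_eq_append upt_conv_Cons le_add_diff_inverse zero_le)
  have sets: "1 \<in> set (f p j) \<longleftrightarrow> j < p" "2 \<in> set (f p j) \<longleftrightarrow> \<not> j < p" "column (f p j)" if "j < s" for j p
    using that letters_nth [OF that] ds_column [of "ds ! j"] len(1)
    by (auto simp: f_def column_snoc sorted_wrt_map numeral_2_eq_2)
  have 1: "shifted p = concat (map (f p) [0..<q]) @ f p q @ concat (map (f p) [Suc q..<s])" for p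
    unfolding shifted_def upt by (simp add: f_def [abs_def])
  have "map (f (Suc q)) [0..<q] = map (f q) [0..<q]" "map (f (Suc q)) [Suc q..<s] = map (f q) [Suc q..<s]"
    by (auto simp: f_def)
  note eqs = this
  have 2: "shifted (Suc q) = concat (map (f q) [0..<q]) @ f (Suc q) q @ concat (map (f q) [Suc q..<s])"
    by (simp only: 1 eqs)
  show ?thesis
    unfolding 1 [of q] 2
  proof (rule raise_middle)
    show "eps 1 (concat (map (f q) [0..<q])) = 0"
      using assms sets by (intro eps_concat_0) (auto simp: column_eps numeral_2_eq_2)
    show "phi 1 (concat (map (f q) [Suc q..<s])) = 0"
      using assms sets by (intro phi_concat_0) (auto simp: column_phi numeral_2_eq_2)
    have "map (\<lambda>x. if x = Suc 1 then 1 else x) (f q q) = f (Suc q) q"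
      using letters [of "ds ! q"] assms len(1) by (auto simp: f_def)
    then show "raise 1 (f q q) = Some (f (Suc q) q)"
      using column_raise [of "f q q" 1] sets [OF assms, of q] by (simp add: numeral_2_eq_2)
  qed
qed

lemma weak_ss_rectified: "weak_ss (rectified q)"
  unfolding rectified_def
proof (rule weak_ss_map_upt)
  show "col_le (if j < s - q then ds ! j @ [1] else ds ! j) (if Suc j < s - q then ds ! Suc j @ [1] else ds ! Suc j)"
    if j: "Suc j < s" for j
  proof -
    have l: "length (ds ! j) = length (ds ! Suc j)" using len j by (metis Suc_inject Suc_lessD nth_mem)
    have "rev (ds ! j @ [1]) ! k \<le> rev (ds ! Suc j) ! k" if k: "k < length (ds ! Suc j)" for k
    proof (cases k)
      case 0
      have "rev (ds ! Suc j) ! k \<in> set (ds ! Suc j)" using k by (metis length_rev nth_mem set_rev)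
      then show ?thesis using 0 letters [of "ds ! Suc j"] j len(1) by (auto simp: less_imp_le)
    next
      case (Suc k')
      have "rev (ds ! j) ! k' \<le> rev (ds ! Suc j) ! k'"
        using ds_le [OF j] k Suc by (simp add: col_le_def)
      also have "\<dots> \<le> rev (ds ! Suc j) ! k"
        using column_rev_less [OF ds_column, of "ds ! Suc j" k' k] k Suc j len(1) by simp
      finally show ?thesis using Suc by simp
    qed
    then have "col_le (ds ! j @ [1]) (ds ! Suc j)" using l by (simp add: col_le_def)
    then show ?thesis using ds_le [OF j] by (auto simp: col_le_snoc)
  qed
  show "column (if j < s - q then ds ! j @ [1] else ds ! j)" if "j < s" for j
    using that ds_column [of "ds ! j"] letters_nth [OF that] len(1) by (auto simp: column_snoc)
qed

text \<open>
  Without the ones and after the shift, the columns of \<open>shifted q\<close> lack their first letter in the first \<open>q\<close>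
  places.  Sliding the letters 1 to the left moves these holes to the last \<open>q\<close> columns, and since all
  columns are compatible, nothing else happens.
\<close>

lemma psi_inv_shifted:
  assumes "q \<le> s"
  shows "psi_inv n r s (shifted q) = promoted q"
proof -
  have z: "0 \<notin> set (shifted q)" using shifted_rectangular [of q] r by (auto simp: rectangular_eq)
  have z': "0 \<notin> set d" if "d \<in> set ds" for d using letters [OF that, of 0] by auto
  have "drop_ones (shifted q) = concat (map (\<lambda>j. if j < q then ds ! j else ds ! j @ [1]) [0..<s])"
  proof -
    have "drop_ones (concat (map f js)) = concat (map (\<lambda>j. drop_ones (f j)) js)" for f and js :: "nat list"
      by (induction js) auto
    moreover have "drop_ones (map Suc (ds ! j) @ [if j < q then 1 else 2]) = (if j < q then ds ! j else ds ! j @ [1])"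
      if "j < s" for j using z' [of "ds ! j"] that len(1) by (simp add: drop_ones_map_Suc)
    ultimately show ?thesis unfolding shifted_def by (auto intro!: arg_cong [of _ _ concat])
  qed
  also have "\<dots> = concat (take q ds) @ concat (map (\<lambda>d. d @ [1]) (drop q ds))"
    using map_nth_split [OF len(1) assms, of "\<lambda>d. d" "\<lambda>d. d @ [1]"] by simp
  also have "keq \<dots> (concat (map (\<lambda>d. d @ [1]) (take (length (drop q ds)) (take q ds @ drop q ds))) @
      concat (drop (length (drop q ds)) (take q ds @ drop q ds)))"
  proof (rule keq_slide_letters)
    show "successively (list_all2 (\<le>)) (take q ds @ drop q ds)"
      unfolding successively_iff_nth append_take_drop_id
      using ds_le len by (auto intro!: col_le_list_all2) (metis Suc_inject Suc_lessD nth_mem)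
    show "column (d @ [1])" if "d \<in> set (take q ds @ drop q ds)" for d
      using that ss unfolding append_take_drop_id by (auto simp: weak_ss_def)
  qed
  also have "\<dots> = concat (rectified q)"
    using map_nth_split [OF len(1), of "s - q" "\<lambda>d. d @ [1]" "\<lambda>d. d"] len(1) by (simp add: rectified_def)
  finally have "schensted (drop_ones (shifted q)) = concat (rectified q)"
    using schensted_eq_iff [OF zero_notin_drop_ones [OF z]] weak_ss_tableaux [OF weak_ss_rectified] by blast
  then have "psi_inv n r s (shifted q) = concat (map (\<lambda>c. replicate (r - length c) (2 * n) @ c) (rectified q))"
    using psi_inv_eq [OF z] fill_rectangle_concat [OF weak_ss_rectified length_rectified] by simp
  also have "map (\<lambda>c. replicate (r - length c) (2 * n) @ c) (rectified q) =
      map (\<lambda>j. if j < s - q then ds ! j @ [1] else 2 * n # ds ! j) [0..<s]"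
  proof -
    have "replicate (r - length (ds ! j)) (2 * n) = [2 * n]" "replicate (r - length (ds ! j @ [1])) (2 * n) = []"
      if "j < s" for j using len(2) [of "ds ! j"] that len(1) by auto
    then show ?thesis unfolding rectified_def by auto
  qed
  finally show ?thesis by (simp add: promoted_def)
qed

lemma promoted_rectangular: "q \<le> s \<Longrightarrow> promoted q \<in> rectangular n r s"
  using psi_inv_rectangular [OF shifted_rectangular r n] psi_inv_shifted by metis

lemma psi_promoted: "q \<le> s \<Longrightarrow> psi n r s (promoted q) = shifted q"
  using psi_psi_inv [OF r shifted_rectangular] psi_inv_shifted by metis

lemma e_A_promoted:
  assumes "q < s"
  shows "e_A n 0 (promoted q) = Some (promoted (Suc q))"
  using e_A_0(1) [OF promoted_rectangular r _ n, of q] assms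
  by (simp add: psi_promoted raise_shifted [unfolded One_nat_def] psi_inv_shifted)

lemma string_length_promoted:
  assumes "q < s"
  shows "string_length (e_A n 0) (promoted q) > 0"
proof -
  have "eps 1 (shifted q) \<noteq> 0" using raise_shifted [OF assms] raise_None_iff [of 1 "shifted q"] by simp
  then show ?thesis
    using string_length_e_A_0(1) [OF promoted_rectangular r _ n, of q] assms psi_promoted [of q] by simp
qed

text \<open>
  No ones, hence no step of \<open>f\<^sub>1\<close>, after transport by \<open>\<psi>\<close>.
\<close>

lemma string_length_promoted_0:
  assumes "1 \<le> s"
  shows "string_length (f_A n 0) (promoted 0) = 0"
proof -
  have "0 \<notin> set (ds ! j)" if "j < s" for j using letters_nth [OF that, of 0] by auto
  then have "1 \<notin> set (shifted 0)" unfolding shifted_def by auto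
  then have "lower 1 (shifted 0) = None" using lower_set [of 1 "shifted 0"] by (cases "lower 1 (shifted 0)") auto
  then have "phi 1 (shifted 0) = 0" by (simp add: lower_None_iff)
  then show ?thesis
    using string_length_e_A_0(2) [OF promoted_rectangular r assms n, of 0] psi_promoted [of 0] by simp
qed

lemma promoted_split:
  "q \<le> s \<Longrightarrow> promoted q = concat (map (\<lambda>d. d @ [1]) (take (s - q) ds) @ map (\<lambda>d. 2 * n # d) (drop (s - q) ds))"
  using map_nth_split [OF len(1), of "s - q" "\<lambda>d. d @ [1]" "\<lambda>d. 2 * n # d"] by (simp add: promoted_def)

end

section \<open>Tensor products\<close>

lemma iterate_transfer:
  assumes "Q x" "\<And>x. Q x \<Longrightarrow> g' (h x) = map_option h (g x)" "\<And>x y. Q x \<Longrightarrow> g x = Some y \<Longrightarrow> Q y"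
  shows "iterate g' k (h x) = map_option h (iterate g k x)"
  using assms(1)
proof (induction k arbitrary: x)
  case (Suc k)
  then show ?case using assms(2) [of x] assms(3) [of x] by (cases "g x") (auto simp: iterate_Suc)
qed simp

lemma string_length_transfer:
  assumes "Q x" "\<And>x. Q x \<Longrightarrow> g' (h x) = map_option h (g x)" "\<And>x y. Q x \<Longrightarrow> g x = Some y \<Longrightarrow> Q y"
  shows "string_length g' (h x) = string_length g x"
proof -
  have "iterate g' k (h x) = map_option h (iterate g k x)" for k
    by (rule iterate_transfer [where Q = Q]) (use assms in auto)
  then have "iterate g' k (h x) \<noteq> None \<longleftrightarrow> iterate g k x \<noteq> None" for k by simp
  then show ?thesis unfolding string_length_def by simp
qed

lemma string_length_None: "string_length (\<lambda>_. None) b = 0"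
  by (rule string_length_eqI [where Q = "\<lambda>_. True" and h = "\<lambda>_. 0"]) auto

lemma tensor_e_left:
  assumes "e t2 = Some c" "string_length e t2 > string_length f t1"
  shows "tensor_e e f [t2, t1] = Some [c, t1]"
proof -
  have "string_length (power_f e f 1) [t1] = string_length f t1"
    by (rule string_length_transfer [where Q = "\<lambda>_. True"]) (auto simp: string_length_None)
  then show ?thesis using assms by (simp add: tensor_e_def)
qed

text \<open>
  The tensor product is associative: the operators on a tensor product of words are the operators on the
  concatenated word.
\<close>

lemma power_concat:
  assumes "length bs = k"
  shows "map_option concat (power_e (raise i) (lower i) k bs) = raise i (concat bs) \<and>
    map_option concat (power_f (raise i) (lower i) k bs) = lower i (concat bs)"
  using assms
proof (induction k arbitrary: bs)
  case (Suc k)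
  obtain b cs where bs: "bs = b # cs" "length cs = k" using Suc.prems by (cases bs) auto
  have "string_length lower' cs = phi i (concat cs)"
    if p: "lower' = power_f (raise i) (lower i) k" for lower'
  proof -
    have pres: "power_f e f k bs = Some bs' \<Longrightarrow> length bs' = length bs"
      for e f :: "nat list operator" and k bs bs'
    proof (induction k arbitrary: bs bs')
      case (Suc k)
      then show ?case by (cases bs) (auto split: if_splits)
    qed simp
    show ?thesis unfolding p
    proof (rule string_length_eqI [where Q = "\<lambda>u. length u = k" and h = "\<lambda>u. phi i (concat u)"])
      fix u :: "nat list list" assume u: "length u = k"
      note * = Suc.IH [OF u, THEN conjunct2]
      show "power_f (raise i) (lower i) k u = None \<longleftrightarrow> phi i (concat u) = 0"
        using * lower_None_iff [of i "concat u"] by (metis map_option_is_None)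
      fix v assume v: "power_f (raise i) (lower i) k u = Some v"
      then have "lower i (concat u) = Some (concat v)" using * by simp
      then show "length v = k \<and> phi i (concat u) = Suc (phi i (concat v))"
        using pres [OF v] u lower_Some by simp
    qed (use bs in simp)
  qed
  then have "string_length (power_f (raise i) (lower i) k) cs = phi i (concat cs)" by simp
  then show ?case
    using Suc.IH [OF bs(2)]
    by (auto simp: bs(1) raise_append lower_append string_length_raise option.map_comp comp_def
      simp flip: Suc.IH [OF bs(2), THEN conjunct1] Suc.IH [OF bs(2), THEN conjunct2])
qed simp

lemma tensor_concat:
  "map_option concat (tensor_e (raise i) (lower i) bs) = raise i (concat bs)"
  "map_option concat (tensor_f (raise i) (lower i) bs) = lower i (concat bs)"
  using power_concat [OF refl] by (auto simp: tensor_e_def tensor_f_def)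

lemma power_f_closed:
  assumes "\<And>t x t'. P t x \<Longrightarrow> f t = Some t' \<Longrightarrow> P t' x" "list_all2 P bs xs" "power_f e f k bs = Some bs'"
  shows "list_all2 P bs' xs"
  using assms(2,3)
proof (induction k arbitrary: bs bs' xs)
  case (Suc k)
  then show ?case using assms(1)
    by (cases bs) (auto simp: list_all2_Cons1 split: if_splits)
qed simp

lemma power_e_closed:
  assumes "\<And>t x t'. P t x \<Longrightarrow> e t = Some t' \<Longrightarrow> P t' x" "list_all2 P bs xs" "power_e e f k bs = Some bs'"
  shows "list_all2 P bs' xs"
  using assms(2,3)
proof (induction k arbitrary: bs bs' xs)
  case (Suc k)
  then show ?case using assms(1)
    by (cases bs) (auto simp: list_all2_Cons1 split: if_splits)
qed simp

section \<open>The ambient crystal and the virtual operators\<close>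

text \<open>
  Positivity of both side lengths is included since the size of a rectangle is recovered from the tableau.
\<close>

definition in_factor :: "nat \<Rightarrow> nat list \<Rightarrow> nat \<times> nat \<Rightarrow> bool" where
  "in_factor n t x \<longleftrightarrow> 1 \<le> fst x \<and> 1 \<le> snd x \<and> t \<in> rectangular n (fst x) (snd x)"

definition ambient_set :: "affine_type \<Rightarrow> nat \<Rightarrow> nat \<Rightarrow> nat \<Rightarrow> nat list list set" where
  "ambient_set g n r s = {b. list_all2 (in_factor n) b (ambient g n r s)}"

lemma ambient_set_tensor:
  assumes "b \<in> ambient_set g n r s" "1 \<le> n" "i < 2 * n"
  shows "tensor_e (e_A n i) (f_A n i) b = Some b' \<Longrightarrow> b' \<in> ambient_set g n r s"
    and "tensor_f (e_A n i) (f_A n i) b = Some b' \<Longrightarrow> b' \<in> ambient_set g n r s"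
proof -
  have e: "in_factor n t' x" if "in_factor n t x" "e_A n i t = Some t'" for t t' x
    using that e_A_rectangular(1) assms(2,3) unfolding in_factor_def by blast
  have f: "in_factor n t' x" if "in_factor n t x" "f_A n i t = Some t'" for t t' x
    using that e_A_rectangular(2) assms(2,3) unfolding in_factor_def by blast
  show "tensor_e (e_A n i) (f_A n i) b = Some b' \<Longrightarrow> b' \<in> ambient_set g n r s"
    using power_e_closed [of "in_factor n", OF e] assms(1) by (simp add: tensor_e_def ambient_set_def)
  show "tensor_f (e_A n i) (f_A n i) b = Some b' \<Longrightarrow> b' \<in> ambient_set g n r s"
    using power_f_closed [of "in_factor n", OF f] assms(1) by (simp add: tensor_f_def ambient_set_def)
qed

text \<open>
  The relation that becomes the graph of the embedding, read from right to left.
\<close>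

definition same_tableau :: "affine_type \<Rightarrow> nat \<Rightarrow> nat \<Rightarrow> nat \<Rightarrow> nat list list \<Rightarrow> nat list \<Rightarrow> bool" where
  "same_tableau g n r s b w \<longleftrightarrow> b \<in> ambient_set g n r s \<and> keq (concat b) w"

lemma same_tableau_tensor:
  assumes "same_tableau g n r s b w" "1 \<le> i" "i < 2 * n"
  shows "rel_option (same_tableau g n r s) (tensor_e (e_A n i) (f_A n i) b) (word_e n i w)"
    and "rel_option (same_tableau g n r s) (tensor_f (e_A n i) (f_A n i) b) (word_f n i w)"
proof -
  have b: "b \<in> ambient_set g n r s" "keq (concat b) w" using assms(1) by (auto simp: same_tableau_def)
  have ops: "e_A n i = raise i" "f_A n i = lower i" "word_e n i = raise i" "word_f n i = lower i"
    using assms(2,3) by (simp_all add: e_A_pos f_A_pos word_e_eq word_f_eq)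
  have "rel_option keq (map_option concat (tensor_e (raise i) (lower i) b)) (raise i w)"
    "rel_option keq (map_option concat (tensor_f (raise i) (lower i) b)) (lower i w)"
    unfolding tensor_concat using b(2) by (rule keq_raise, rule keq_lower)
  then show "rel_option (same_tableau g n r s) (tensor_e (e_A n i) (f_A n i) b) (word_e n i w)"
    "rel_option (same_tableau g n r s) (tensor_f (e_A n i) (f_A n i) b) (word_f n i w)"
    using ambient_set_tensor [OF b(1) _ assms(3)] assms(2,3) unfolding ops option.rel_map
    by (auto simp: same_tableau_def elim!: option.rel_cases)
qed

lemma rel_option_bind:
  "rel_option R x y \<Longrightarrow> (\<And>a b. R a b \<Longrightarrow> rel_option S (g a) (h b)) \<Longrightarrow>
   rel_option S (Option.bind x g) (Option.bind y h)"
  by (auto elim!: option.rel_cases)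

lemma rel_option_iterate:
  assumes "R a b" "\<And>a b. R a b \<Longrightarrow> rel_option R (g a) (h b)"
  shows "rel_option R (iterate g k a) (iterate h k b)"
  using assms(1)
proof (induction k arbitrary: a b)
  case (Suc k)
  show ?case
    unfolding iterate_Suc by (rule rel_option_bind [OF assms(2) [OF Suc.prems] Suc.IH])
qed simp

lemma rel_option_virtual:
  assumes "1 \<le> i" "i \<le> n" "R a b" 
    and "\<And>j a b. 1 \<le> j \<Longrightarrow> j < 2 * n \<Longrightarrow> R a b \<Longrightarrow> rel_option R (op1 j a) (op2 j b)"
  shows "rel_option R (virtual g n op1 i a) (virtual g n op2 i b)"
proof (cases "i < n")
  case True
  then show ?thesis
    unfolding virtual_def using assms(1,3) by (auto intro!: rel_option_bind [of R] assms(4))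
next
  case False
  then have "i = n" using assms by simp
  then show ?thesis
    unfolding virtual_def using assms(1,3) by (auto intro!: rel_option_iterate assms(4))
qed

lemma same_tableau_virtual:
  assumes "same_tableau g n r s b w" "1 \<le> i" "i \<le> n"
  shows "rel_option (same_tableau g n r s) (ambient_e g n i b) (virtual g n (word_e n) i w)"
    and "rel_option (same_tableau g n r s) (ambient_f g n i b) (virtual g n (word_f n) i w)"
  unfolding ambient_e_def ambient_f_def
  by (intro rel_option_virtual assms same_tableau_tensor, assumption+)+

lemma iterate_closed:
  assumes "iterate h k b = Some b'" "b \<in> A" "\<And>c c'. c \<in> A \<Longrightarrow> h c = Some c' \<Longrightarrow> c' \<in> A"
  shows "b' \<in> A"
  using assms(1,2)
proof (induction k arbitrary: b)
  case (Suc k)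
  then show ?case using assms(3) by (cases "h b") (auto simp: iterate_Suc)
qed auto

text \<open>
  For \<open>i \<noteq> 0\<close> the virtual operator does not involve the type A operator with index 0, so
  nothing is required of the latter then.
\<close>

lemma virtual_closed:
  assumes "virtual g n op i b = Some b'" "b \<in> A" "1 \<le> n" "i \<le> n"
    and cl: "\<And>j c c'. j < 2 * n \<Longrightarrow> (j = 0 \<Longrightarrow> i = 0) \<Longrightarrow> c \<in> A \<Longrightarrow> op j c = Some c' \<Longrightarrow> c' \<in> A"
  shows "b' \<in> A"
proof -
  consider "i = 0" | "0 < i" "i < n" | "0 < i" "i = n" using assms(4) by linarith
  then show ?thesis
  proof cases
    case 1
    then have "iterate (op 0) (gam' g) b = Some b'" using assms(1) by (simp add: virtual_def)
    then show ?thesis by (rule iterate_closed [OF _ assms(2) cl]) (use 1 assms(3) in auto)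
  next
    case 2
    then obtain c where "op i b = Some c" "op (2 * n - i) c = Some b'"
      using assms(1) by (auto simp: virtual_def bind_eq_Some_conv)
    then show ?thesis using cl [of i b c] cl [of "2 * n - i" c b'] assms(2) 2 by simp
  next
    case 3
    then have "iterate (op n) (gam g) b = Some b'" using assms(1) by (simp add: virtual_def)
    then show ?thesis by (rule iterate_closed [OF _ assms(2) cl]) (use 3 in auto)
  qed
qed

lemma ambient_set_virtual:
  assumes "b \<in> ambient_set g n r s" "1 \<le> n" "i \<le> n"
  shows "ambient_e g n i b = Some b' \<Longrightarrow> b' \<in> ambient_set g n r s"
    and "ambient_f g n i b = Some b' \<Longrightarrow> b' \<in> ambient_set g n r s"
  unfolding ambient_e_def ambient_f_def
  using virtual_closed [OF _ assms, of g] ambient_set_tensor [OF _ assms(2)] by blast+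

lemma highest_tableau_rectangle:
  assumes "1 \<le> a" "a \<le> N"
  shows "highest_tableau N (\<lambda>i. if 1 \<le> i \<and> i \<le> a then s else 0) = canonical (replicate s a)"
proof -
  have "{i \<in> {1..N}. j \<le> (if 1 \<le> i \<and> i \<le> a then s else 0)} = {1..a}" if "1 \<le> j" "j \<le> s" for j
    using that assms by auto
  then have "map (\<lambda>j. highest_column (card {i \<in> {1..N}. j \<le> (if 1 \<le> i \<and> i \<le> a then s else 0)})) [1..<Suc s] =
    replicate s (highest_column a)"
    by (intro replicate_eqI) auto
  then show ?thesis using assms(1) by (simp add: highest_tableau_def canonical_def)
qed

lemma canonical_rectangular: "1 \<le> a \<Longrightarrow> a \<le> 2 * n \<Longrightarrow> canonical (replicate s a) \<in> rectangular n a s"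
proof -
  assume a: "1 \<le> a" "a \<le> 2 * n"
  have "canonical (replicate s a) \<in> rect a s" unfolding canonical_def
    by (rule rectI [OF weak_ss_canonical]) (auto simp: sorted_wrt_replicate)
  moreover have "set (canonical (replicate s a)) \<subseteq> {1..2 * n}" using a by (auto simp: canonical_def)
  ultimately show ?thesis using a by (simp add: rectangular_eq)
qed

lemma ambient_highest_eq:
  assumes "1 \<le> r" "r \<le> n"
  shows "ambient_highest g n r s = map (\<lambda>(a, b). canonical (replicate b a)) (ambient g n r s)"
  using assms highest_tableau_rectangle [of _ "2 * n"]
  unfolding ambient_highest_def ambient_def by (auto split: affine_type.splits)

lemma ambient_highest_in:
  assumes "1 \<le> r" "r \<le> n" "1 \<le> s"
  shows "ambient_highest g n r s \<in> ambient_set g n r s"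
  using assms canonical_rectangular
  unfolding ambient_highest_eq [OF assms(1,2)] ambient_set_def in_factor_def
  by (auto simp: ambient_def split: affine_type.splits)

lemma V_rect_subset:
  assumes "1 \<le> r" "r \<le> n" "1 \<le> s"
  shows "carrier (V_rect g n r s) \<subseteq> ambient_set g n r s"
proof
  fix b assume "b \<in> carrier (V_rect g n r s)"
  then have "b \<in> generated (ambient_e g n ` {0..n} \<union> ambient_f g n ` {0..n}) (ambient_highest g n r s)"
    by (simp add: V_rect_def)
  then show "b \<in> ambient_set g n r s"
  proof induction
    case base
    then show ?case using ambient_highest_in assms by blast
  next
    case (step b h c)
    then show ?case using ambient_set_virtual [of b g n r s _ c] assms by auto
  qed
qed

lemma V_rect_step:
  assumes "b \<in> carrier (V_rect g n r s)" "i \<le> n" "ambient_e g n i b = Some c \<or> ambient_f g n i b = Some c"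
  shows "c \<in> carrier (V_rect g n r s)"
proof -
  have "ambient_e g n i \<in> ambient_e g n ` {0..n} \<union> ambient_f g n ` {0..n}"
    "ambient_f g n i \<in> ambient_e g n ` {0..n} \<union> ambient_f g n ` {0..n}" using assms(2) by auto
  then show ?thesis using assms(1,3) by (auto simp: V_rect_def intro: generated.step)
qed

lemma ambient_nonspin: "r \<le> n \<Longrightarrow> \<not> spin_case g n r \<Longrightarrow> ambient g n r s = [(2 * n - r, s), (r, s)]"
  by (cases g) (auto simp: ambient_def spin_case_def)

section \<open>Reaching the highest elements\<close>

definition column_of :: "nat set \<Rightarrow> nat list" where
  "column_of A = rev (sorted_list_of_set A)"

lemma column_of: "column (column_of A)"
  by (simp add: column_of_def sorted_wrt_rev)

lemma set_column_of: "finite A \<Longrightarrow> set (column_of A) = A"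
  by (simp add: column_of_def)

lemma column_eq_column_of: "column c \<Longrightarrow> set c = A \<Longrightarrow> c = column_of A"
  by (intro set_eq_column column_of) (auto simp: set_column_of)

lemma raise_column_of:
  assumes "finite A" "Suc i \<in> A" "i \<notin> A"
  shows "raise i (column_of A) = Some (column_of (insert i (A - {Suc i})))"
proof -
  have *: "Suc i \<in> set (column_of A)" "i \<notin> set (column_of A)" using assms by (auto simp: set_column_of)
  have "map (\<lambda>x. if x = Suc i then i else x) (column_of A) = column_of (insert i (A - {Suc i}))"
    by (rule column_eq_column_of [OF column_raise_column [OF column_of *]])
       (use assms in \<open>auto simp: set_column_of\<close>)
  then show ?thesis using column_raise [OF column_of *] by simp
qed

lemma concat_eq_same_length:
  assumes "concat as = concat bs" "length as = length bs" "\<And>a. a \<in> set as \<Longrightarrow> length a = k" "\<And>b. b \<in> set bs \<Longrightarrow> length b = k"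
  shows "as = bs"
  using assms(2,1,3,4) by (induction rule: list_induct2) auto

text \<open>
  The case of two factors, of \<open>2 * n - r\<close> and \<open>r\<close> rows.  The vertex belonging to a list \<open>ks\<close> has one left column
  for every member \<open>k\<close> of \<open>ks\<close>; the right factor never changes.
\<close>

locale nonspin =
  fixes g :: affine_type and n r s :: nat
  assumes r: "1 \<le> r" "r \<le> n" and s: "1 \<le> s" and nonspin: "\<not> spin_case g n r"
begin

abbreviation V where "V \<equiv> carrier (V_rect g n r s)"

abbreviation L where "L \<equiv> levi_column r (2 * n - r)"

definition right where "right = canonical (replicate s r)"

definition vertex where "vertex ks = [concat (map L ks), right]"

lemma set_L: "k \<le> r \<Longrightarrow> set (L k) = {1..k} \<union> {r + 1..2 * n - k}"
  using r by (simp add: set_levi_column)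

lemma vertex_highest: "vertex (replicate s r) \<in> V"
proof -
  have "L r = highest_column (2 * n - r)"
    by (intro set_eq_column column_levi_column) (use r in \<open>auto simp: set_L\<close>)
  then have "vertex (replicate s r) = ambient_highest g n r s"
    unfolding ambient_highest_eq [OF r] ambient_nonspin [OF r(2) nonspin] vertex_def right_def
    by (simp add: canonical_def)
  then show ?thesis by (simp add: V_rect_def generated.base)
qed

lemma V_left_rectangular: "[t2, t1] \<in> V \<Longrightarrow> t2 \<in> rectangular n (2 * n - r) s"
  using V_rect_subset [OF r s, of g] ambient_nonspin [OF r(2) nonspin]
  by (auto simp: ambient_set_def in_factor_def)

text \<open>
  The right factor is the start of the sequence of \<open>columns_with_one\<close> for \<open>r\<close> rows.  So \<open>\<phi>\<^sub>0 = 0\<close> there, and by the tensor rule the zero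
  operator acts in the left factor as long as it can.
\<close>

lemma string_length_f_0_right: "r < 2 * n \<Longrightarrow> string_length (f_A n 0) right = 0"
proof -
  \<comment> \<open>The column \<open>r \<dots> 2\<close> without its one.\<close>
  interpret R: columns_with_one n r s "replicate s (map Suc (highest_column (r - 1)))"
  proof
    have "map Suc (highest_column (r - 1)) @ [1] = highest_column r"
      by (rule set_eq_column) (use r in \<open>auto simp: column_snoc sorted_wrt_map image_Suc_atLeastAtMost\<close>)
    then show "weak_ss (map (\<lambda>d. d @ [1]) (replicate s (map Suc (highest_column (r - 1)))))"
      using weak_ss_canonical [of "replicate s r"] by (simp add: sorted_wrt_replicate)
  qed (use r in auto)
  have "map Suc (highest_column (r - 1)) @ [1] = highest_column r"
    by (rule set_eq_column) (use r in \<open>auto simp: column_snoc sorted_wrt_map image_Suc_atLeastAtMost\<close>)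
  then have "R.promoted 0 = right" using R.promoted_split [of 0] by (simp add: right_def canonical_def)
  then show ?thesis using R.string_length_promoted_0 [OF s] by simp
qed

lemma phi_right: "1 \<le> i \<Longrightarrow> i \<noteq> r \<Longrightarrow> phi i right = 0"
  unfolding right_def by (rule phi_canonical_replicate)

lemma raise_left:
  assumes "raise i t = Some t'" "1 \<le> i" "i < 2 * n" "i \<noteq> r"
  shows "tensor_e (e_A n i) (f_A n i) [t, right] = Some [t', right]"
proof -
  have "eps i t \<noteq> 0" using assms(1) raise_None_iff [of i t] by auto
  then show ?thesis
    using assms phi_right [of i] tensor_e_left [of "raise i" t t' "lower i" right]
    by (simp add: e_A_pos f_A_pos string_length_raise string_length_lower)
qed

text \<open>
  A column on its way from \<open>k + 1\<close> to \<open>k\<close>.  The missing letter \<open>j\<close> starts at 1 and arrives at \<open>k + 1\<close>; at the same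
  time the largest letter descends from \<open>2 * n\<close> to \<open>2 * n - k\<close>.
\<close>

definition moving :: "nat \<Rightarrow> nat \<Rightarrow> nat set" where
  "moving k j = ({1..k + 1} - {j}) \<union> {r + 1..2 * n - k - 1} \<union> {2 * n - j + 1}"

lemma mem_moving:
  "x \<in> moving k j \<longleftrightarrow> 1 \<le> x \<and> x \<le> k + 1 \<and> x \<noteq> j \<or> r + 1 \<le> x \<and> x \<le> 2 * n - k - 1 \<or> x = 2 * n - j + 1"
  by (auto simp: moving_def)

lemma finite_moving [simp]: "finite (moving k j)"
  by (simp add: moving_def)

lemma lower_columns_by_e_0:
  assumes "vertex (as @ replicate q (k + 1)) \<in> V" "\<And>a. a \<in> set as \<Longrightarrow> k + 1 \<le> a \<and> a \<le> r" "k < r"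
    and "length as + q = s" "gam' g dvd q"
  shows "[concat (map L as @ replicate q (column_of (moving k 1))), right] \<in> V"
proof -
  define ks where "ks = as @ replicate q (k + 1)"
  define d where "d a = rev ([2..<Suc a] @ [Suc r..<Suc (2 * n - a)])" for a
  have a: "2 * n - r \<ge> 1" "r + (2 * n - r) = 2 * n" using r by auto
  have ks: "1 \<le> a \<and> a \<le> r" if "a \<in> set ks" for a using that assms(2) [of a] assms(3) by (auto simp: ks_def)
  have L: "L a = d a @ [1]" if "1 \<le> a" "a \<le> r" for a
    using that r by (simp add: levi_column_def d_def upt_conv_Cons numeral_2_eq_2 del: upt_Suc)
  have mapL: "map L ks = map (\<lambda>d. d @ [1]) (map d ks)" using ks L by simp
  have rect: "concat (map L ks) \<in> rect (2 * n - r) s"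
    using V_left_rectangular assms(1) a(1) by (simp add: vertex_def ks_def rectangular_eq)
  have lens: "length c = 2 * n - r" if c: "c \<in> set (map L ks)" for c
  proof -
    obtain a where "c = L a" "a \<in> set ks" using c by auto
    moreover have "a \<le> 2 * n - r" using ks [of a] \<open>a \<in> set ks\<close> r by linarith
    ultimately show ?thesis using length_levi_column [of a r "2 * n - r"] ks [of a] by simp
  qed
  have weak: "weak_ss (map L ks)"
  proof -
    obtain cs where cs: "concat (map L ks) = concat cs" "weak_ss cs" "length cs = s" "\<forall>c \<in> set cs. length c = 2 * n - r"
      using rect by (rule rectE)
    have "map L ks = cs"
      by (rule concat_eq_same_length [OF cs(1)]) (use cs lens assms(4) in \<open>auto simp: ks_def\<close>)
    then show ?thesis using cs(2) by simp
  qed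
  interpret C: columns_with_one n "2 * n - r" s "map d ks"
  proof
    show "1 \<le> n" "1 \<le> 2 * n - r" "length (map d ks) = s" using r a assms(4) by (auto simp: ks_def)
    show "weak_ss (map (\<lambda>d. d @ [1]) (map d ks))" using weak mapL by simp
    fix c assume "c \<in> set (map d ks)"
    then obtain a where a: "c = d a" "a \<in> set ks" by auto
    have "length (L a) = 2 * n - r" using lens a by simp
    then show "Suc (length c) = 2 * n - r" using L [of a] ks a by simp
    fix x assume "x \<in> set c"
    then show "1 < x \<and> x < 2 * n" using ks [OF a(2)] a(1) r by (auto simp: d_def)
  qed
  have start: "C.promoted 0 = concat (map L ks)"
  proof -
    have "take s (map d ks) = map d ks" "drop s (map d ks) = []" using C.len(1) by auto
    then show ?thesis using C.promoted_split [of 0] unfolding mapL by simp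
  qed
  have one: "tensor_e (e_A n 0) (f_A n 0) [C.promoted p, right] = Some [C.promoted (Suc p), right]" if "p < s" for p
    using tensor_e_left [of "e_A n 0" _ _ "f_A n 0" right] C.e_A_promoted [OF that] C.string_length_promoted [OF that] string_length_f_0_right r by simp
  \<comment> \<open>The virtual operator takes \<open>\<gamma>'\<close> of these steps at once.\<close>
  have many: "iterate (tensor_e (e_A n 0) (f_A n 0)) m [C.promoted p, right] = Some [C.promoted (p + m), right]"
    if "p + m \<le> s" for p m
    using that by (induction m arbitrary: p) (auto simp: iterate_Suc one)
  have multiple: "gam' g * m \<le> s \<Longrightarrow> [C.promoted (gam' g * m), right] \<in> V" for m
  proof (induction m)
    case 0
    then show ?case using assms(1) start by (simp add: vertex_def ks_def)
  next
    case (Suc m)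
    then have "ambient_e g n 0 [C.promoted (gam' g * m), right] = Some [C.promoted (gam' g * Suc m), right]"
      using many [of "gam' g * m" "gam' g"] by (simp add: ambient_e_def virtual_def add.commute)
    then show ?case using V_rect_step [of _ g n r s 0] Suc by auto
  qed
  have "2 * n # d (k + 1) = column_of (moving k 1)"
    by (rule column_eq_column_of) (use r assms(3) in \<open>auto simp: d_def moving_def sorted_wrt_append sorted_wrt_rev\<close>)
  moreover have "map d ks = map d as @ replicate q (d (k + 1))" by (simp add: ks_def)
  moreover have "map (\<lambda>d. d @ [1]) (map d as) = map L as" using L assms(2) by force
  moreover have "take (s - q) (map d ks) = map d as" "drop (s - q) (map d ks) = replicate q (d (k + 1))"
    using assms(4) by (auto simp: ks_def)
  ultimately have "C.promoted q = concat (map L as @ replicate q (column_of (moving k 1)))"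
    using C.promoted_split [of q] assms(4) by (simp only: map_replicate)
  moreover have "[C.promoted q, right] \<in> V" using assms(4,5) multiple by auto
  ultimately show ?thesis by simp
qed

text \<open>
  The virtual \<open>e\<^sub>j\<close> moves the gap and the largest letter of one column, beginning with the leftmost of the
  moving columns.  The columns to the left in \<open>as\<close> contain both \<open>j\<close> and \<open>Suc j\<close> and stop below \<open>2 * n - j\<close>, so
  they are invisible for both type A operators.
\<close>

lemma lower_columns_by_e_j:
  assumes "[concat (map L as @ replicate q (column_of (moving k j))), right] \<in> V"
    and "\<And>a. a \<in> set as \<Longrightarrow> k + 1 \<le> a \<and> a \<le> r" "k < r" "1 \<le> j" "j \<le> k"
  shows "[concat (map L as @ replicate q (column_of (moving k (j + 1)))), right] \<in> V"
proof -
  define N where "N = 2 * n"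
  define state where
    "state i = concat (map L as @ replicate i (column_of (moving k (j + 1))) @ replicate (q - i) (column_of (moving k j)))" for i
  define mid where "mid = insert j (moving k j - {Suc j})"
  have bounds: "j < n" "j < N - k" "k + 1 < N - j" "r + 1 \<le> N - k" "k + 1 \<le> n" "j \<le> N"
    using r assms(3,5) unfolding N_def by auto
  have step: "ambient_e g n j [state i, right] = Some [state (Suc i), right]" if "i < q" for i
  proof -
    define u where "u = concat (map L as @ replicate i (column_of (moving k (j + 1))))"
    define v where "v = concat (replicate (q - Suc i) (column_of (moving k j)))"
    have "q - i = Suc (q - Suc i)" using that by simp
    then have st: "state i = u @ column_of (moving k j) @ v" "state (Suc i) = u @ column_of (moving k (j + 1)) @ v"
      by (simp_all add: state_def u_def v_def replicate_app_Cons_same [symmetric])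
    have u_cols: "column c \<and> (set c = moving k (j + 1) \<or> (\<exists>a. k + 1 \<le> a \<and> a \<le> r \<and> set c = {1..a} \<union> {r + 1..N - a}))"
      if c: "c \<in> set (map L as @ replicate i (column_of (moving k (j + 1))))" for c
    proof -
      consider a where "a \<in> set as" "c = L a" | "c = column_of (moving k (j + 1))"
        using c by (auto split: if_splits)
      then show ?thesis
      proof cases
        case (1 a)
        then have "k + 1 \<le> a" "a \<le> r" using assms(2) by auto
        then show ?thesis using 1(2) set_L [of a] column_levi_column [of a r] by (auto simp: N_def)
      qed (simp add: column_of set_column_of)
    qed
    have arith: "r \<le> n" "j \<le> k" "k < r" "1 \<le> j" using r assms(3-5) by auto
    have eps_u: "eps p u = 0" if p: "p = j \<or> p = N - j" for p unfolding u_def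
    proof (rule eps_concat_0)
      fix c assume "c \<in> set (map L as @ replicate i (column_of (moving k (j + 1))))"
      then have c: "column c" "set c = moving k (j + 1) \<or> (\<exists>a. k + 1 \<le> a \<and> a \<le> r \<and> set c = {1..a} \<union> {r + 1..N - a})"
        using u_cols by blast+
      have "Suc p \<in> set c \<Longrightarrow> p \<in> set c"
        using c(2)
      proof (elim disjE exE conjE)
        assume "set c = moving k (j + 1)" "Suc p \<in> set c"
        then show "p \<in> set c" using p arith unfolding mem_moving N_def by (simp only: mem_moving) linarith
      next
        fix a assume "k + 1 \<le> a" "a \<le> r" "set c = {1..a} \<union> {r + 1..N - a}" "Suc p \<in> set c"
        then show "p \<in> set c" using p arith unfolding N_def by (simp only: Un_iff atLeastAtMost_iff) linarith
      qed
      then show "eps p c = 0" by (auto simp: column_eps [OF c(1)])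
    qed
    have phi_v: "phi p v = 0" if p: "p = j \<or> p = N - j" for p unfolding v_def
    proof (rule phi_concat_0)
      fix c assume "c \<in> set (replicate (q - Suc i) (column_of (moving k j)))"
      then have "c = column_of (moving k j)" by simp
      moreover have "p \<notin> moving k j" using p arith unfolding mem_moving N_def by linarith
      ultimately show "phi p c = 0" by (simp add: column_phi [OF column_of] set_column_of)
    qed
    have raise1: "raise j (column_of (moving k j)) = Some (column_of mid)" unfolding mid_def
    proof (rule raise_column_of)
      show "Suc j \<in> moving k j" "j \<notin> moving k j" using arith unfolding mem_moving by linarith+
    qed simp
    have mem_mid: "x \<in> mid \<longleftrightarrow> x = j \<or> x \<in> moving k j \<and> x \<noteq> Suc j" for x by (auto simp: mid_def)
    have raise2: "raise (N - j) (column_of mid) = Some (column_of (moving k (j + 1)))"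
    proof -
      have "raise (N - j) (column_of mid) = Some (column_of (insert (N - j) (mid - {Suc (N - j)})))"
      proof (rule raise_column_of)
        show "Suc (N - j) \<in> mid" "N - j \<notin> mid" using arith unfolding mem_mid mem_moving N_def by linarith+
      qed (simp add: mid_def)
      moreover have "insert (N - j) (mid - {Suc (N - j)}) = moving k (j + 1)"
      proof (rule set_eqI)
        fix x
        have "x = N - j \<or> x \<in> mid \<and> x \<noteq> Suc (N - j) \<longleftrightarrow> x \<in> moving k (j + 1)"
          using arith unfolding mem_mid mem_moving N_def by linarith
        then show "x \<in> insert (N - j) (mid - {Suc (N - j)}) \<longleftrightarrow> x \<in> moving k (j + 1)" by auto
      qed
      ultimately show ?thesis by simp
    qed
    have "raise j (state i) = Some (u @ column_of mid @ v)"
      unfolding st by (rule raise_middle [OF eps_u phi_v raise1]) simp_all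
    moreover have "raise (N - j) (u @ column_of mid @ v) = Some (state (Suc i))"
      unfolding st by (rule raise_middle [OF eps_u phi_v raise2]) simp_all
    ultimately show ?thesis
      using raise_left [of j "state i" "u @ column_of mid @ v"]
        raise_left [of "N - j" "u @ column_of mid @ v" "state (Suc i)"] bounds arith
      by (simp add: ambient_e_def virtual_def N_def)
  qed
  have "i \<le> q \<Longrightarrow> [state i, right] \<in> V" for i
  proof (induction i)
    case 0
    then show ?case using assms(1) by (simp add: state_def)
  next
    case (Suc i)
    then show ?case using V_rect_step [of _ g n r s j] step [of i] bounds(1) by auto
  qed
  from this [of q] show ?thesis by (simp add: state_def)
qed

lemma vertex_step:
  assumes "vertex (as @ replicate q (k + 1)) \<in> V" "\<And>a. a \<in> set as \<Longrightarrow> k + 1 \<le> a \<and> a \<le> r" "k < r"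
    and "length as + q = s" "gam' g dvd q"
  shows "vertex (as @ replicate q k) \<in> V"
proof -
  have "j \<le> k \<Longrightarrow> [concat (map L as @ replicate q (column_of (moving k (j + 1)))), right] \<in> V" for j
  proof (induction j)
    case 0
    then show ?case using lower_columns_by_e_0 [OF assms] by simp
  next
    case (Suc j)
    then show ?case using lower_columns_by_e_j [of as q k "Suc j"] assms(2,3) by simp
  qed
  moreover have "column_of (moving k (k + 1)) = L k"
    by (rule column_eq_column_of [symmetric])
       (use r assms(3) column_levi_column set_L [of k] in \<open>auto simp: moving_def\<close>)
  ultimately show ?thesis by (simp add: vertex_def) (metis add.commute le_refl plus_1_eq_Suc)
qed

text \<open>
  The list \<open>ks\<close> is approached by \<open>map (max k) ks\<close> for \<open>k\<close> from \<open>r\<close> down to 0.  In this way all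
  columns still have a one when the zero operator is applied.
\<close>

lemma vertex_in_V:
  assumes "sorted_wrt (\<ge>) ks" "\<And>k. k \<in> set ks \<Longrightarrow> k \<le> r" "length ks = s"
    and "\<And>k. k < r \<Longrightarrow> gam' g dvd length (filter (\<lambda>x. x \<le> k) ks)"
  shows "vertex ks \<in> V"
proof -
  have "vertex (map (max (r - d)) ks) \<in> V" if "d \<le> r" for d
    using that
  proof (induction d)
    case 0
    have "map (max r) ks = replicate s r"
      using assms(2,3) by (intro replicate_eqI) (auto simp: max_absorb1)
    then show ?case using vertex_highest by simp
  next
    case (Suc d)
    define k where "k = r - Suc d"
    have k: "r - d = k + 1" "k < r" using Suc.prems by (auto simp: k_def)
    define as where "as = takeWhile (\<lambda>x. k + 1 \<le> x) ks"
    define bs where "bs = dropWhile (\<lambda>x. k + 1 \<le> x) ks"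
    have ks: "ks = as @ bs" by (simp add: as_def bs_def)
    have as: "k + 1 \<le> x" if "x \<in> set as" for x using that unfolding as_def by (meson set_takeWhileD)
    have bs: "x \<le> k" if "x \<in> set bs" for x
    proof -
      have "bs \<noteq> []" using that by auto
      then have "\<not> k + 1 \<le> hd bs" unfolding bs_def by (rule hd_dropWhile)
      moreover have "x \<le> hd bs" using that assms(1) unfolding ks by (cases bs) (auto simp: sorted_wrt_append)
      ultimately show ?thesis by simp
    qed
    have 1: "map (max (k + 1)) ks = as @ replicate (length bs) (k + 1)"
    proof -
      have "map (max (k + 1)) as = as" using as by (intro map_idI) (auto simp: max_absorb2)
      moreover have "map (max (k + 1)) bs = replicate (length bs) (k + 1)"
        using bs by (intro replicate_eqI) (auto simp: le_SucI)
      ultimately show ?thesis unfolding ks by simp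
    qed
    have 2: "map (max k) ks = as @ replicate (length bs) k"
    proof -
      have "map (max k) as = as" using as by (intro map_idI) (force simp: max_absorb2)
      moreover have "map (max k) bs = replicate (length bs) k"
        using bs by (intro replicate_eqI) auto
      ultimately show ?thesis unfolding ks by simp
    qed
    have "filter (\<lambda>x. x \<le> k) as = []" using as by (force simp: filter_empty_conv)
    moreover have "filter (\<lambda>x. x \<le> k) bs = bs" using bs by simp
    ultimately have "filter (\<lambda>x. x \<le> k) ks = bs" unfolding ks by simp
    then have dvd: "gam' g dvd length bs" using assms(4) [OF k(2)] by simp
    have "vertex (as @ replicate (length bs) k) \<in> V"
    proof (rule vertex_step [OF _ _ k(2) _ dvd])
      show "vertex (as @ replicate (length bs) (k + 1)) \<in> V" using Suc k 1 by simp
      show "k + 1 \<le> a \<and> a \<le> r" if "a \<in> set as" for a using as [OF that] assms(2) [of a] that ks by auto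
      show "length as + length bs = s" using assms(3) ks by simp
    qed
    then show ?case using 2 by (simp add: k_def)
  qed
  moreover have "map (max 0) ks = ks" by (induction ks) auto
  ultimately show ?thesis by (metis diff_self_eq_0 le_refl)
qed

end

section \<open>The embedding\<close>

lemma rectangular_tableaux: "t \<in> rectangular n a s \<Longrightarrow> t \<in> tableaux"
  unfolding rectangular_def tableaux_def by blast

lemma ambient_length: "length (ambient g n r s) = 1 \<or> length (ambient g n r s) = 2"
  by (cases g) (auto simp: ambient_def)

lemma ambient_set_letters:
  assumes "b \<in> ambient_set g n r s"
  shows "set (concat b) \<subseteq> {1..2 * n}" "length (concat b) = num_letters g n r s"
proof -
  have "set (concat b) \<subseteq> {1..2 * n} \<and> length (concat b) = (\<Sum>(a, b) \<leftarrow> xs. a * b)"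
    if "list_all2 (in_factor n) b xs" for b xs
    using that
  proof (induction rule: list_all2_induct)
    case (Cons t b x xs)
    have "t \<in> rect (fst x) (snd x)" "set t \<subseteq> {1..2 * n}"
      using Cons.hyps(1) rectangular_eq [of "fst x" n "snd x"] unfolding in_factor_def by blast+
    then show ?case
      using Cons.IH length_rect [of t "fst x" "snd x"]
      by (simp only: concat.simps set_append Un_subset_iff length_append list.map sum_list.Cons case_prod_unfold
          mult.commute simp_thms)
  qed simp
  then show "set (concat b) \<subseteq> {1..2 * n}" "length (concat b) = num_letters g n r s"
    using assms by (auto simp: ambient_set_def num_letters_def)
qed

lemma ambient_set_inj:
  assumes "b \<in> ambient_set g n r s" "c \<in> ambient_set g n r s" "keq (concat b) (concat c)"
  shows "b = c"
proof -
  have z: "0 \<notin> set (concat b)" using ambient_set_letters(1) [OF assms(1)] by auto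
  consider x where "ambient g n r s = [x]" | x y where "ambient g n r s = [x, y]"
    using ambient_length [of g n r s] by (auto simp: length_Suc_conv numeral_2_eq_2)
  then show ?thesis
  proof cases
    case (1 x)
    then obtain t u where tu: "b = [t]" "c = [u]" "in_factor n t x" "in_factor n u x"
      using assms(1,2) by (auto simp: ambient_set_def list_all2_Cons2)
    then have "t = u" using keq_tableau_unique [of t u] z assms(3) rectangular_tableaux
      by (auto simp: in_factor_def)
    then show ?thesis using tu by simp
  next
    case (2 x y)
    then obtain t2 t1 u2 u1 where tu: "b = [t2, t1]" "c = [u2, u1]" "in_factor n t2 x" "in_factor n t1 y"
      "in_factor n u2 x" "in_factor n u1 y"
      using assms(1,2) by (auto simp: ambient_set_def list_all2_Cons2)
    then have "t2 = u2 \<and> t1 = u1"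
      using z assms(3) by (intro rect_pair_inj [of t2 "fst x" "snd x" t1 "fst y" "snd y"])
        (auto simp: in_factor_def rectangular_eq)
    then show ?thesis using tu by simp
  qed
qed

lemma V_weight_step:
  assumes "b \<in> carrier (V_weight g n N w)" "1 \<le> i" "i \<le> n"
    "virtual g n (word_e n) i b = Some c \<or> virtual g n (word_f n) i b = Some c"
  shows "c \<in> carrier (V_weight g n N w)"
proof -
  have "virtual g n (word_e n) i \<in> virtual g n (word_e n) ` {1..n} \<union> virtual g n (word_f n) ` {1..n}"
    "virtual g n (word_f n) i \<in> virtual g n (word_e n) ` {1..n} \<union> virtual g n (word_f n) ` {1..n}"
    using assms(2,3) by auto
  then show ?thesis using assms(1,4) by (auto simp: V_weight_def intro: generated.step)
qed

lemma V_weight_induct [consumes 2, case_names highest step]: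
  assumes "b \<in> carrier (V_weight g n N w)" "1 \<le> n"
    and "P (highest_tableau (2 * n) (partition_A g n N w))"
    and "\<And>b i c. b \<in> carrier (V_weight g n N w) \<Longrightarrow> P b \<Longrightarrow> 1 \<le> i \<Longrightarrow> i \<le> n \<Longrightarrow>
      virtual g n (word_e n) i b = Some c \<or> virtual g n (word_f n) i b = Some c \<Longrightarrow> P c"
  shows "P b"
proof -
  have "b \<in> generated (virtual g n (word_e n) ` {1..n} \<union> virtual g n (word_f n) ` {1..n})
                  (highest_tableau (2 * n) (partition_A g n N w))"
    using assms(1) by (simp add: V_weight_def)
  then show ?thesis
  proof induction
    case (step b h c)
    then have "b \<in> carrier (V_weight g n N w)" by (simp add: V_weight_def)
    then show ?case using step assms(4) [of b _ c] by auto
  qed (rule assms(3))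
qed

lemma V_weight_shape:
  assumes "b \<in> carrier (V_weight g n N w)" "1 \<le> n"
    and "highest_tableau (2 * n) (partition_A g n N w) = canonical hs" "sorted_wrt (\<ge>) hs"
  shows "\<exists>cs. weak_ss cs \<and> b = concat cs \<and> map length cs = hs"
  using assms(1,2)
proof (induction rule: V_weight_induct)
  case highest
  show ?case using assms(3,4)
    by (intro exI [of _ "map highest_column hs"]) (simp add: canonical_def weak_ss_canonical comp_def)
next
  case (step b i c)
  define A where "A = {b. \<exists>cs. weak_ss cs \<and> b = concat cs \<and> map length cs = hs}"
  have "b \<in> A" using step.IH by (simp add: A_def)
  have e: "c' \<in> A" if "c \<in> A" "raise j c = Some c'" for c c' j
    using that unfolding A_def by (auto elim: weak_ss_raise)
  have f: "c' \<in> A" if "c \<in> A" "lower j c = Some c'" for c c' j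
    using that unfolding A_def by (auto elim: weak_ss_lower)
  have ops: "word_e n j = raise j" "word_f n j = lower j" if "j < 2 * n" "j = 0 \<Longrightarrow> i = 0" for j
  proof -
    have "1 \<le> j" using that(2) step.hyps(2) by (cases j) auto
    then show "word_e n j = raise j" "word_f n j = lower j" using that(1) by (simp_all add: word_e_eq word_f_eq)
  qed
  from step.hyps(4) have "c \<in> A"
  proof
    assume "virtual g n (word_e n) i b = Some c"
    then show ?thesis using \<open>b \<in> A\<close> assms(2) step.hyps(3)
      by (rule virtual_closed) (metis e ops(1))
  next
    assume "virtual g n (word_f n) i b = Some c"
    then show ?thesis using \<open>b \<in> A\<close> assms(2) step.hyps(3)
      by (rule virtual_closed) (metis f ops(2))
  qed
  then show ?case by (simp add: A_def)
qed

text \<open>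
  One element above the highest tableau suffices: the operators carry existence from there to all of \<open>V(\<lambda>)\<close>.
  String lengths need no separate argument, since they are determined by the operators.
\<close>

lemma iota_exists_unique:
  assumes "1 \<le> r" "r \<le> n" "1 \<le> s"
    and "highest_tableau (2 * n) (partition_A g n (num_letters g n r s) lam) = canonical hs" "sorted_wrt (\<ge>) hs"
    and "b0 \<in> carrier (V_rect g n r s)" "keq (concat b0) (canonical hs)"
  shows "\<exists>!\<iota>. is_iota g n r s lam \<iota>"
proof -
  define L where "L = V_weight g n (num_letters g n r s) lam"
  define V where "V = V_rect g n r s"
  have n: "1 \<le> n" using assms by simp
  have VA: "b \<in> ambient_set g n r s" if "b \<in> carrier V" for b
    using that V_rect_subset [OF assms(1-3)] unfolding V_def by blast
  have tab: "b' \<in> tableaux" if "b' \<in> carrier L" for b'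
    using V_weight_shape [OF _ n assms(4,5)] that weak_ss_tableaux unfolding L_def by blast
  have ex: "\<exists>b \<in> carrier V. keq (concat b) b'" if "b' \<in> carrier L" for b'
    using that n unfolding L_def
  proof (induction rule: V_weight_induct)
    case highest
    then show ?case using assms(4,6,7) unfolding V_def by auto
  next
    case (step b' i c')
    then obtain b where b: "b \<in> carrier V" "keq (concat b) b'" by blast
    then have "same_tableau g n r s b b'" using VA by (simp add: same_tableau_def)
    note rel = same_tableau_virtual [OF this step.hyps(2,3)]
    have "\<exists>c. (ambient_e g n i b = Some c \<or> ambient_f g n i b = Some c) \<and> same_tableau g n r s c c'"
      using rel step.hyps(4) by (auto simp: option_rel_Some2)
    then obtain c where "ambient_e g n i b = Some c \<or> ambient_f g n i b = Some c" "same_tableau g n r s c c'" by blast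
    then show ?case using V_rect_step [of b g n r s i c] b(1) step.hyps(3) unfolding V_def same_tableau_def by blast
  qed
  have uniq: "b = c" if "b \<in> carrier V" "c \<in> carrier V" "keq (concat b) b'" "keq (concat c) b'" for b c b'
    using ambient_set_inj [OF VA VA] that keq_sym keq_trans by meson
  define \<iota> where "\<iota> = restrict (\<lambda>b'. THE b. b \<in> carrier V \<and> keq (concat b) b') (carrier L)"
  have iota: "\<iota> b' \<in> carrier V" "keq (concat (\<iota> b')) b'" if "b' \<in> carrier L" for b'
  proof -
    have "\<exists>!b. b \<in> carrier V \<and> keq (concat b) b'" using ex [OF that] uniq by blast
    from theI' [OF this] show "\<iota> b' \<in> carrier V" "keq (concat (\<iota> b')) b'" using that by (simp_all add: \<iota>_def)
  qed
  have iota_eq: "\<iota> b' = b" if "b' \<in> carrier L" "b \<in> carrier V" "keq (concat b) b'" for b b'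
    using iota [OF that(1)] that uniq by blast
  have sch: "schensted (concat b) = b' \<longleftrightarrow> keq (concat b) b'" if "b \<in> carrier V" "b' \<in> carrier L" for b b'
  proof -
    have "0 \<notin> set (concat b)" using ambient_set_letters(1) [OF VA [OF that(1)]] by auto
    then show ?thesis using schensted_eq_iff tab [OF that(2)] by blast
  qed
  have commute: "e_op V i (\<iota> b') = map_option \<iota> (e_op L i b')" "f_op V i (\<iota> b') = map_option \<iota> (f_op L i b')"
    if "b' \<in> carrier L" "i \<in> {1..n}" for b' i
  proof -
    have same: "same_tableau g n r s (\<iota> b') b'" using iota [OF that(1)] VA by (simp add: same_tableau_def)
    have i: "1 \<le> i" "i \<le> n" using that by auto
    have *: "x = map_option \<iota> y"
      if "rel_option (same_tableau g n r s) x y"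
        "\<And>c. x = Some c \<Longrightarrow> ambient_e g n i (\<iota> b') = Some c \<or> ambient_f g n i (\<iota> b') = Some c"
        "\<And>c. y = Some c \<Longrightarrow> virtual g n (word_e n) i b' = Some c \<or> virtual g n (word_f n) i b' = Some c" for x y
      using that(1)
    proof cases
      case (Some c c')
      have "c \<in> carrier V" using V_rect_step [of "\<iota> b'" g n r s i c] iota(1) [OF \<open>b' \<in> carrier L\<close>] i that(2) Some unfolding V_def by blast
      moreover have "c' \<in> carrier L" using V_weight_step [of b' g n _ lam i c'] \<open>b' \<in> carrier L\<close> i that(3) Some unfolding L_def by blast
      ultimately show ?thesis using Some iota_eq by (simp add: same_tableau_def)
    qed simp
    show "e_op V i (\<iota> b') = map_option \<iota> (e_op L i b')"
      unfolding V_def L_def V_rect_def V_weight_def crystal.simps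
      by (rule * [OF same_tableau_virtual(1) [OF same i]]) auto
    show "f_op V i (\<iota> b') = map_option \<iota> (f_op L i b')"
      unfolding V_def L_def V_rect_def V_weight_def crystal.simps
      by (rule * [OF same_tableau_virtual(2) [OF same i]]) auto
  qed
  have closed: "c \<in> carrier L" if "b' \<in> carrier L" "i \<in> {1..n}" "e_op L i b' = Some c \<or> f_op L i b' = Some c" for b' i c
    using V_weight_step [of b' g n _ lam i c] that unfolding L_def by (auto simp: V_weight_def)
  have embedding: "crystal_embedding {1..n} L V \<iota>"
    unfolding crystal_embedding_def
  proof (intro conjI ballI)
    show "\<iota> \<in> carrier L \<rightarrow> carrier V" using iota by auto
    show "inj_on \<iota> (carrier L)"
    proof (rule inj_onI)
      fix x y assume *: "x \<in> carrier L" "y \<in> carrier L" "\<iota> x = \<iota> y"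
      then have "keq x y" using iota(2) keq_sym keq_trans by metis
      moreover have "0 \<notin> set x"
        using ambient_set_letters(1) [OF VA [OF iota(1) [OF *(1)]]] keq_set [OF iota(2) [OF *(1)]] by auto
      ultimately show "x = y" using keq_tableau_unique tab * by blast
    qed
  next
    fix b' assume b': "b' \<in> carrier L"
    have "wt_A n (concat (\<iota> b')) = wt_A n b'" using keq_count [OF iota(2) [OF b']] by (simp add: wt_A_def fun_eq_iff)
    then show "wt V (\<iota> b') = wt L b'" by (simp add: V_def L_def V_rect_def V_weight_def virtual_wt_def)
    fix i assume i: "i \<in> {1..n}"
    show "string_length (e_op V i) (\<iota> b') = string_length (e_op L i) b'"
      by (rule string_length_transfer [where Q = "\<lambda>x. x \<in> carrier L"]) (use b' i commute closed in auto)
    show "string_length (f_op V i) (\<iota> b') = string_length (f_op L i) b'"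
      by (rule string_length_transfer [where Q = "\<lambda>x. x \<in> carrier L"]) (use b' i commute closed in auto)
    show "e_op V i (\<iota> b') = map_option \<iota> (e_op L i b')" "f_op V i (\<iota> b') = map_option \<iota> (f_op L i b')"
      using commute b' i by auto
  qed
  show ?thesis
  proof (rule ex1I [of _ \<iota>])
    show "is_iota g n r s lam \<iota>"
      unfolding is_iota_def Let_def L_def [symmetric] V_def [symmetric]
      using embedding iota iota_eq sch by (auto simp: \<iota>_def)
  next
    fix \<kappa> assume "is_iota g n r s lam \<kappa>"
    then have k: "\<kappa> \<in> extensional (carrier L)" "crystal_embedding {1..n} L V \<kappa>"
      "\<And>b' b. b' \<in> carrier L \<Longrightarrow> b \<in> carrier V \<Longrightarrow> \<kappa> b' = b \<longleftrightarrow> schensted (concat b) = b'"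
      unfolding is_iota_def Let_def L_def V_def by auto
    show "\<kappa> = \<iota>"
    proof (rule extensionalityI [OF k(1)])
      show "\<iota> \<in> extensional (carrier L)" by (simp add: \<iota>_def)
      show "\<kappa> b' = \<iota> b'" if "b' \<in> carrier L" for b'
        using k(3) [OF that iota(1) [OF that]] sch [OF iota(1) [OF that] that] iota(2) [OF that] by simp
    qed
  qed
qed

lemma iota_image:
  assumes "is_iota g n r s lam \<iota>" "b \<in> \<iota> ` carrier (V_weight g n (num_letters g n r s) lam)"
  shows "b \<in> carrier (V_rect g n r s)" "schensted (concat b) \<in> carrier (V_weight g n (num_letters g n r s) lam)"
proof -
  obtain b' where b': "b' \<in> carrier (V_weight g n (num_letters g n r s) lam)" "b = \<iota> b'" using assms(2) by blast
  have "\<iota> \<in> carrier (V_weight g n (num_letters g n r s) lam) \<rightarrow> carrier (V_rect g n r s)"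
    using assms(1) by (simp add: is_iota_def crystal_embedding_def Let_def)
  then show V: "b \<in> carrier (V_rect g n r s)" using b' by blast
  have "\<forall>b' \<in> carrier (V_weight g n (num_letters g n r s) lam). \<forall>b \<in> carrier (V_rect g n r s).
      \<iota> b' = b \<longleftrightarrow> schensted (concat b) = b'"
    using assms(1) by (simp add: is_iota_def Let_def)
  then have "schensted (concat b) = b'" using b' V by blast
  then show "schensted (concat b) \<in> carrier (V_weight g n (num_letters g n r s) lam)" using b' by simp
qed

section \<open>The highest tableau of a given weight\<close>

lemma sorted_conjugate:
  assumes "sorted_wrt (\<ge>) hs" "j < length hs"
  shows "Suc j \<le> length (filter (\<lambda>h. i \<le> h) hs) \<longleftrightarrow> i \<le> (hs ! j :: nat)"
  using assms
proof (induction hs arbitrary: j)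
  case (Cons h hs)
  show ?case
  proof (cases "i \<le> h")
    case True
    then show ?thesis using Cons by (cases j) auto
  next
    case False
    then have "filter (\<lambda>h. i \<le> h) (h # hs) = []" using Cons.prems(1) by (auto simp: filter_empty_conv)
    moreover have "(h # hs) ! j \<le> h" using Cons.prems by (cases j) auto
    ultimately show ?thesis using False by simp
  qed
qed simp

text \<open>
  The column heights in \<open>highest_tableau\<close> form the conjugate of \<open>p\<close>, and \<open>p\<close> is the conjugate of \<open>hs\<close>.
\<close>

lemma highest_tableau_counts:
  assumes "sorted_wrt (\<ge>) hs" "0 \<notin> set hs" "set hs \<subseteq> {..N}" "1 \<le> N"
    and "\<And>i. 1 \<le> i \<Longrightarrow> i \<le> N \<Longrightarrow> p i = length (filter (\<lambda>h. i \<le> h) hs)"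
  shows "highest_tableau N p = canonical hs"
proof -
  have "filter (\<lambda>h. 1 \<le> h) hs = hs" using assms(2) by (auto simp: filter_id_conv Suc_le_eq intro: gr0I)
  then have p1: "p 1 = length hs" using assms(4,5) by simp
  have "map (\<lambda>j. card {i \<in> {1..N}. j \<le> p i}) [1..<Suc (p 1)] = hs"
  proof (rule nth_equalityI)
    fix j assume "j < length (map (\<lambda>j. card {i \<in> {1..N}. j \<le> p i}) [1..<Suc (p 1)])"
    then have j: "j < length hs" using p1 by (simp del: upt_Suc)
    have "{i \<in> {1..N}. Suc j \<le> p i} = {1..hs ! j}"
      using sorted_conjugate [OF assms(1) j] assms(3,5) nth_mem [OF j] by fastforce
    then show "map (\<lambda>j. card {i \<in> {1..N}. j \<le> p i}) [1..<Suc (p 1)] ! j = hs ! j"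
      using j p1 by (simp del: upt_Suc)
  qed (simp add: p1 [unfolded One_nat_def] del: upt_Suc)
  then have "map highest_column (map (\<lambda>j. card {i \<in> {1..N}. j \<le> p i}) [1..<Suc (p 1)]) = map highest_column hs"
    by simp
  then show ?thesis unfolding highest_tableau_def canonical_def by (simp add: comp_def del: upt_Suc)
qed

text \<open>
  Two solutions differ by a constant on \<open>{1..2 * n}\<close>, and the number of cells shows that it is 0.
\<close>

lemma partition_A_eqI:
  assumes "1 \<le> n" "\<And>j. j \<notin> {1..2 * n} \<Longrightarrow> p j = 0"
    and "\<And>j. 1 \<le> j \<Longrightarrow> j \<le> 2 * n - 1 \<Longrightarrow> int (p j) - int (p (j + 1)) = Psi g n w j"
    and "(\<Sum>j = 1..2 * n. p j) = N"
  shows "partition_A g n N w = p"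
  unfolding partition_A_def
proof (rule the_equality)
  show "(\<forall>j. j \<notin> {1..2 * n} \<longrightarrow> p j = 0) \<and>
    (\<forall>j\<in>{1..2 * n - 1}. int (p j) - int (p (j + 1)) = Psi g n w j) \<and> (\<Sum>j = 1..2 * n. p j) = N"
    using assms by auto
next
  fix q assume q: "(\<forall>j. j \<notin> {1..2 * n} \<longrightarrow> q j = 0) \<and>
    (\<forall>j\<in>{1..2 * n - 1}. int (q j) - int (q (j + 1)) = Psi g n w j) \<and> (\<Sum>j = 1..2 * n. q j) = N"
  define d where "d = int (q 1) - int (p 1)"
  have diff: "int (q (Suc j)) = int (p (Suc j)) + d" if "Suc j \<le> 2 * n" for j
    using that
  proof (induction j)
    case (Suc j)
    have "Suc j \<in> {1..2 * n - 1}" using Suc.prems by auto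
    then have "int (q (Suc j)) - int (q (Suc j + 1)) = int (p (Suc j)) - int (p (Suc j + 1))"
      using q assms(3) [of "Suc j"] by auto
    then show ?case using Suc by simp
  qed (simp add: d_def)
  have diff': "int (q j) = int (p j) + d" if "j \<in> {1..2 * n}" for j
    using diff [of "j - 1"] that by simp
  have "int (\<Sum>j = 1..2 * n. q j) = (\<Sum>j = 1..2 * n. int (p j) + d)"
    using diff' by simp
  also have "\<dots> = int (\<Sum>j = 1..2 * n. p j) + int (2 * n) * d" by (simp add: sum.distrib)
  finally have "int (2 * n) * d = 0" using q assms(4) by linarith
  then have "d = 0" using assms(1) by simp
  show "q = p"
  proof
    fix j show "q j = p j" using q assms(2) [of j] diff' [of j] \<open>d = 0\<close> by (cases "j \<in> {1..2 * n}") auto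
  qed
qed

lemma Psi_eq:
  assumes "1 \<le> n" "1 \<le> j" "j \<le> 2 * n - 1"
  shows "Psi g n w j = (if j < n then w j else if j = n then int (gam g) * w n else w (2 * n - j))"
proof -
  \<comment> \<open>No other index contributes to the coefficient at \<open>j\<close>.\<close>
  define k where "k = (if j \<le> n then j else 2 * n - j)"
  have "Psi g n w j = (\<Sum>i = 1..n. if i = k then (if i < n then w i else int (gam g) * w n) else 0)"
    unfolding Psi_def by (intro sum.cong refl) (use assms in \<open>auto simp: fund_def k_def\<close>)
  also have "\<dots> = (if k < n then w k else int (gam g) * w n)"
    using assms by (subst sum.delta) (auto simp: k_def)
  finally show ?thesis using assms by (auto simp: k_def)
qed

text \<open>
  A highest element of the right weight lies above the highest tableau, because its content
  satisfies the conditions that define the partition.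
\<close>

lemma highest_element_tableau:
  assumes "b \<in> ambient_set g n r s" "1 \<le> n" "\<And>i. i \<ge> 1 \<Longrightarrow> eps i (concat b) = 0"
    and "\<And>j. 1 \<le> j \<Longrightarrow> j \<le> 2 * n - 1 \<Longrightarrow>
      int (count_list (concat b) j) - int (count_list (concat b) (j + 1)) = Psi g n lam j"
  obtains hs where "sorted_wrt (\<ge>) hs" "0 \<notin> set hs" "set hs \<subseteq> {..2 * n}" "keq (concat b) (canonical hs)"
    "highest_tableau (2 * n) (partition_A g n (num_letters g n r s) lam) = canonical hs"
proof -
  note letters = ambient_set_letters [OF assms(1)]
  have "0 \<notin> set (concat b)" using letters(1) by auto
  then obtain hs where hs: "sorted_wrt (\<ge>) hs" "0 \<notin> set hs" "keq (concat b) (canonical hs)"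
    using highest_word_keq_canonical [OF assms(3)] by blast
  have bounded: "set hs \<subseteq> {..2 * n}"
  proof
    fix h assume h: "h \<in> set hs"
    then have "h \<noteq> 0" using hs(2) by metis
    then have "h \<in> set (highest_column h)" by simp
    then have "h \<in> set (canonical hs)" using h unfolding canonical_def set_concat set_map by blast
    then show "h \<in> {..2 * n}" using letters(1) keq_set [OF hs(3)] by auto
  qed
  define p where "p j = (if j \<in> {1..2 * n} then count_list (concat b) j else 0)" for j
  have "partition_A g n (num_letters g n r s) lam = p"
  proof (rule partition_A_eqI [OF assms(2)])
    show "p j = 0" if "j \<notin> {1..2 * n}" for j using that unfolding p_def by presburger
    show "int (p j) - int (p (j + 1)) = Psi g n lam j" if "1 \<le> j" "j \<le> 2 * n - 1" for j
    proof -
      have "j \<in> {1..2 * n}" "j + 1 \<in> {1..2 * n}" using that assms(2) by auto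
      then show ?thesis using assms(4) [OF that] by (simp only: p_def if_True)
    qed
    have "(\<Sum>j = 1..2 * n. p j) = sum (count_list (concat b)) {1..2 * n}" by (simp add: p_def)
    also have "\<dots> = num_letters g n r s" using sum_count_set [OF letters(1)] letters(2) by simp
    finally show "(\<Sum>j = 1..2 * n. p j) = num_letters g n r s" .
  qed
  moreover have "highest_tableau (2 * n) p = canonical hs"
    by (rule highest_tableau_counts [OF hs(1,2) bounded])
       (use assms(2) count_canonical keq_count [OF hs(3)] in \<open>auto simp: p_def\<close>)
  ultimately show thesis using that hs bounded by simp
qed

section \<open>The number of cells beyond a column\<close>

lemma length_filter_drop:
  "sorted_wrt (\<ge>) hs \<Longrightarrow> length (filter (\<lambda>h. i \<le> h) (drop s hs)) = length (filter (\<lambda>h. i \<le> (h::nat)) hs) - s"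
proof (induction hs arbitrary: s)
  case (Cons h hs)
  show ?case
  proof (cases s)
    case (Suc s')
    show ?thesis
    proof (cases "i \<le> h")
      case True
      then show ?thesis using Cons Suc by simp
    next
      case False
      then have "filter (\<lambda>h. i \<le> h) hs = []" using Cons.prems(1) by (auto simp: filter_empty_conv)
      then show ?thesis using Cons Suc False by auto
    qed
  qed simp
qed simp

text \<open>
  Cells counted by columns and by rows.
\<close>

lemma sum_list_conjugate:
  "set hs \<subseteq> {..N} \<Longrightarrow> sum_list hs = (\<Sum>i = 1..N. length (filter (\<lambda>h. i \<le> h) hs))"
proof (induction hs)
  case (Cons h hs)
  have "(\<Sum>i = 1..N. length (filter (\<lambda>h. i \<le> h) (h # hs))) = (\<Sum>i = 1..N. of_bool (i \<le> h) + length (filter (\<lambda>h. i \<le> h) hs))"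
    by (intro sum.cong) auto
  also have "\<dots> = (\<Sum>i = 1..N. of_bool (i \<le> h)) + sum_list hs" using Cons by (simp add: sum.distrib)
  also have "(\<Sum>i = 1..N. of_bool (i \<le> h)) = (\<Sum>i = 1..h. 1 :: nat)"
    by (rule sum.mono_neutral_cong_right) (use Cons.prems in auto)
  finally show ?case by simp
qed simp

lemma cells_right_of:
  assumes "b' \<in> carrier (V_weight g n N lam)" "1 \<le> n" "highest_tableau (2 * n) (partition_A g n N lam) = canonical hs"
    and "sorted_wrt (\<ge>) hs" "0 \<notin> set hs" "set hs \<subseteq> {..2 * n}"
  shows "(\<Sum>c \<leftarrow> drop s (columns b'). length c) = (\<Sum>i = 1..2 * n. count_list (canonical hs) i - s)"
proof -
  obtain cs where cs: "weak_ss cs" "b' = concat cs" "map length cs = hs"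
    using V_weight_shape [OF assms(1-4)] by blast
  have "semistandard cs" using cs(1,3) assms(5) by (auto simp: semistandard_iff)
  then have "columns b' = cs" using cs(2) by (simp add: columns_concat)
  then have "(\<Sum>c \<leftarrow> drop s (columns b'). length c) = sum_list (drop s hs)" using cs(3) by (simp add: drop_map [symmetric])
  also have "\<dots> = (\<Sum>i = 1..2 * n. length (filter (\<lambda>h. i \<le> h) (drop s hs)))"
    using assms(6) set_drop_subset [of s hs] by (intro sum_list_conjugate) auto
  also have "\<dots> = (\<Sum>i = 1..2 * n. count_list (canonical hs) i - s)"
    by (intro sum.cong refl) (simp add: length_filter_drop [OF assms(4)] count_canonical)
  finally show ?thesis .
qed

section \<open>Weights of the highest elements\<close>

lemma phi_canonical_same: "1 \<le> r \<Longrightarrow> phi r (canonical (replicate s r)) = s"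
  by (induction s) (auto simp: phi_append phi_highest_column column_eps)

lemma count_canonical_replicate: "1 \<le> i \<Longrightarrow> count_list (canonical (replicate s a)) i = (if i \<le> a then s else 0)"
  by (simp add: count_canonical)

lemma spin_highest:
  assumes "spin_case g n r" "1 \<le> n" "1 \<le> s" "1 \<le> j" "j \<le> 2 * n - 1"
  shows "int (count_list (concat (ambient_highest g n r s)) j) - int (count_list (concat (ambient_highest g n r s)) (j + 1)) =
    Psi g n (\<lambda>j. int s * fund n j) j"
  using assms ambient_highest_eq [of r n g s]
  by (auto simp: spin_case_def ambient_def Psi_eq count_canonical_replicate fund_def)

primrec list_of_multiplicities :: "(nat \<Rightarrow> nat) \<Rightarrow> nat \<Rightarrow> nat list" where
  "list_of_multiplicities m 0 = []"
| "list_of_multiplicities m (Suc k) = replicate (m k) k @ list_of_multiplicities m k"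

lemma set_list_of_multiplicities: "set (list_of_multiplicities m k) \<subseteq> {..<k}"
  by (induction k) auto

lemma sorted_list_of_multiplicities: "sorted_wrt (\<ge>) (list_of_multiplicities m k)"
proof (induction k)
  case (Suc k)
  then show ?case using set_list_of_multiplicities [of m k] by (auto simp: sorted_wrt_append sorted_wrt_replicate)
qed simp

lemma count_list_of_replicate: "count_list (replicate k x) y = (if x = y then k else 0)"
  by (induction k) auto

lemma count_list_of_multiplicities: "count_list (list_of_multiplicities m k) i = (if i < k then m i else 0)"
  by (induction k) (auto simp: count_list_of_replicate less_Suc_eq)

lemma length_list_of_multiplicities: "length (list_of_multiplicities m k) = (\<Sum>i<k. m i)"
  by (induction k) auto

lemma length_filter_list_of_multiplicities: "j < k \<Longrightarrow> length (filter (\<lambda>x. x \<le> j) (list_of_multiplicities m k)) = (\<Sum>i\<le>j. m i)"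
proof (induction k)
  case (Suc k)
  show ?case
  proof (cases "j = k")
    case True
    have "filter (\<lambda>x. x \<le> j) (list_of_multiplicities m (Suc k)) = list_of_multiplicities m (Suc k)"
      using set_list_of_multiplicities [of m "Suc k"] True by (intro filter_True) auto
    then show ?thesis using True by (simp only: length_list_of_multiplicities lessThan_Suc_atMost)
  next
    case False
    then show ?thesis using Suc by auto
  qed
qed simp

lemma sum_list_of_multiplicities: "sum_list (list_of_multiplicities m k) = (\<Sum>i<k. i * m i)"
  by (induction k) (auto simp: sum_list_replicate mult.commute)

context nonspin
begin

text \<open>
  The column with parameter \<open>k\<close> has weight \<open>\<Lambda>\<^sub>k + \<Lambda>\<^bsub>2n-k\<^esub> - \<Lambda>\<^sub>r\<close>; the last term is cancelled by a column of
  the right factor.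
\<close>

lemma count_L:
  assumes "k \<le> r" "1 \<le> j" "j \<le> 2 * n - 1"
  shows "int (count_list (L k) j) - int (count_list (L k) (j + 1)) =
    of_bool (k = j) + of_bool (k = 2 * n - j) - of_bool (j = r)"
proof -
  have c: "count_list (L k) x = of_bool (1 \<le> x \<and> x \<le> k \<or> r + 1 \<le> x \<and> x \<le> 2 * n - k)" for x
    using count_column [OF column_levi_column [OF assms(1)]] set_L [OF assms(1)] by simp
  have low: "of_bool (1 \<le> j \<and> j \<le> k) - of_bool (1 \<le> j + 1 \<and> j + 1 \<le> k) = (of_bool (k = j) :: int)"
    using assms(2) by auto
  have high: "of_bool (r + 1 \<le> j \<and> j \<le> 2 * n - k) - of_bool (r + 1 \<le> j + 1 \<and> j + 1 \<le> 2 * n - k) =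
      (of_bool (k = 2 * n - j) - of_bool (j = r) :: int)"
  proof (cases "j < r")
    case True
    then have "k \<noteq> 2 * n - j" using assms(1) r by linarith
    then show ?thesis using True by simp
  next
    case False
    have "k = 2 * n - j \<longleftrightarrow> j = 2 * n - k" using assms r by linarith
    moreover have "r \<le> 2 * n - k" using assms(1) r by linarith
    ultimately show ?thesis using False by auto
  qed
  have disjoint: "of_bool (1 \<le> x \<and> x \<le> k \<or> r + 1 \<le> x \<and> x \<le> 2 * n - k) =
      (of_bool (1 \<le> x \<and> x \<le> k) + of_bool (r + 1 \<le> x \<and> x \<le> 2 * n - k) :: int)" for x
    using assms(1) by auto
  show ?thesis unfolding c of_nat_of_bool disjoint using low high by linarith
qed

lemma count_map_L:
  assumes "\<And>k. k \<in> set ks \<Longrightarrow> k \<le> r" "1 \<le> j" "j \<le> 2 * n - 1"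
  shows "int (count_list (concat (map L ks)) j) - int (count_list (concat (map L ks)) (j + 1)) =
    int (count_list ks j) + int (count_list ks (2 * n - j)) - int (length ks) * of_bool (j = r)"
  using assms(1)
proof (induction ks)
  case (Cons k ks)
  have head: "int (count_list (k # ks) x) = of_bool (k = x) + int (count_list ks x)" for x by simp
  have len: "int (length (k # ks)) * of_bool (j = r) = of_bool (j = r) + int (length ks) * of_bool (j = r)"
    by (simp add: algebra_simps)
  have IH: "int (count_list (concat (map L ks)) j) - int (count_list (concat (map L ks)) (j + 1)) =
    int (count_list ks j) + int (count_list ks (2 * n - j)) - int (length ks) * of_bool (j = r)"
    using Cons by simp
  have "k \<le> r" using Cons.prems by simp
  from count_L [OF this assms(2,3)] IH show ?case unfolding head len by simp
qed simp

lemma eps_L: "k \<le> r \<Longrightarrow> i \<ge> 1 \<Longrightarrow> i \<noteq> r \<Longrightarrow> eps i (L k) = 0"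
proof -
  assume *: "k \<le> r" "i \<ge> 1" "i \<noteq> r"
  then have "Suc i \<in> set (L k) \<Longrightarrow> i \<in> set (L k)" by (simp add: set_L) linarith
  then show ?thesis using * by (simp add: column_eps [OF column_levi_column])
qed

lemma eps_map_L: "\<forall>k \<in> set ks. k \<le> r \<Longrightarrow> eps r (concat (map L ks)) \<le> length ks"
proof (induction ks)
  case (Cons k ks)
  have "eps r (L k) \<le> 1" using Cons.prems by (simp add: column_eps [OF column_levi_column] of_bool_def)
  then show ?case using Cons by (auto simp: eps_append)
qed simp

lemma vertex_is_highest:
  assumes "\<And>k. k \<in> set ks \<Longrightarrow> k \<le> r" "length ks = s" "i \<ge> 1"
  shows "eps i (concat (vertex ks)) = 0"
proof -
  have "eps i (concat (map L ks)) \<le> phi i right"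
  proof (cases "i = r")
    case True
    then show ?thesis using eps_map_L [of ks] assms r phi_canonical_same [of r s] by (simp add: right_def)
  next
    case False
    then have "eps i (concat (map L ks)) = 0" using assms eps_L by (intro eps_concat_0) auto
    then show ?thesis by simp
  qed
  then show ?thesis using eps_canonical [OF assms(3)] by (simp add: vertex_def eps_append right_def)
qed

lemma vertex_weight:
  assumes "\<And>k. k \<in> set ks \<Longrightarrow> k \<le> r" "length ks = s" "1 \<le> j" "j \<le> 2 * n - 1"
    and "\<And>i. 1 \<le> i \<Longrightarrow> i \<le> r \<Longrightarrow> count_list ks i = m i"
    and "lam = (\<lambda>j. \<Sum>i = 1..r. int (m i * mu g n i) * fund i j)"
  shows "int (count_list (concat (vertex ks)) j) - int (count_list (concat (vertex ks)) (j + 1)) = Psi g n lam j"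
proof -
  have ks: "count_list ks i = (if i \<le> r then m i else 0)" if "1 \<le> i" for i
    using assms(1,5) that by (auto simp: count_list_0_iff)
  have lam: "lam i = (if i \<le> r then int (m i * mu g n i) else 0)" if "1 \<le> i" for i
  proof -
    have "lam i = (\<Sum>k = 1..r. if k = i then int (m i * mu g n i) else 0)"
      unfolding assms(6) by (intro sum.cong) (auto simp: fund_def)
    then show ?thesis using that by simp
  qed
  have mu: "mu g n i = 1" if "i < n" for i using that by (simp add: mu_def)
  have mun: "r = n \<Longrightarrow> gam g * mu g n n = 2" using nonspin by (cases g) (auto simp: spin_case_def mu_def)
  have "int (count_list (concat (vertex ks)) j) - int (count_list (concat (vertex ks)) (j + 1)) =
    int (count_list ks j) + int (count_list ks (2 * n - j))"
    using count_map_L [of ks j, OF assms(1) assms(3,4)] assms(2,3)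
    by (auto simp: vertex_def right_def count_canonical_replicate of_bool_def split: if_splits)
  also have "\<dots> = Psi g n lam j"
  proof -
    consider "j < n" | "j = n" "r < n" | "j = n" "r = n" | "n < j" using r by linarith
    then show ?thesis
    proof cases
      case 1
      then have "\<not> 2 * n - j \<le> r" using r by linarith
      then show ?thesis using 1 assms(3,4) r mu [of j] by (simp add: Psi_eq ks lam)
    next
      case 2
      then show ?thesis using assms(3,4) r by (simp add: Psi_eq ks lam)
    next
      case 3
      have "int (gam g) * (int (m n) * int (mu g n n)) = int (gam g * mu g n n) * int (m n)" by simp
      then have "int (gam g) * (int (m n) * int (mu g n n)) = 2 * int (m n)" unfolding mun [OF 3(2)] by simp
      then show ?thesis using 3 assms(3,4) r by (simp add: Psi_eq ks lam)
    next
      case 4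
      then show ?thesis using assms(3,4) r mu [of "2 * n - j"] by (simp add: Psi_eq ks lam)
    qed
  qed
  finally show ?thesis .
qed

lemma cells_of_vertex:
  assumes "\<And>k. k \<in> set ks \<Longrightarrow> k \<le> r" "length ks = s"
  shows "(\<Sum>i = 1..2 * n. count_list (concat (vertex ks)) i - s) = sum_list ks"
proof -
  have count: "count_list (L k) x = of_bool (1 \<le> x \<and> x \<le> k \<or> r + 1 \<le> x \<and> x \<le> 2 * n - k)" if "k \<le> r" for x k
    using count_column [OF column_levi_column [OF that]] set_L [OF that] by simp
  have le: "count_list (concat (map L ks)) i \<le> length ks" for i
    using assms(1)
  proof (induction ks)
    case (Cons k ks)
    have "count_list (L k) i \<le> 1" using count [of k i] Cons.prems by simp
    then show ?case using Cons by fastforce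
  qed simp
  have "(\<Sum>i = 1..2 * n. count_list (concat (vertex ks)) i - s) = (\<Sum>i = 1..r. length (filter (\<lambda>k. i \<le> k) ks))"
  proof (rule sum.mono_neutral_cong_right)
    show "\<forall>i\<in>{1..2 * n} - {1..r}. count_list (concat (vertex ks)) i - s = 0"
      using le assms(2) by (auto simp: vertex_def right_def count_canonical_replicate)
    show "count_list (concat (vertex ks)) i - s = length (filter (\<lambda>k. i \<le> k) ks)" if "i \<in> {1..r}" for i
      using that count_levi [of ks r i "2 * n - r"] assms(1) by (simp add: vertex_def right_def count_canonical_replicate)
  qed (use r in auto)
  also have "\<dots> = sum_list ks" using assms(1) by (subst sum_list_conjugate [of ks r]) auto
  finally show ?thesis .
qed

text \<open>
  The columns with \<open>k = 0\<close> make up for \<open>\<Sum> m\<^sub>i \<le> s\<close>.  Their number \<open>(s - m\<^sub>r) - (m\<^sub>1 + \<dots> + m\<^bsub>r-1\<^esub>)\<close> is divisible by \<open>\<gamma>'\<close>, and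
  so are all the partial sums that occur in \<open>vertex_in_V\<close>.
\<close>

lemma weight_multiplicities:
  fixes m :: "nat \<Rightarrow> nat"
  assumes "(\<Sum>i = 1..r. m i) \<le> s" "int (gam' g) dvd int s - int (m r)" "\<forall>i \<in> {1..r - 1}. gam' g dvd m i"
  obtains ks where "vertex ks \<in> V" "\<And>k. k \<in> set ks \<Longrightarrow> k \<le> r" "length ks = s"
    "\<And>i. 1 \<le> i \<Longrightarrow> i \<le> r \<Longrightarrow> count_list ks i = m i" "sum_list ks = (\<Sum>i = 1..r. i * m i)"
proof -
  \<comment> \<open>No truncation occurs in the subtraction, by the bound on the sum.\<close>
  define m' where "m' i = (if i = 0 then s - (\<Sum>i = 1..r. m i) else m i)" for i
  define ks where "ks = list_of_multiplicities m' (Suc r)"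
  have split: "(\<Sum>i<Suc r. f i) = f 0 + (\<Sum>i = 1..r. f i)" for f :: "nat \<Rightarrow> nat"
    by (simp add: lessThan_Suc_atMost atMost_atLeast0 sum.atLeast_Suc_atMost)
  have m': "(\<Sum>i = 1..r. m' i) = (\<Sum>i = 1..r. m i)" "(\<Sum>i = 1..r. i * m' i) = (\<Sum>i = 1..r. i * m i)"
    by (auto simp: m'_def intro!: sum.cong)
  have bound: "k \<le> r" if "k \<in> set ks" for k using that set_list_of_multiplicities [of m' "Suc r"] unfolding ks_def by auto
  have len: "length ks = s" unfolding ks_def length_list_of_multiplicities split m' using assms(1) by (simp add: m'_def)
  have dvd0: "gam' g dvd m' 0"
  proof -
    obtain r' where r': "r = Suc r'" using r by (cases r) auto
    have "gam' g dvd (\<Sum>i = 1..r'. m i)" using assms(3) r' by (intro dvd_sum) auto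
    then have "int (gam' g) dvd int (\<Sum>i = 1..r'. m i)" unfolding int_dvd_int_iff .
    with assms(2) have "int (gam' g) dvd int s - int (m r) - int (\<Sum>i = 1..r'. m i)" by (rule dvd_diff)
    also have "int s - int (m r) - int (\<Sum>i = 1..r'. m i) = int (m' 0)"
      using assms(1) by (simp add: m'_def r' of_nat_diff)
    finally show ?thesis by simp
  qed
  have "vertex ks \<in> V"
  proof (rule vertex_in_V)
    show "sorted_wrt (\<ge>) ks" unfolding ks_def by (rule sorted_list_of_multiplicities)
    show "gam' g dvd length (filter (\<lambda>x. x \<le> k) ks)" if "k < r" for k
    proof -
      have "length (filter (\<lambda>x. x \<le> k) ks) = (\<Sum>i\<le>k. m' i)" unfolding ks_def using that by (intro length_filter_list_of_multiplicities) simp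
      moreover have "gam' g dvd m' i" if "i \<le> k" for i
        using dvd0 assms(3) that \<open>k < r\<close> by (cases "i = 0") (auto simp: m'_def)
      ultimately show ?thesis by (auto intro: dvd_sum)
    qed
  qed (use bound len in auto)
  moreover have "count_list ks i = m i" if "1 \<le> i" "i \<le> r" for i
    using that unfolding ks_def count_list_of_multiplicities by (simp add: m'_def)
  moreover have "sum_list ks = (\<Sum>i = 1..r. i * m i)" unfolding ks_def sum_list_of_multiplicities split m' by simp
  ultimately show thesis using that bound len by blast
qed

end

theorem proposition6p18:
  fixes g :: affine_type and n r s :: nat and lam :: "nat \<Rightarrow> int"
  assumes "valid_rank g n"
    and "1 \<le> r" and "r \<le> n"
    and "s \<ge> 1"
    and "prescribed_weight g n r s lam"
  shows "(\<exists>!\<iota>. is_iota g n r s lam \<iota>) \<and>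
    (\<forall>\<iota>. is_iota g n r s lam \<iota> \<longrightarrow>
       (\<forall>b \<in> \<iota> ` carrier (V_weight g n (num_letters g n r s) lam).
          virtual_energy g r s b = prescribed_energy g n r s lam))"
proof (cases "spin_case g n r")
  case True
  have n: "1 \<le> n" using assms by simp
  have lam: "lam = (\<lambda>j. int s * fund n j)" using assms(5) True by (simp add: prescribed_weight_def)
  have one: "\<exists>x. ambient g n r s = [x]" using True by (auto simp: spin_case_def ambient_def)
  define b0 where "b0 = ambient_highest g n r s"
  have b0: "b0 \<in> carrier (V_rect g n r s)" by (simp add: b0_def V_rect_def generated.base)
  have b0': "b0 \<in> ambient_set g n r s" using ambient_highest_in [OF assms(2-4)] by (simp add: b0_def)
  have eps: "eps i (concat b0) = 0" if "i \<ge> 1" for i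
    using one unfolding b0_def ambient_highest_eq [OF assms(2,3)] by (auto simp: eps_canonical [OF that] split: prod.splits)
  obtain hs where hs: "sorted_wrt (\<ge>) hs" "0 \<notin> set hs" "set hs \<subseteq> {..2 * n}" "keq (concat b0) (canonical hs)"
    "highest_tableau (2 * n) (partition_A g n (num_letters g n r s) lam) = canonical hs"
    by (rule highest_element_tableau [OF b0' n eps, of lam])
       (use spin_highest [OF True n] assms(4) in \<open>auto simp: lam b0_def\<close>)
  show ?thesis
  proof (intro conjI allI impI ballI)
    show "\<exists>!\<iota>. is_iota g n r s lam \<iota>"
      by (rule iota_exists_unique [OF assms(2-4) hs(5,1) b0 hs(4)])
    fix \<iota> b assume *: "is_iota g n r s lam \<iota>" "b \<in> \<iota> ` carrier (V_weight g n (num_letters g n r s) lam)"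
    have "b \<in> ambient_set g n r s" using iota_image(1) [OF *] V_rect_subset [OF assms(2-4)] by blast
    then have "length b = 1" using one by (auto simp: ambient_set_def list_all2_Cons2)
    then show "virtual_energy g r s b = prescribed_energy g n r s lam"
      using True by (simp add: virtual_energy_def ambient_energy_def prescribed_energy_def)
  qed
next
  case False
  interpret nonspin g n r s by unfold_locales (use assms False in auto)
  have n: "1 \<le> n" using assms by simp
  obtain m :: "nat \<Rightarrow> nat" where m: "lam = (\<lambda>j. \<Sum>i = 1..r. int (m i * mu g n i) * fund i j)"
    "(\<Sum>i = 1..r. m i) \<le> s" "int (gam' g) dvd int s - int (m r)" "\<forall>i \<in> {1..r - 1}. gam' g dvd m i"
    using assms(5) False by (auto simp: prescribed_weight_def)
  obtain ks where ks: "vertex ks \<in> V" "\<And>k. k \<in> set ks \<Longrightarrow> k \<le> r" "length ks = s"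
    "\<And>i. 1 \<le> i \<Longrightarrow> i \<le> r \<Longrightarrow> count_list ks i = m i" "sum_list ks = (\<Sum>i = 1..r. i * m i)"
    using weight_multiplicities [OF m(2-4)] by blast
  have A: "vertex ks \<in> ambient_set g n r s" using ks(1) V_rect_subset [OF assms(2-4)] by blast
  obtain hs where hs: "sorted_wrt (\<ge>) hs" "0 \<notin> set hs" "set hs \<subseteq> {..2 * n}" "keq (concat (vertex ks)) (canonical hs)"
    "highest_tableau (2 * n) (partition_A g n (num_letters g n r s) lam) = canonical hs"
    by (rule highest_element_tableau [OF A n vertex_is_highest [OF ks(2,3)], of lam])
       (use vertex_weight [OF ks(2,3) _ _ ks(4) m(1)] in auto)
  show ?thesis
  proof (intro conjI allI impI ballI)
    show "\<exists>!\<iota>. is_iota g n r s lam \<iota>"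
      by (rule iota_exists_unique [OF assms(2-4) hs(5,1) ks(1) hs(4)])
    fix \<iota> b assume *: "is_iota g n r s lam \<iota>" "b \<in> \<iota> ` carrier (V_weight g n (num_letters g n r s) lam)"
    have "b \<in> ambient_set g n r s" using iota_image(1) [OF *] V_rect_subset [OF assms(2-4)] by blast
    then have "length b = 2"
      unfolding ambient_set_def ambient_nonspin [OF assms(3) False] by (auto simp: list_all2_Cons2)
    moreover have "(\<Sum>c \<leftarrow> drop s (columns (schensted (concat b))). length c) = (\<Sum>i = 1..2 * n. count_list (canonical hs) i - s)"
      by (rule cells_right_of [OF iota_image(2) [OF *] n hs(5,1,2,3)])
    moreover have "\<dots> = (\<Sum>i = 1..r. i * m i)"
      using cells_of_vertex [OF ks(2,3)] ks(5) keq_count [OF hs(4)] by simp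
    ultimately have "ambient_energy r s b = int (\<Sum>i = 1..r. i * m i) - int (r * s)"
      by (simp add: ambient_energy_def)
    then have "virtual_energy g r s b = (of_nat (\<Sum>i = 1..r. i * m i) - of_nat (r * s)) / of_nat (gam' g)"
      by (simp add: virtual_energy_def)
    also have "\<dots> = prescribed_energy g n r s lam"
    proof -
      have "r < n \<or> g \<in> {A2, A2_dagger}" using False assms(3) by (cases g) (auto simp: spin_case_def)
      from bilinear_form_explicit [OF assms(2,3) this, of m s] show ?thesis
        using False unfolding m(1) by (simp add: prescribed_energy_def)
    qed
    finally show "virtual_energy g r s b = prescribed_energy g n r s lam" .
  qed
qed

end
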